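(* For any $k$-CSP $(D,\mathcal R)$, any distribution $\rho$ over $\mathcal R$, any even $t$ with $2\le t\le k$, and any $\gamma>0$, there are $K=K(k,|D|,\gamma)$ and $C=C(k,|D|,t,\gamma)$ such that for any $m\ge Cn^{t/2}$, except with probability $o_n(1)$ over a $\rho$-random instance $\mathcal I$ with $n$ variables and $m$ independent constraints sampled with replacement, every pseudo-distribution $\mu$ of degree $K$ satisfies $\widetilde{\mathbb E}_\mu\mathrm{Val}_{\mathcal I}(x)\le\mathrm{opt}_t(\rho)+\gamma$.
   Context: A $k$-CSP $(D,\mathcal R)$: finite $D$, relations $R\subseteq D^k$; instance $\mathcal I=(V,\mathcal C)$ with multiset of constraints $(\sigma,R)$, $\sigma:[k]\to V$ injective. $\rho$-random instance with $m$ constraints with replacement: $m$ constraints drawn independently, each by choosing a uniformly random $k$-subset $e$ of the $n$ variables, a uniform bijection $\sigma:[k]\to e$, and $R\sim\rho$. $t$-wise $\nu$-independent distribution on $D^k$: all marginals on $t$-subsets $T\subseteq[k]$ equal $\nu^T$. $\mathrm{opt}_t(\rho)$ = maximum of $\mathbb E_{R\sim\rho}\Pr_{x\sim\mu^R}[x\in R]$ over distributions $\nu$ on $D$ and tuples $(\mu^R)_{R\in\mathcal R}$ of $t$-wise $\nu$-independent distributions. Pseudo-distributions: indeterminates $x_{v,a}$; degree-$d$ pseudo-distribution = linear functional $\widetilde{\mathbb E}_\mu$ on polynomials of degree $\le d$, $\widetilde{\mathbb E}_\mu[1]=1$, $\widetilde{\mathbb E}_\mu[q^2]\ge 0$ for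 $\deg q\le d/2$, $\widetilde{\mathbb E}_\mu[hq]=0$ for $h\in\{\sum_a x_{v,a}^2-1\}\cup\{x_{v,a}x_{v,a'}:a\neq a'\}$, $\deg(hq)\le d$. $\mathrm{Val}_{\mathcal I}(x)=\frac1{|\mathcal C|}\sum_{(\sigma,R)\in\mathcal C}\sum_{b\in R}\prod_{i=1}^kx_{\sigma(i),b_i}$. *)

theory Defs
  imports
    "HOL-Probability.Probability"
    "HOL-Library.Multiset"
    "HOL-Library.Poly_Mapping"
    "HOL-Library.Landau_Symbols"
begin

section \<open>Constraint satisfaction problems\<close>

text \<open>
  The index set \<open>[k]\<close> is \<open>{1..k}\<close>, and \<open>D\<^sup>k\<close> is the set of extensional functions from
  \<open>{1..k}\<close> to \<open>D\<close>.
\<close>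

definition k_csp :: "nat \<Rightarrow> 'a set \<Rightarrow> (nat \<Rightarrow> 'a) set set \<Rightarrow> bool" where
  "k_csp k D \<R> \<longleftrightarrow> finite D \<and> (\<forall>R\<in>\<R>. R \<subseteq> ({1..k} \<rightarrow>\<^sub>E D))"

type_synonym ('v, 'a) csp_constraint = "(nat \<Rightarrow> 'v) \<times> (nat \<Rightarrow> 'a) set"

type_synonym ('v, 'a) csp_instance = "'v set \<times> ('v, 'a) csp_constraint multiset"

text \<open>\<open>pmf_of_set\<close> is only meaningful on non-empty finite sets, so this requires \<open>k \<le> card V\<close>.\<close>

definition random_constraint ::
    "nat \<Rightarrow> (nat \<Rightarrow> 'a) set pmf \<Rightarrow> 'v set \<Rightarrow> ('v, 'a) csp_constraint pmf" where
  "random_constraint k \<rho> V =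
     do {
       e \<leftarrow> pmf_of_set {e. e \<subseteq> V \<and> card e = k};
       \<sigma> \<leftarrow> pmf_of_set {\<sigma> \<in> {1..k} \<rightarrow>\<^sub>E e. bij_betw \<sigma> {1..k} e};
       R \<leftarrow> \<rho>;
       return_pmf (\<sigma>, R)
     }"

definition random_instance ::
    "nat \<Rightarrow> (nat \<Rightarrow> 'a) set pmf \<Rightarrow> nat \<Rightarrow> nat \<Rightarrow> (nat, 'a) csp_instance pmf" where
  "random_instance k \<rho> n m =
     map_pmf (\<lambda>cs. ({..<n}, mset cs)) (replicate_pmf m (random_constraint k \<rho> {..<n}))"

section \<open>The optimum over \<open>t\<close>-wise independent distributions\<close>

text \<open>
  The marginal on \<open>T\<close> is the law of \<open>restrict x T\<close>; \<open>restrict\<close> and this instance of \<open>Pi_pmf\<close>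
  both take the value \<open>undefined\<close> outside \<open>T\<close>.
\<close>

definition twise_indep :: "nat \<Rightarrow> nat \<Rightarrow> 'a set \<Rightarrow> 'a pmf \<Rightarrow> (nat \<Rightarrow> 'a) pmf \<Rightarrow> bool" where
  "twise_indep t k D \<nu> \<mu> \<longleftrightarrow>
     set_pmf \<mu> \<subseteq> ({1..k} \<rightarrow>\<^sub>E D) \<and>
     (\<forall>T. T \<subseteq> {1..k} \<and> card T = t \<longrightarrow>
        map_pmf (\<lambda>x. restrict x T) \<mu> = Pi_pmf T undefined (\<lambda>_. \<nu>))"

text \<open>
  For non-empty \<open>D\<close> the set below is non-empty, bounded by 1 and, the feasible
  \<open>(\<nu>, \<mu>)\<close> forming a compact set, it has a maximum, which is its supremum.
\<close>

definition opt :: "nat \<Rightarrow> nat \<Rightarrow> 'a set \<Rightarrow> (nat \<Rightarrow> 'a) set set \<Rightarrow> (nat \<Rightarrow> 'a) set pmf \<Rightarrow> real" where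
  "opt t k D \<R> \<rho> =
     Sup {measure_pmf.expectation \<rho> (\<lambda>R. measure_pmf.prob (\<mu> R) R) | \<nu> \<mu>.
            set_pmf \<nu> \<subseteq> D \<and> (\<forall>R\<in>\<R>. twise_indep t k D \<nu> (\<mu> R))}"

section \<open>Polynomials and pseudo-distributions\<close>

text \<open>
  Real polynomials in indeterminates of type \<open>'x\<close>: finitely supported maps from monomials
  (finitely supported exponent vectors) to coefficients, multiplied by convolution.
\<close>

type_synonym 'x rpoly = "('x \<Rightarrow>\<^sub>0 nat) \<Rightarrow>\<^sub>0 real"

definition Var :: "'x \<Rightarrow> 'x rpoly" where
  "Var i = Poly_Mapping.single (Poly_Mapping.single i 1) 1"

definition Const :: "real \<Rightarrow> 'x rpoly" where
  "Const c = Poly_Mapping.single 0 c"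

definition poly_vars :: "'x rpoly \<Rightarrow> 'x set" where
  "poly_vars p = (\<Union>s\<in>Poly_Mapping.keys p. Poly_Mapping.keys s)"

text \<open>The zero polynomial gets degree 0.\<close>

definition total_degree :: "'x rpoly \<Rightarrow> nat" where
  "total_degree p =
     Max (insert 0 ((\<lambda>s. \<Sum>i\<in>Poly_Mapping.keys s. Poly_Mapping.lookup s i) ` Poly_Mapping.keys p))"

definition polys :: "'v set \<Rightarrow> 'a set \<Rightarrow> ('v \<times> 'a) rpoly set" where
  "polys V D = {p. poly_vars p \<subseteq> V \<times> D}"

definition polys_upto :: "nat \<Rightarrow> 'v set \<Rightarrow> 'a set \<Rightarrow> ('v \<times> 'a) rpoly set" where
  "polys_upto d V D = {p \<in> polys V D. total_degree p \<le> d}"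

definition assignment_axioms :: "'v set \<Rightarrow> 'a set \<Rightarrow> ('v \<times> 'a) rpoly set" where
  "assignment_axioms V D =
     {(\<Sum>a\<in>D. Var (v, a) ^ 2) - 1 | v. v \<in> V} \<union>
     {Var (v, a) * Var (v, a') | v a a'. v \<in> V \<and> a \<in> D \<and> a' \<in> D \<and> a \<noteq> a'}"

text \<open>
  A functional on \<open>polys_upto d V D\<close> is given by a total function whose values elsewhere are
  unconstrained.
\<close>

definition pseudo_distribution ::
    "nat \<Rightarrow> 'v set \<Rightarrow> 'a set \<Rightarrow> (('v \<times> 'a) rpoly \<Rightarrow> real) \<Rightarrow> bool" where
  "pseudo_distribution d V D E \<longleftrightarrow>
     (\<forall>p\<in>polys_upto d V D. \<forall>q\<in>polys_upto d V D. E (p + q) = E p + E q) \<and>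
     (\<forall>c. \<forall>p\<in>polys_upto d V D. E (Const c * p) = c * E p) \<and>
     E 1 = 1 \<and>
     (\<forall>q\<in>polys V D. real (total_degree q) \<le> real d / 2 \<longrightarrow> E (q ^ 2) \<ge> 0) \<and>
     (\<forall>h\<in>assignment_axioms V D. \<forall>q\<in>polys V D. total_degree (h * q) \<le> d \<longrightarrow> E (h * q) = 0)"

definition Val :: "nat \<Rightarrow> ('v, 'a) csp_instance \<Rightarrow> ('v \<times> 'a) rpoly" where
  "Val k I =
     Const (1 / real (size (snd I))) *
     (\<Sum>(\<sigma>, R)\<in>#snd I. \<Sum>b\<in>R. \<Prod>i=1..k. Var (\<sigma> i, b i))"

end

theory Submission
  imports Defs
begin

text \<open>The axioms give \<open>x\<^sup>3 = x\<close>, hence \<open>P \<le> P\<^sup>2\<close> for every monomial \<open>P\<close>, and the squares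
  \<open>x\<^sub>v\<^sub>,\<^sub>a\<^sup>2\<close> behave like the indicators of an assignment; only their pseudo-moments are used.
  Conditioning on boundedly many variables (a potential argument with the second moments of the
  local distributions as potential) makes the \<open>t\<close>-variable local distributions close, on average
  over all \<open>t\<close>-tuples, to products of the one-variable ones.

  For a fixed relation and a fixed \<open>t\<close>-subset of positions, average the local distributions over
  the constraints. Cutting the \<open>t\<close> positions in two halves makes this average a bilinear form in
  Gram vectors indexed by the \<open>n\<^bsup>t/2\<^esup>\<close> half-tuples. By Grothendieck's inequality its deviation from
  the average over all injective tuples is at most a constant times a maximum over signs, and
  Hoeffding's inequality with a union bound over the \<open>4 ^ n\<^bsup>t/2\<^esup>\<close> sign patterns controls the latter
  once \<open>m \<ge> C n\<^bsup>t/2\<^esup>\<close>; no logarithm is lost.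

  So for every relation the averaged local distribution on \<open>D\<^sup>k\<close> is almost \<open>t\<close>-wise
  \<open>\<nu>\<close>-independent, with one \<open>\<nu>\<close> for all relations. A small perturbation makes it exactly \<open>t\<close>-wise
  independent, and the definition of \<open>opt\<close> applies.\<close>

section \<open>Grothendieck's inequality\<close>

text \<open>The pseudo-distribution may be chosen after the instance, and conditioning ties it to
  the instance even more, so no concentration bound applies to it directly. The only random event is
  therefore a statement about sign patterns (\<open>good_instance\<close>), independent of any
  functional; Grothendieck's inequality extends it to all moment functionals at once, including the
  conditioned one.

  Conditioning controls correlations only between uniformly chosen tuples of variables, while the
  value looks only at constraint tuples. The sign event carries the independence from the former to
  the latter. Since the value must survive too, value and correlation are combined in one penalised
  objective, for which some outcome of the pinned variables does as well as the average.

  The number of pinned variables is bounded in terms of \<open>k\<close> rather than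
  \<open>t\<close>, so \<open>K\<close> does not depend on \<open>t\<close>. Normalising the local
  distributions of a relation divides by its frequency; hence rare relations are handled apart and
  paid for in full, which is affordable as there are at most \<open>2 ^ (card D ^ k)\<close>
  relations.\<close>

definition sg :: "'x set \<Rightarrow> 'x \<Rightarrow> real" where
  "sg S x = (if x \<in> S then 1 else - 1)"

lemma abs_sg [simp]: "\<bar>sg S x\<bar> = 1"
  by (simp add: sg_def)

text \<open>Cholesky elimination, one index at a time. If the diagonal entry is positive, the Schur
  complement is again positive semidefinite and the removed row supplies one new coordinate; if it
  is 0, positivity forces the whole row to be 0.\<close>

lemma gram_representation:
  fixes G :: "'i \<Rightarrow> 'i \<Rightarrow> real"
  assumes "finite I"
    and "\<And>i j. i \<in> I \<Longrightarrow> j \<in> I \<Longrightarrow> G i j = G j i"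
    and "\<And>c. 0 \<le> (\<Sum>i\<in>I. \<Sum>j\<in>I. c i * c j * G i j)"
  shows "\<exists>(d::nat) B. \<forall>i\<in>I. \<forall>j\<in>I. G i j = (\<Sum>l<d. B i l * B j l)"
  using assms
proof (induction I arbitrary: G rule: finite_induct)
  case empty
  then show ?case by simp
next
  case (insert z I)
  note sym = insert.prems(1) and psd = insert.prems(2)
  have quad: "0 \<le> x\<^sup>2 * G z z + 2 * x * (\<Sum>i\<in>I. c i * G z i) + (\<Sum>i\<in>I. \<Sum>j\<in>I. c i * c j * G i j)"
    for x and c :: "'i \<Rightarrow> real"
  proof -
    define c' where "c' = c(z := x)"
    have c': "c' z = x" "\<And>i. i \<in> I \<Longrightarrow> c' i = c i"
      using insert.hyps by (auto simp: c'_def)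
    have "(\<Sum>i\<in>insert z I. \<Sum>j\<in>insert z I. c' i * c' j * G i j) =
        x * x * G z z + (\<Sum>j\<in>I. x * c j * G z j) + ((\<Sum>i\<in>I. c i * x * G i z) +
         (\<Sum>i\<in>I. \<Sum>j\<in>I. c i * c j * G i j))"
      using insert.hyps by (simp add: c' sum.distrib)
    also have "(\<Sum>i\<in>I. c i * x * G i z) = (\<Sum>i\<in>I. x * c i * G z i)"
      using sym by (intro sum.cong) auto
    finally show ?thesis
      using psd[of c'] by (simp add: power2_eq_square sum_distrib_left mult.assoc algebra_simps)
  qed
  have zz: "0 \<le> G z z"
    using quad[of 1 "\<lambda>_. 0"] by simp
  show ?case
  proof (cases "G z z = 0")
    case True
    have z0: "G z j = 0" if j: "j \<in> I" for j
    proof (rule ccontr)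
      assume n: "G z j \<noteq> 0"
      \<comment> \<open>With \<open>x\<close> in coordinate \<open>z\<close> and 1 in coordinate
        \<open>j\<close>, the form would take the value -1.\<close>
      define x where "x = - (1 + G j j) / (2 * G z j)"
      have "(\<Sum>i\<in>I. (if i = j then 1 else 0) * G z i) = (\<Sum>i\<in>I. if i = j then G z j else 0)"
        by (intro sum.cong) auto
      also have "\<dots> = G z j" using j insert.hyps by simp
      finally have 1: "(\<Sum>i\<in>I. (if i = j then 1 else 0) * G z i) = G z j" .
      have "(\<Sum>i\<in>I. \<Sum>i'\<in>I. (if i = j then 1 else 0) * (if i' = j then 1 else 0) * G i i')
          = (\<Sum>i\<in>I. if i = j then \<Sum>i'\<in>I. if i' = j then G j j else 0 else 0)"
        by (intro sum.cong) (auto intro!: sum.cong sum.neutral)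
      also have "\<dots> = G j j" using j insert.hyps by simp
      finally have 2: "(\<Sum>i\<in>I. \<Sum>i'\<in>I. (if i = j then 1 else 0) * (if i' = j then 1 else 0) * G i i') = G j j" .
      have "0 \<le> 2 * x * G z j + G j j"
        using quad[of x "\<lambda>i. if i = j then 1 else 0"] unfolding 1 2 True by simp
      also have "2 * x * G z j = - (1 + G j j)" using n by (simp add: x_def)
      finally show False by simp
    qed
    have psd0: "0 \<le> (\<Sum>i\<in>I. \<Sum>j\<in>I. c i * c j * G i j)" for c
      using quad[of 0 c] by simp
    have "\<exists>(d::nat) B. \<forall>i\<in>I. \<forall>j\<in>I. G i j = (\<Sum>l<d. B i l * B j l)"
      by (rule insert.IH) (use sym psd0 in simp_all)
    then obtain d :: nat and B where
      B: "\<And>i j. i \<in> I \<Longrightarrow> j \<in> I \<Longrightarrow> G i j = (\<Sum>l<d. B i l * B j l)"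
      by metis
    define B' where "B' = B(z := (\<lambda>_. 0))"
    have "G i j = (\<Sum>l<d. B' i l * B' j l)" if "i \<in> insert z I" "j \<in> insert z I" for i j
      using that z0 True B insert.hyps sym[of i j] by (auto simp: B'_def)
    then show ?thesis by blast
  next
    case False
    with zz have pos: "0 < G z z" by simp
    define G' where "G' i j = G i j - G z i * G z j / G z z" for i j
    have psd': "0 \<le> (\<Sum>i\<in>I. \<Sum>j\<in>I. c i * c j * G' i j)" for c
    proof -
      define s where "s = (\<Sum>i\<in>I. c i * G z i)"
      have "(\<Sum>i\<in>I. \<Sum>j\<in>I. c i * c j * G' i j) =
          (\<Sum>i\<in>I. \<Sum>j\<in>I. c i * c j * G i j) - (\<Sum>i\<in>I. \<Sum>j\<in>I. (c i * G z i) * (c j * G z j)) / G z z"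
        by (simp add: G'_def algebra_simps sum_subtractf sum_divide_distrib)
      also have "(\<Sum>i\<in>I. \<Sum>j\<in>I. (c i * G z i) * (c j * G z j)) = s * s"
        by (simp add: s_def sum_product)
      finally have *: "(\<Sum>i\<in>I. \<Sum>j\<in>I. c i * c j * G' i j) =
          (\<Sum>i\<in>I. \<Sum>j\<in>I. c i * c j * G i j) - s * s / G z z" .
      \<comment> \<open>The value \<open>- s / G z z\<close> minimises the quadratic in
        \<open>x\<close> given by \<open>quad\<close>; the minimum is the form of the Schur
        complement \<open>G'\<close>.\<close>
      have "0 \<le> (- s / G z z)\<^sup>2 * G z z + 2 * (- s / G z z) * s + (\<Sum>i\<in>I. \<Sum>j\<in>I. c i * c j * G i j)"
        using quad[of "- s / G z z" c] by (simp add: s_def)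
      also have "(- s / G z z)\<^sup>2 * G z z + 2 * (- s / G z z) * s = - (s * s / G z z)"
        using pos by (simp add: field_simps power2_eq_square)
      finally show ?thesis unfolding * by simp
    qed
    have "\<exists>(d::nat) B. \<forall>i\<in>I. \<forall>j\<in>I. G' i j = (\<Sum>l<d. B i l * B j l)"
      by (rule insert.IH) (use sym psd' in \<open>simp_all add: G'_def\<close>)
    then obtain d :: nat and B where
      B: "\<And>i j. i \<in> I \<Longrightarrow> j \<in> I \<Longrightarrow> G' i j = (\<Sum>l<d. B i l * B j l)"
      by metis
    \<comment> \<open>Coordinate \<open>d\<close> carries the row of \<open>z\<close>;
      \<open>z\<close> itself has no other non-zero coordinate.\<close>
    define B' where "B' i l = (if l = d then G z i / sqrt (G z z) else if i = z then 0 else B i l)" for i l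
    have sq: "sqrt (G z z) * sqrt (G z z) = G z z" using pos by simp
    have "G i j = (\<Sum>l<Suc d. B' i l * B' j l)" if ij: "i \<in> insert z I" "j \<in> insert z I" for i j
    proof -
      have "(\<Sum>l<d. B' i l * B' j l) = G i j - G z i * G z j / G z z"
      proof (cases "i = z \<or> j = z")
        case True
        then have "(\<Sum>l<d. B' i l * B' j l) = 0"
          by (intro sum.neutral) (auto simp: B'_def)
        with True pos sym[of i j] ij show ?thesis by auto
      next
        case False
        with ij have "i \<in> I" "j \<in> I" by auto
        from B[OF this] False show ?thesis by (simp add: B'_def G'_def)
      qed
      then show ?thesis using pos by (simp add: B'_def sq)
    qed
    then show ?thesis by blast
  qed
qed

text \<open>A Rademacher sum: the subset \<open>S\<close> of \<open>{..<d}\<close> is the sign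
  vector, and sums over \<open>Pow {..<d}\<close> are expectations multiplied by
  \<open>2 ^ d\<close>.\<close>

definition rad_sum :: "(nat \<Rightarrow> real) \<Rightarrow> nat \<Rightarrow> nat set \<Rightarrow> real" where
  "rad_sum u d S = (\<Sum>l<d. u l * sg S l)"

lemma sum_Pow_lessThan_Suc:
  fixes f :: "nat set \<Rightarrow> real"
  shows "(\<Sum>S\<in>Pow {..<Suc d}. f S) = (\<Sum>S\<in>Pow {..<d}. f S + f (insert d S))"
proof -
  have "inj_on (insert d) (Pow {..<d})"
    by (rule inj_onI) (metis PowD insert_ident lessThan_iff less_irrefl subset_iff)
  moreover have "Pow {..<d} \<inter> insert d ` Pow {..<d} = {}" by auto
  ultimately show ?thesis
    by (simp add: lessThan_Suc Pow_insert sum.union_disjoint sum.reindex sum.distrib)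
qed

lemma rad_sum_Suc:
  assumes "S \<subseteq> {..<d}"
  shows "rad_sum u (Suc d) S = rad_sum u d S - u d"
    and "rad_sum u (Suc d) (insert d S) = rad_sum u d S + u d"
  using assms by (auto simp: rad_sum_def sg_def intro!: sum.cong)

text \<open>Cross terms cancel between \<open>S\<close> and \<open>insert d S\<close>. Rademacher
  sums thus represent vectors isometrically up to the factor \<open>2 ^ d\<close>, which allows
  vectors to be replaced by scalar functions.\<close>

lemma rad_sum_second_moment:
  "(\<Sum>S\<in>Pow {..<d}. rad_sum u d S * rad_sum w d S) = 2 ^ d * (\<Sum>l<d. u l * w l)"
proof (induction d)
  case 0
  then show ?case by (simp add: rad_sum_def)
next
  case (Suc d)
  have "(\<Sum>S\<in>Pow {..<Suc d}. rad_sum u (Suc d) S * rad_sum w (Suc d) S) =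
      (\<Sum>S\<in>Pow {..<d}. 2 * (rad_sum u d S * rad_sum w d S) + 2 * (u d * w d))"
    unfolding sum_Pow_lessThan_Suc
    by (intro sum.cong refl) (auto simp: rad_sum_Suc algebra_simps)
  also have "\<dots> = 2 ^ Suc d * (\<Sum>l<Suc d. u l * w l)"
    by (simp add: sum.distrib Suc card_Pow algebra_simps flip: sum_distrib_left)
  finally show ?case .
qed

text \<open>Khintchine's inequality for the fourth moment; in the induction, odd powers of the new
  sign cancel.\<close>

lemma rad_sum_fourth_moment:
  "(\<Sum>S\<in>Pow {..<d}. rad_sum u d S ^ 4) \<le> 2 ^ d * (3 * (\<Sum>l<d. (u l)\<^sup>2)\<^sup>2)"
proof (induction d)
  case 0
  then show ?case by (simp add: rad_sum_def)
next
  case (Suc d)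
  define s where "s = (\<Sum>l<d. (u l)\<^sup>2)"
  have 2: "(\<Sum>S\<in>Pow {..<d}. (rad_sum u d S)\<^sup>2) = 2 ^ d * s"
    using rad_sum_second_moment[of u d u] by (simp add: power2_eq_square s_def)
  have "(\<Sum>S\<in>Pow {..<Suc d}. rad_sum u (Suc d) S ^ 4) =
      (\<Sum>S\<in>Pow {..<d}. 2 * rad_sum u d S ^ 4 + 12 * (u d)\<^sup>2 * (rad_sum u d S)\<^sup>2 + 2 * u d ^ 4)"
    unfolding sum_Pow_lessThan_Suc
    by (intro sum.cong refl)
       (auto simp: rad_sum_Suc power2_eq_square power4_eq_xxxx algebra_simps)
  also have "\<dots> = 2 * (\<Sum>S\<in>Pow {..<d}. rad_sum u d S ^ 4) + 2 ^ d * (12 * (u d)\<^sup>2 * s + 2 * u d ^ 4)"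
    by (simp add: sum.distrib 2 card_Pow algebra_simps flip: sum_distrib_left)
  also have "\<dots> \<le> 2 * (2 ^ d * (3 * s\<^sup>2)) + 2 ^ d * (12 * (u d)\<^sup>2 * s + 2 * u d ^ 4)"
    using Suc by (simp add: s_def)
  also have "\<dots> = 2 ^ d * (6 * s\<^sup>2 + 12 * (u d)\<^sup>2 * s + 2 * u d ^ 4)"
    by (simp add: algebra_simps)
  \<comment> \<open>Raising the last coefficient from 2 to 6 completes the square
    \<open>6 * (s + (u d)\<^sup>2)\<^sup>2\<close>.\<close>
  also have "\<dots> \<le> 2 ^ d * (6 * s\<^sup>2 + 12 * (u d)\<^sup>2 * s + 6 * u d ^ 4)"
    by (intro mult_left_mono) auto
  also have "\<dots> = 2 ^ Suc d * (3 * (s + (u d)\<^sup>2)\<^sup>2)"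
    by (simp add: power2_eq_square power4_eq_xxxx algebra_simps)
  finally show ?case by (simp add: s_def)
qed

text \<open>Large values are sent to 0 and not to the boundary: the remainder
  \<open>x - clip x\<close> is then 0, or \<open>x\<close> with \<open>16 < x\<^sup>2\<close>, so
  its square is at most \<open>x ^ 4 / 16\<close>.\<close>

definition clip :: "real \<Rightarrow> real" where
  "clip x = (if \<bar>x\<bar> \<le> 4 then x else 0)"

text \<open>A bilinear form on a cube is largest at vertices: it is linear in each argument, so each
  argument in turn is replaced by the signs of its coefficients, at the cost of a factor
  \<open>b\<close>.\<close>

lemma bilinear_le_sign_bound:
  fixes A :: "'i \<Rightarrow> 'j \<Rightarrow> real"
  assumes sign: "\<And>S T. S \<subseteq> I \<Longrightarrow> T \<subseteq> J \<Longrightarrow> (\<Sum>i\<in>I. \<Sum>j\<in>J. A i j * (sg S i * sg T j)) \<le> \<tau>"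
    and x: "\<And>i. i \<in> I \<Longrightarrow> \<bar>x i\<bar> \<le> b" and y: "\<And>j. j \<in> J \<Longrightarrow> \<bar>y j\<bar> \<le> b" and "0 \<le> b"
  shows "(\<Sum>i\<in>I. \<Sum>j\<in>J. A i j * (x i * y j)) \<le> b * b * \<tau>"
proof -
  have le: "z * c \<le> b * (sg {i\<in>K. 0 \<le> h i} i * c)" if "i \<in> K" "\<bar>z\<bar> \<le> b" "h i = c"
    for z c :: real and h :: "'k \<Rightarrow> real" and i K
  proof -
    have "z * c \<le> \<bar>z\<bar> * \<bar>c\<bar>" by (simp flip: abs_mult)
    also have "\<dots> \<le> b * \<bar>c\<bar>" using that by (intro mult_right_mono) auto
    also have "\<bar>c\<bar> = sg {i\<in>K. 0 \<le> h i} i * c" using that by (auto simp: sg_def)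
    finally show ?thesis .
  qed
  \<comment> \<open>The signs \<open>S\<close> are chosen against the given \<open>y\<close>;
    \<open>T\<close> is then chosen against \<open>S\<close>, when \<open>x\<close> has been
    eliminated.\<close>
  define S where "S = {i\<in>I. 0 \<le> (\<Sum>j\<in>J. A i j * y j)}"
  define T where "T = {j\<in>J. 0 \<le> (\<Sum>i\<in>I. A i j * sg S i)}"
  have "(\<Sum>i\<in>I. \<Sum>j\<in>J. A i j * (x i * y j)) = (\<Sum>i\<in>I. x i * (\<Sum>j\<in>J. A i j * y j))"
    by (simp add: sum_distrib_left algebra_simps)
  also have "\<dots> \<le> (\<Sum>i\<in>I. b * (sg S i * (\<Sum>j\<in>J. A i j * y j)))"
    unfolding S_def by (intro sum_mono le) (auto simp: x)
  also have "\<dots> = b * (\<Sum>i\<in>I. \<Sum>j\<in>J. y j * (A i j * sg S i))"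
    by (simp add: sum_distrib_left algebra_simps)
  also have "\<dots> = b * (\<Sum>j\<in>J. y j * (\<Sum>i\<in>I. A i j * sg S i))"
    by (subst sum.swap) (simp add: sum_distrib_left)
  also have "\<dots> \<le> b * (\<Sum>j\<in>J. b * (sg T j * (\<Sum>i\<in>I. A i j * sg S i)))"
    unfolding T_def by (intro mult_left_mono sum_mono le) (auto simp: y \<open>0 \<le> b\<close>)
  also have "\<dots> = b * b * (\<Sum>j\<in>J. \<Sum>i\<in>I. A i j * (sg S i * sg T j))"
    by (simp add: sum_distrib_left algebra_simps)
  also have "\<dots> = b * b * (\<Sum>i\<in>I. \<Sum>j\<in>J. A i j * (sg S i * sg T j))"
    by (subst sum.swap) simp
  also have "\<dots> \<le> b * b * \<tau>"
    using sign[of S T] by (intro mult_left_mono) (auto simp: S_def T_def)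
  finally show ?thesis .
qed

text \<open>The dimension is not fixed: the bootstrap turns vectors of dimension \<open>d\<close>
  into vectors indexed by \<open>2 ^ d\<close> sign patterns, and these must lie in the same
  class.\<close>

definition sdp_values :: "('i \<Rightarrow> 'j \<Rightarrow> real) \<Rightarrow> 'i set \<Rightarrow> 'j set \<Rightarrow> real set" where
  "sdp_values A I J = {\<Sum>i\<in>I. \<Sum>j\<in>J. A i j * (\<Sum>l<d. u i l * w j l) | (d::nat) u w.
     (\<forall>i\<in>I. (\<Sum>l<d. (u i l)\<^sup>2) \<le> 1) \<and> (\<forall>j\<in>J. (\<Sum>l<d. (w j l)\<^sup>2) \<le> 1)}"

lemma abs_sum_mult_le_one:
  fixes u w :: "'l \<Rightarrow> real"
  assumes "(\<Sum>l\<in>L. (u l)\<^sup>2) \<le> 1" "(\<Sum>l\<in>L. (w l)\<^sup>2) \<le> 1"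
  shows "\<bar>\<Sum>l\<in>L. u l * w l\<bar> \<le> 1"
proof -
  have "\<bar>\<Sum>l\<in>L. u l * w l\<bar> \<le> (\<Sum>l\<in>L. ((u l)\<^sup>2 + (w l)\<^sup>2) / 2)"
  proof (rule order_trans[OF sum_abs sum_mono])
    fix l
    have "0 \<le> (\<bar>u l\<bar> - \<bar>w l\<bar>)\<^sup>2" by simp
    then show "\<bar>u l * w l\<bar> \<le> ((u l)\<^sup>2 + (w l)\<^sup>2) / 2"
      by (simp add: power2_diff abs_mult)
  qed
  also have "\<dots> = ((\<Sum>l\<in>L. (u l)\<^sup>2) + (\<Sum>l\<in>L. (w l)\<^sup>2)) / 2"
    by (simp add: sum.distrib flip: sum_divide_distrib)
  finally show ?thesis using assms by simp
qed

text \<open>Each inner product has modulus at most 1. Only for a finite supremum can an inequality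
  between it and \<open>7/8\<close> of itself be solved.\<close>

lemma bdd_above_sdp_values: "bdd_above (sdp_values A I J)"
proof (rule bdd_aboveI)
  fix v assume "v \<in> sdp_values A I J"
  then obtain d :: nat and u w where v: "v = (\<Sum>i\<in>I. \<Sum>j\<in>J. A i j * (\<Sum>l<d. u i l * w j l))"
    and "\<And>i. i \<in> I \<Longrightarrow> (\<Sum>l<d. (u i l)\<^sup>2) \<le> 1" "\<And>j. j \<in> J \<Longrightarrow> (\<Sum>l<d. (w j l)\<^sup>2) \<le> 1"
    unfolding sdp_values_def by blast
  then have "A i j * (\<Sum>l<d. u i l * w j l) \<le> \<bar>A i j\<bar>" if "i \<in> I" "j \<in> J" for i j
  proof -
    have "A i j * (\<Sum>l<d. u i l * w j l) \<le> \<bar>A i j\<bar> * \<bar>\<Sum>l<d. u i l * w j l\<bar>"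
      by (simp flip: abs_mult)
    also have "\<dots> \<le> \<bar>A i j\<bar> * 1"
      using that \<open>\<And>i. i \<in> I \<Longrightarrow> _\<close> \<open>\<And>j. j \<in> J \<Longrightarrow> _\<close>
      by (intro mult_left_mono abs_sum_mult_le_one) auto
    finally show ?thesis by simp
  qed
  then show "v \<le> (\<Sum>i\<in>I. \<Sum>j\<in>J. \<bar>A i j\<bar>)"
    unfolding v by (intro sum_mono)
qed

lemma sdp_value_le_Sup:
  assumes "finite L" "\<And>i. i \<in> I \<Longrightarrow> (\<Sum>l\<in>L. (u i l)\<^sup>2) \<le> 1" "\<And>j. j \<in> J \<Longrightarrow> (\<Sum>l\<in>L. (w j l)\<^sup>2) \<le> 1"
  shows "(\<Sum>i\<in>I. \<Sum>j\<in>J. A i j * (\<Sum>l\<in>L. u i l * w j l)) \<le> Sup (sdp_values A I J)"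
proof -
  obtain h where "bij_betw h {0..<card L} L"
    using ex_bij_betw_nat_finite assms(1) by blast
  then have h: "bij_betw h {..<card L} L" by (simp add: atLeast0LessThan)
  have r: "(\<Sum>l<card L. f (h l)) = (\<Sum>l\<in>L. f l)" for f :: "'a \<Rightarrow> real"
    by (rule sum.reindex_bij_betw[OF h])
  have "(\<Sum>i\<in>I. \<Sum>j\<in>J. A i j * (\<Sum>l<card L. u i (h l) * w j (h l))) \<in> sdp_values A I J"
    unfolding sdp_values_def using assms(2,3) r[of "\<lambda>l. (u i l)\<^sup>2" for i] r[of "\<lambda>l. (w j l)\<^sup>2" for j]
    by (intro CollectI exI[of _ "card L"] exI[of _ "\<lambda>i l. u i (h l)"] exI[of _ "\<lambda>j l. w j (h l)"]) auto
  then have "(\<Sum>i\<in>I. \<Sum>j\<in>J. A i j * (\<Sum>l<card L. u i (h l) * w j (h l))) \<le> Sup (sdp_values A I J)"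
    by (intro cSup_upper bdd_above_sdp_values)
  then show ?thesis using r[of "\<lambda>l. u i l * w j l" for i j] by simp
qed

text \<open>
  Replace the vectors by Rademacher sums, which have the same inner products, and clip these at 4.
  The clipped parts are controlled by signs; the tails have \<open>L\<^sup>2\<close> norm at most \<open>\<surd>3 / 4 \<le> 7/16\<close> by the
  fourth moment, so after rescaling they are again admissible vectors.
\<close>

lemma grothendieck_step:
  fixes A :: "'i \<Rightarrow> 'j \<Rightarrow> real"
  assumes sign: "\<And>S T. S \<subseteq> I \<Longrightarrow> T \<subseteq> J \<Longrightarrow> (\<Sum>i\<in>I. \<Sum>j\<in>J. A i j * (sg S i * sg T j)) \<le> \<tau>"
    and u: "\<And>i. i \<in> I \<Longrightarrow> (\<Sum>l<d. (u i l)\<^sup>2) \<le> 1" and w: "\<And>j. j \<in> J \<Longrightarrow> (\<Sum>l<d. (w j l)\<^sup>2) \<le> 1"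
  shows "(\<Sum>i\<in>I. \<Sum>j\<in>J. A i j * (\<Sum>l<(d::nat). u i l * w j l)) \<le> 16 * \<tau> + 7/8 * Sup (sdp_values A I J)"
proof -
  define \<Omega> where "\<Omega> = Pow {..<d}"
  define K :: real where "K = 2 ^ d"
  define s where "s = sqrt K"
  have K: "0 < K" "real (card \<Omega>) = K" and s: "s * s = K" "s > 0" and fin: "finite \<Omega>"
    by (auto simp: K_def \<Omega>_def card_Pow s_def)
  define X where "X v S = rad_sum v d S" for v S
  have sq: "(\<Sum>S\<in>\<Omega>. (X v S)\<^sup>2) \<le> K" "(\<Sum>S\<in>\<Omega>. (clip (X v S))\<^sup>2) \<le> K"
    "(\<Sum>S\<in>\<Omega>. (X v S - clip (X v S))\<^sup>2) \<le> 3/16 * K" if v: "(\<Sum>l<d. (v l)\<^sup>2) \<le> 1" for v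
  proof -
    have nn: "0 \<le> (\<Sum>l<d. (v l)\<^sup>2)" by (intro sum_nonneg) auto
    show 1: "(\<Sum>S\<in>\<Omega>. (X v S)\<^sup>2) \<le> K"
      using rad_sum_second_moment[of v d v] v
      by (simp add: X_def \<Omega>_def K_def power2_eq_square)
    have "(\<Sum>S\<in>\<Omega>. (clip (X v S))\<^sup>2) \<le> (\<Sum>S\<in>\<Omega>. (X v S)\<^sup>2)"
      by (intro sum_mono) (auto simp: clip_def)
    with 1 show "(\<Sum>S\<in>\<Omega>. (clip (X v S))\<^sup>2) \<le> K" by simp
    have "(x - clip x)\<^sup>2 \<le> x ^ 4 / 16" for x :: real
    proof (cases "\<bar>x\<bar> \<le> 4")
      case False
      then have "4\<^sup>2 \<le> \<bar>x\<bar>\<^sup>2" by (intro power_mono) auto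
      then have "16 * x\<^sup>2 \<le> x\<^sup>2 * x\<^sup>2" by (intro mult_right_mono) auto
      with False show ?thesis by (simp add: clip_def power4_eq_xxxx power2_eq_square algebra_simps)
    qed (simp add: clip_def)
    then have "(\<Sum>S\<in>\<Omega>. (X v S - clip (X v S))\<^sup>2) \<le> (\<Sum>S\<in>\<Omega>. X v S ^ 4 / 16)"
      by (intro sum_mono)
    also have "\<dots> \<le> K * (3 * (\<Sum>l<d. (v l)\<^sup>2)\<^sup>2) / 16"
      using rad_sum_fourth_moment[where u=v and d=d]
      by (simp add: X_def \<Omega>_def K_def flip: sum_divide_distrib)
    also have "\<dots> \<le> 3/16 * K"
      using nn v K by (simp add: power_le_one)
    finally show "(\<Sum>S\<in>\<Omega>. (X v S - clip (X v S))\<^sup>2) \<le> 3/16 * K" .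
  qed
  define B where "B f g = (\<Sum>i\<in>I. \<Sum>j\<in>J. A i j * (\<Sum>S\<in>\<Omega>. f i S * g j S))"
    for f :: "'i \<Rightarrow> nat set \<Rightarrow> real" and g :: "'j \<Rightarrow> nat set \<Rightarrow> real"
  have B_add: "B (\<lambda>i S. f i S + f' i S) g = B f g + B f' g"
    "B f (\<lambda>i S. g i S + g' i S) = B f g + B f g'" for f f' g g'
    by (simp_all add: B_def algebra_simps sum.distrib)
  have B_le: "B f g \<le> a * b * Sup (sdp_values A I J)"
    if "a > 0" "b > 0" "\<And>i. i \<in> I \<Longrightarrow> (\<Sum>S\<in>\<Omega>. (f i S)\<^sup>2) \<le> a\<^sup>2" "\<And>j. j \<in> J \<Longrightarrow> (\<Sum>S\<in>\<Omega>. (g j S)\<^sup>2) \<le> b\<^sup>2"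
    for a b f g
  proof -
    have "(\<Sum>i\<in>I. \<Sum>j\<in>J. A i j * (\<Sum>S\<in>\<Omega>. (f i S / a) * (g j S / b))) \<le> Sup (sdp_values A I J)"
      using that by (intro sdp_value_le_Sup fin)
        (simp_all add: power_divide divide_le_eq flip: sum_divide_distrib)
    moreover have "(\<Sum>i\<in>I. \<Sum>j\<in>J. A i j * (\<Sum>S\<in>\<Omega>. (f i S / a) * (g j S / b))) = B f g / (a * b)"
      by (simp add: B_def sum_divide_distrib sum_distrib_left)
    ultimately show ?thesis using that by (simp add: divide_le_eq mult_ac)
  qed
  define U where "U i S = X (u i) S" for i S
  define W where "W j S = X (w j) S" for j S
  define cU where "cU i S = clip (U i S)" for i S
  define cW where "cW j S = clip (W j S)" for j S
  \<comment> \<open>One factor is split at a time, so each of the two error terms pairs a tail with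
    a vector of norm at most \<open>s\<close>. At \<open>7/16\<close> each they add up to
    \<open>7/8\<close>, below 1 as the bootstrap demands.\<close>
  have "B U W = B (\<lambda>i S. cU i S + (U i S - cU i S)) W" by simp
  also have "\<dots> = B cU W + B (\<lambda>i S. U i S - cU i S) W"
    unfolding B_add ..
  also have "B cU W = B cU (\<lambda>i S. cW i S + (W i S - cW i S))" by simp
  also have "\<dots> = B cU cW + B cU (\<lambda>i S. W i S - cW i S)" unfolding B_add ..
  finally have split: "B U W = B cU cW + B cU (\<lambda>i S. W i S - cW i S) + B (\<lambda>i S. U i S - cU i S) W" .
  have small: "3/16 * K \<le> (7/16 * s)\<^sup>2" using s K by (simp add: power2_eq_square field_simps)
  have s2: "K = s\<^sup>2" using s by (simp add: power2_eq_square)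
  have U: "(\<Sum>S\<in>\<Omega>. (cU i S)\<^sup>2) \<le> s\<^sup>2" "(\<Sum>S\<in>\<Omega>. (U i S - cU i S)\<^sup>2) \<le> (7/16 * s)\<^sup>2" if "i \<in> I" for i
    using sq(2)[OF u[OF that]] order_trans[OF sq(3)[OF u[OF that]] small]
    by (simp_all add: cU_def U_def s2)
  have W: "(\<Sum>S\<in>\<Omega>. (W j S)\<^sup>2) \<le> s\<^sup>2" "(\<Sum>S\<in>\<Omega>. (W j S - cW j S)\<^sup>2) \<le> (7/16 * s)\<^sup>2" if "j \<in> J" for j
    using sq(1)[OF w[OF that]] order_trans[OF sq(3)[OF w[OF that]] small]
    by (simp_all add: cW_def W_def s2)
  have b1: "B cU (\<lambda>i S. W i S - cW i S) \<le> s * (7/16 * s) * Sup (sdp_values A I J)"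
    using s by (intro B_le U W) auto
  have b2: "B (\<lambda>i S. U i S - cU i S) W \<le> (7/16 * s) * s * Sup (sdp_values A I J)"
    using s by (intro B_le U W) auto
  have c1: "s * (7/16 * s) = 7/16 * K" and c2: "(7/16 * s) * s = 7/16 * K"
    using s by simp_all
  have "B cU cW = (\<Sum>S\<in>\<Omega>. \<Sum>i\<in>I. \<Sum>j\<in>J. A i j * (cU i S * cW j S))"
  proof -
    have "B cU cW = (\<Sum>i\<in>I. \<Sum>S\<in>\<Omega>. \<Sum>j\<in>J. A i j * (cU i S * cW j S))"
      unfolding B_def sum_distrib_left by (intro sum.cong refl sum.swap)
    also have "\<dots> = (\<Sum>S\<in>\<Omega>. \<Sum>i\<in>I. \<Sum>j\<in>J. A i j * (cU i S * cW j S))" by (rule sum.swap)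
    finally show ?thesis .
  qed
  \<comment> \<open>For a fixed sign pattern the clipped sums are scalars of modulus at most
    4.\<close>
  also have "\<dots> \<le> (\<Sum>S\<in>\<Omega>. 4 * 4 * \<tau>)"
    by (intro sum_mono bilinear_le_sign_bound sign) (auto simp: cU_def cW_def clip_def)
  finally have b3: "B cU cW \<le> K * (16 * \<tau>)" using K by simp
  have "K * (\<Sum>i\<in>I. \<Sum>j\<in>J. A i j * (\<Sum>l<d. u i l * w j l)) = B U W"
    unfolding B_def U_def W_def X_def \<Omega>_def K_def rad_sum_second_moment
    by (simp add: sum_distrib_left algebra_simps)
  also have "\<dots> \<le> K * (16 * \<tau>) + 2 * ((7/16 * K) * Sup (sdp_values A I J))"
    using split b1 b2 b3 unfolding c1 c2 by linarith
  also have "\<dots> = K * (16 * \<tau> + 7/8 * Sup (sdp_values A I J))" by (simp add: algebra_simps)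
  finally show ?thesis using K by simp
qed

text \<open>The supremum \<open>s\<close> satisfies \<open>s \<le> 16 * \<tau> + 7/8 * s\<close>;
  solving for \<open>s\<close> gives the constant 128.\<close>

theorem grothendieck:
  fixes A :: "'i \<Rightarrow> 'j \<Rightarrow> real"
  assumes sign: "\<And>S T. S \<subseteq> I \<Longrightarrow> T \<subseteq> J \<Longrightarrow> (\<Sum>i\<in>I. \<Sum>j\<in>J. A i j * (sg S i * sg T j)) \<le> \<tau>"
    and u: "\<And>i. i \<in> I \<Longrightarrow> (\<Sum>l<d. (u i l)\<^sup>2) \<le> 1" and w: "\<And>j. j \<in> J \<Longrightarrow> (\<Sum>l<d. (w j l)\<^sup>2) \<le> 1"
  shows "(\<Sum>i\<in>I. \<Sum>j\<in>J. A i j * (\<Sum>l<(d::nat). u i l * w j l)) \<le> 128 * \<tau>"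
proof -
  have "Sup (sdp_values A I J) \<le> 16 * \<tau> + 7/8 * Sup (sdp_values A I J)"
  proof (rule cSup_least)
    have "(\<Sum>i\<in>I. \<Sum>j\<in>J. A i j * (\<Sum>l<d. u i l * w j l)) \<in> sdp_values A I J"
      unfolding sdp_values_def using u w by blast
    then show "sdp_values A I J \<noteq> {}" by blast
  next
    fix v assume "v \<in> sdp_values A I J"
    then obtain d :: nat and u w where "v = (\<Sum>i\<in>I. \<Sum>j\<in>J. A i j * (\<Sum>l<d. u i l * w j l))"
      and "\<And>i. i \<in> I \<Longrightarrow> (\<Sum>l<d. (u i l)\<^sup>2) \<le> 1" "\<And>j. j \<in> J \<Longrightarrow> (\<Sum>l<d. (w j l)\<^sup>2) \<le> 1"
      unfolding sdp_values_def by blast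
    then show "v \<le> 16 * \<tau> + 7/8 * Sup (sdp_values A I J)"
      by (simp only:) (rule grothendieck_step[OF sign])
  qed
  moreover have "(\<Sum>i\<in>I. \<Sum>j\<in>J. A i j * (\<Sum>l<d. u i l * w j l)) \<le> Sup (sdp_values A I J)"
    using u w by (intro sdp_value_le_Sup) auto
  ultimately show ?thesis by simp
qed

text \<open>The form in which the inequality is used: the matrix is the push-forward of a weight on
  samples, and the vectors come from one positive semidefinite kernel on labels shared by rows and
  columns. The absolute value results from also negating the row vectors, by the factor
  \<open>e\<close>.\<close>

corollary grothendieck_kernel:
  fixes G :: "'q \<Rightarrow> 'q \<Rightarrow> real" and wt :: "'o \<Rightarrow> real"
  assumes "finite \<Omega>" and fin: "finite I" "finite J"
    and f: "\<And>\<omega>. \<omega> \<in> \<Omega> \<Longrightarrow> f \<omega> \<in> I" and g: "\<And>\<omega>. \<omega> \<in> \<Omega> \<Longrightarrow> g \<omega> \<in> J"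
    and sign: "\<And>S T. S \<subseteq> I \<Longrightarrow> T \<subseteq> J \<Longrightarrow> (\<Sum>\<omega>\<in>\<Omega>. wt \<omega> * (sg S (f \<omega>) * sg T (g \<omega>))) \<le> \<tau>"
    and Q: "finite Q" "\<And>i. i \<in> I \<Longrightarrow> p i \<in> Q" "\<And>j. j \<in> J \<Longrightarrow> p' j \<in> Q"
    and sym: "\<And>q q'. q \<in> Q \<Longrightarrow> q' \<in> Q \<Longrightarrow> G q q' = G q' q"
    and psd: "\<And>c. 0 \<le> (\<Sum>q\<in>Q. \<Sum>q'\<in>Q. c q * c q' * G q q')"
    and diag: "\<And>q. q \<in> Q \<Longrightarrow> G q q \<le> 1"
  shows "\<bar>\<Sum>\<omega>\<in>\<Omega>. wt \<omega> * G (p (f \<omega>)) (p' (g \<omega>))\<bar> \<le> 128 * \<tau>"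
proof -
  obtain d :: nat and B where B: "\<And>q q'. q \<in> Q \<Longrightarrow> q' \<in> Q \<Longrightarrow> G q q' = (\<Sum>l<d. B q l * B q' l)"
    using gram_representation[OF Q(1) sym psd] by blast
  define A where "A i j = (\<Sum>\<omega> | \<omega> \<in> \<Omega> \<and> f \<omega> = i \<and> g \<omega> = j. wt \<omega>)" for i j
  have A: "(\<Sum>i\<in>I. \<Sum>j\<in>J. A i j * h i j) = (\<Sum>\<omega>\<in>\<Omega>. wt \<omega> * h (f \<omega>) (g \<omega>))" for h
  proof -
    have "(\<Sum>i\<in>I. \<Sum>j\<in>J. A i j * h i j) = (\<Sum>x\<in>I \<times> J. \<Sum>\<omega> | \<omega> \<in> \<Omega> \<and> (f \<omega>, g \<omega>) = x. wt \<omega> * h (f \<omega>) (g \<omega>))"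
      unfolding sum.cartesian_product A_def
      by (intro sum.cong) (auto simp: sum_distrib_right intro!: sum.cong)
    also have "\<dots> = (\<Sum>\<omega>\<in>\<Omega>. wt \<omega> * h (f \<omega>) (g \<omega>))"
      using assms by (intro sum.group) auto
    finally show ?thesis .
  qed
  have diag': "(\<Sum>l<d. (B q l)\<^sup>2) \<le> 1" if "q \<in> Q" for q
    using B[OF that that] diag[OF that] by (simp add: power2_eq_square)
  have *: "(\<Sum>\<omega>\<in>\<Omega>. wt \<omega> * (\<Sum>l<d. e * B (p (f \<omega>)) l * B (p' (g \<omega>)) l)) \<le> 128 * \<tau>"
    if "e\<^sup>2 = 1" for e :: real
    unfolding A[of "\<lambda>i j. \<Sum>l<d. e * B (p i) l * B (p' j) l", symmetric]
    using sign Q(2,3) diag' that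
    by (intro grothendieck) (simp_all add: A power_mult_distrib)
  have "(\<Sum>\<omega>\<in>\<Omega>. wt \<omega> * G (p (f \<omega>)) (p' (g \<omega>))) = (\<Sum>\<omega>\<in>\<Omega>. wt \<omega> * (\<Sum>l<d. B (p (f \<omega>)) l * B (p' (g \<omega>)) l))"
    using B f g Q by (intro sum.cong) auto
  then show ?thesis using *[of 1] *[of "-1"] by (simp add: sum_negf abs_le_iff)
qed

section \<open>Concentration\<close>

lemma nn_integral_exp_sum_list_replicate_pmf:
  fixes g :: "'c \<Rightarrow> real"
  shows "(\<integral>\<^sup>+ xs. ennreal (exp (l * sum_list (map g xs))) \<partial>replicate_pmf m p) =
    (\<integral>\<^sup>+ x. ennreal (exp (l * g x)) \<partial>p) ^ m"
proof (induction m)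
  case 0
  then show ?case by simp
next
  case (Suc m)
  have "(\<integral>\<^sup>+ xs. ennreal (exp (l * sum_list (map g xs))) \<partial>replicate_pmf (Suc m) p) =
     (\<integral>\<^sup>+ x. \<integral>\<^sup>+ xs. ennreal (exp (l * g x)) * ennreal (exp (l * sum_list (map g xs))) \<partial>replicate_pmf m p \<partial>p)"
    by (simp add: distrib_left exp_add ennreal_mult)
  also have "\<dots> = (\<integral>\<^sup>+ x. ennreal (exp (l * g x)) \<partial>p) ^ Suc m"
    by (simp add: nn_integral_cmult nn_integral_multc Suc)
  finally show ?case .
qed

text \<open>Chernoff bound with the optimal parameter \<tau>, as Hoeffding's lemma gives
  \<open>exp (\<tau>\<^sup>2 / 2)\<close> per draw for a range of length 2. The length is part of
  the event because centring subtracts the mean once per list entry.\<close>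

lemma hoeffding_replicate_pmf:
  fixes f :: "'c \<Rightarrow> real"
  assumes "\<And>x. \<bar>f x\<bar> \<le> 1" and "\<tau> > 0"
  shows "measure_pmf.prob (replicate_pmf m p)
      {cs. sum_list (map f cs) \<ge> real m * (measure_pmf.expectation p f + \<tau>) \<and> length cs = m}
    \<le> exp (- (real m * \<tau>\<^sup>2 / 2))"
proof -
  define \<mu> where "\<mu> = measure_pmf.expectation p f"
  define g where "g x = f x - \<mu>" for x
  interpret interval_bounded_random_variable "measure_pmf p" f "-1" 1
    using assms by unfold_locales (auto simp: abs_le_iff minus_le_iff)
  have mgf: "(\<integral>\<^sup>+ x. ennreal (exp (\<tau> * g x)) \<partial>p) \<le> ennreal (exp (\<tau>\<^sup>2 / 2))"
    using Hoeffdings_lemma_nn_integral[OF \<open>\<tau> > 0\<close>] by (simp add: g_def \<mu>_def)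
  have len: "sum_list (map g cs) = sum_list (map f cs) - real (length cs) * \<mu>" for cs
    by (induction cs) (auto simp: g_def algebra_simps)
  have "emeasure (replicate_pmf m p) {cs \<in> space (replicate_pmf m p). sum_list (map g cs) \<ge> real m * \<tau>}
     \<le> ennreal (exp (- \<tau> * (real m * \<tau>))) *
        (\<integral>\<^sup>+cs\<in>space (replicate_pmf m p). exp (\<tau> * sum_list (map g cs)) \<partial>replicate_pmf m p)"
    by (intro Chernoff_ineq_nn_integral_ge \<open>\<tau> > 0\<close>) auto
  also have "(\<integral>\<^sup>+cs\<in>space (replicate_pmf m p). exp (\<tau> * sum_list (map g cs)) \<partial>replicate_pmf m p)
     = (\<integral>\<^sup>+ x. ennreal (exp (\<tau> * g x)) \<partial>p) ^ m"
    by (simp add: nn_integral_exp_sum_list_replicate_pmf)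
  also have "ennreal (exp (- \<tau> * (real m * \<tau>))) * \<dots> \<le> ennreal (exp (- \<tau> * (real m * \<tau>))) * ennreal (exp (\<tau>\<^sup>2 / 2)) ^ m"
    by (intro mult_left_mono power_mono mgf) auto
  also have "\<dots> = ennreal (exp (- \<tau> * (real m * \<tau>)) * exp (\<tau>\<^sup>2 / 2) ^ m)"
    by (simp add: ennreal_mult ennreal_power)
  also have "exp (- \<tau> * (real m * \<tau>)) * exp (\<tau>\<^sup>2 / 2) ^ m = exp (- (real m * \<tau>\<^sup>2 / 2))"
    by (simp flip: exp_of_nat_mult exp_add) (simp add: power2_eq_square field_simps)
  finally have "measure_pmf.prob (replicate_pmf m p) {cs. sum_list (map g cs) \<ge> real m * \<tau>}
      \<le> exp (- (real m * \<tau>\<^sup>2 / 2))"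
    by (simp add: measure_pmf.emeasure_eq_measure)
  moreover have "measure_pmf.prob (replicate_pmf m p)
      {cs. sum_list (map f cs) \<ge> real m * (\<mu> + \<tau>) \<and> length cs = m} \<le>
      measure_pmf.prob (replicate_pmf m p) {cs. sum_list (map g cs) \<ge> real m * \<tau>}"
    by (intro measure_pmf.finite_measure_mono) (auto simp: len algebra_simps)
  ultimately show ?thesis by (simp add: \<mu>_def)
qed

section \<open>Repairing almost \<open>t\<close>-wise independent distributions\<close>

lemma exists_pmf_of_weights:
  fixes f :: "'x \<Rightarrow> real"
  assumes "finite Z" "\<And>x. x \<in> Z \<Longrightarrow> 0 \<le> f x" "sum f Z = 1"
  shows "\<exists>p. \<forall>x. pmf p x = (if x \<in> Z then f x else 0)"
proof -
  define g where "g x = (if x \<in> Z then f x else 0)" for x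
  have "(\<integral>\<^sup>+ x. ennreal (g x) \<partial>count_space UNIV) = (\<Sum>x\<in>Z. ennreal (g x))"
    using assms by (intro nn_integral_count_space') (auto simp: g_def)
  also have "\<dots> = ennreal (sum g Z)"
    using assms by (intro sum_ennreal) (auto simp: g_def)
  also have "sum g Z = 1" using assms by (simp add: g_def)
  finally have "pmf (embed_pmf g) x = g x" for x
    using assms by (intro pmf_embed_pmf) (auto simp: g_def)
  then show ?thesis unfolding g_def by blast
qed

text \<open>Marginals are kept as functions of full points \<open>x\<close>, of which only the
  coordinates in \<open>T\<close> matter. \<open>f\<close> is any real function, since differences
  and corrections of distributions take both signs.\<close>

definition marg :: "'i set \<Rightarrow> 'a set \<Rightarrow> 'i set \<Rightarrow> (('i \<Rightarrow> 'a) \<Rightarrow> real) \<Rightarrow> ('i \<Rightarrow> 'a) \<Rightarrow> real" where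
  "marg I D T f x = (\<Sum>z | z \<in> (I \<rightarrow>\<^sub>E D) \<and> (\<forall>i\<in>T. z i = x i). f z)"

lemma finite_cube [simp]: "finite I \<Longrightarrow> finite D \<Longrightarrow> finite (I \<rightarrow>\<^sub>E D)"
  by (intro finite_PiE) auto

lemma marg_add: "marg I D T (\<lambda>z. f z + g z) x = marg I D T f x + marg I D T g x"
  and marg_diff: "marg I D T (\<lambda>z. f z - g z) x = marg I D T f x - marg I D T g x"
  and marg_cmult: "marg I D T (\<lambda>z. c * f z) x = c * marg I D T f x"
  and marg_sum: "marg I D T (\<lambda>z. \<Sum>i\<in>A. h i z) x = (\<Sum>i\<in>A. marg I D T (h i) x)"
  by (simp_all add: marg_def sum.distrib sum_subtractf sum_distrib_left) (rule sum.swap)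

lemma card_cube: "finite I \<Longrightarrow> card (I \<rightarrow>\<^sub>E D) = card D ^ card I"
  by (simp add: card_PiE)

lemma abs_marg_le:
  assumes I: "finite I" and "finite D" "\<And>z. z \<in> (I \<rightarrow>\<^sub>E D) \<Longrightarrow> \<bar>f z\<bar> \<le> b" "0 \<le> b"
  shows "\<bar>marg I D T f x\<bar> \<le> real (card D ^ card I) * b"
proof -
  have "\<bar>marg I D T f x\<bar> \<le> (\<Sum>z | z \<in> (I \<rightarrow>\<^sub>E D) \<and> (\<forall>i\<in>T. z i = x i). b)"
    unfolding marg_def using assms by (intro order_trans[OF sum_abs] sum_mono) auto
  also have "\<dots> \<le> (\<Sum>z \<in> (I \<rightarrow>\<^sub>E D). b)"
    using assms by (intro sum_mono2) auto
  finally show ?thesis using assms by (simp add: card_cube)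
qed

text \<open>The conditions imposed by \<open>S\<close> and \<open>T\<close> act on each coordinate
  separately, so the sum over the cube factors: coordinates in \<open>S\<close> are decided by
  \<open>f\<close>, those in \<open>T - S\<close> contribute \<nu>, the others sum to 1.\<close>

lemma marg_tensor:
  assumes I: "finite I" and D: "finite D" and S: "S \<subseteq> I" and T: "T \<subseteq> I"
    and \<nu>: "(\<Sum>a\<in>D. \<nu> a) = (1::real)" and x: "x \<in> (I \<rightarrow>\<^sub>E D)"
  shows "marg I D T (\<lambda>z. marg I D S f z * (\<Prod>i\<in>I-S. \<nu> (z i))) x =
    marg I D (S \<inter> T) f x * (\<Prod>i\<in>T-S. \<nu> (x i))"
proof -
  let ?Z = "I \<rightarrow>\<^sub>E D"
  have inner: "(\<Sum>z | z \<in> {z \<in> ?Z. \<forall>i\<in>T. z i = x i} \<and> (\<forall>i\<in>S. y i = z i). \<Prod>i\<in>I-S. \<nu> (z i)) =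
      (if \<forall>i\<in>S \<inter> T. y i = x i then \<Prod>i\<in>T-S. \<nu> (x i) else 0)" if y: "y \<in> ?Z" for y
  proof -
    \<comment> \<open>For fixed \<open>y\<close>, the values left for coordinate \<open>i\<close>;
      the summation range becomes a product.\<close>
    define B where "B i = {a \<in> D. (i \<in> T \<longrightarrow> a = x i) \<and> (i \<in> S \<longrightarrow> y i = a)}" for i
    define h where "h i a = (if i \<in> S then 1 else \<nu> a)" for i a
    have "{z. z \<in> {z \<in> ?Z. \<forall>i\<in>T. z i = x i} \<and> (\<forall>i\<in>S. y i = z i)} = PiE I B"
      using S T by (auto simp: B_def PiE_iff extensional_def)
    then have "(\<Sum>z | z \<in> {z \<in> ?Z. \<forall>i\<in>T. z i = x i} \<and> (\<forall>i\<in>S. y i = z i). \<Prod>i\<in>I-S. \<nu> (z i))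
       = (\<Sum>z\<in>PiE I B. \<Prod>i\<in>I. h i (z i))"
      using S I by (intro sum.cong) (auto simp: h_def prod.If_cases Diff_eq)
    also have "\<dots> = (\<Prod>i\<in>I. \<Sum>a\<in>B i. h i a)"
      using I D by (intro prod_sum_PiE[symmetric]) (auto simp: B_def)
    also have "\<dots> = (\<Prod>i\<in>I. (if i \<in> S \<inter> T then of_bool (y i = x i) else 1) * (if i \<in> T - S then \<nu> (x i) else 1))"
    proof (intro prod.cong refl)
      fix i assume i: "i \<in> I"
      have Bi: "B i = (if i \<in> S then (if i \<in> T \<and> y i \<noteq> x i then {} else {y i}) else if i \<in> T then {x i} else D)"
        using x y i by (auto simp: B_def PiE_iff)
      show "(\<Sum>a\<in>B i. h i a) = (if i \<in> S \<inter> T then of_bool (y i = x i) else 1) * (if i \<in> T - S then \<nu> (x i) else 1)"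
        unfolding Bi h_def using \<nu> by auto
    qed
    also have "\<dots> = (\<Prod>i\<in>S \<inter> T. of_bool (y i = x i)) * (\<Prod>i\<in>T-S. \<nu> (x i))"
    proof -
      have "I \<inter> (S \<inter> T) = S \<inter> T" "I \<inter> (T - S) = T - S" using S T by auto
      then show ?thesis
        unfolding prod.distrib using I by (simp only: prod.inter_restrict[symmetric])
    qed
    also have "(\<Prod>i\<in>S \<inter> T. of_bool (y i = x i)) = (if \<forall>i\<in>S \<inter> T. y i = x i then 1 else (0::real))"
      using finite_subset[OF S I] by (auto simp: prod_zero_iff)
    finally show ?thesis by simp
  qed
  have "marg I D T (\<lambda>z. marg I D S f z * (\<Prod>i\<in>I-S. \<nu> (z i))) x =
     (\<Sum>z\<in>{z \<in> ?Z. \<forall>i\<in>T. z i = x i}. \<Sum>y | y \<in> ?Z \<and> (\<forall>i\<in>S. y i = z i). f y * (\<Prod>i\<in>I-S. \<nu> (z i)))"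
    unfolding marg_def by (simp add: sum_distrib_right)
  also have "\<dots> = (\<Sum>y\<in>?Z. \<Sum>z | z \<in> {z \<in> ?Z. \<forall>i\<in>T. z i = x i} \<and> (\<forall>i\<in>S. y i = z i). f y * (\<Prod>i\<in>I-S. \<nu> (z i)))"
    using I D by (intro sum.swap_restrict) auto
  also have "\<dots> = (\<Sum>y\<in>?Z. if \<forall>i\<in>S \<inter> T. y i = x i then f y * (\<Prod>i\<in>T-S. \<nu> (x i)) else 0)"
    by (intro sum.cong refl) (use inner in \<open>simp add: sum_distrib_left[symmetric]\<close>)
  also have "\<dots> = marg I D (S \<inter> T) f x * (\<Prod>i\<in>T-S. \<nu> (x i))"
    using I D by (simp add: marg_def sum_distrib_right flip: sum.inter_filter)
  finally show ?thesis .
qed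

lemma marg_prod:
  assumes I: "finite I" and D: "finite D" and T: "T \<subseteq> I"
    and \<nu>: "(\<Sum>a\<in>D. \<nu> a) = (1::real)" and x: "x \<in> (I \<rightarrow>\<^sub>E D)"
  shows "marg I D T (\<lambda>z. \<Prod>i\<in>I. \<nu> (z i)) x = (\<Prod>i\<in>T. \<nu> (x i))"
proof -
  \<comment> \<open>A point mass has total mass 1, so \<open>marg_tensor\<close> with
    \<open>S = {}\<close> leaves only the product of \<nu>.\<close>
  define f where "f = (\<lambda>z. if z = x then 1 else (0::real))"
  have f: "marg I D {} f z = 1" for z
    using I D x by (simp add: marg_def f_def)
  have "marg I D T (\<lambda>z. marg I D {} f z * (\<Prod>i\<in>I-{}. \<nu> (z i))) x = marg I D ({} \<inter> T) f x * (\<Prod>i\<in>T-{}. \<nu> (x i))"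
    by (rule marg_tensor) (use assms in auto)
  then show ?thesis by (simp add: f)
qed

lemma cube_agree_eq_PiE:
  assumes "T \<subseteq> I" "x \<in> (I \<rightarrow>\<^sub>E D)"
  shows "{z \<in> I \<rightarrow>\<^sub>E D. \<forall>i\<in>T. z i = x i} = PiE I (\<lambda>i. if i \<in> T then {x i} else D)"
proof (intro set_eqI iffI)
  fix z assume z: "z \<in> PiE I (\<lambda>i. if i \<in> T then {x i} else D)"
  have "z i = x i" if "i \<in> T" for i
    using PiE_mem[OF z, of i] that assms(1) by auto
  moreover have "z i \<in> D" if "i \<in> I" for i
    using PiE_mem[OF z that] PiE_mem[OF assms(2) that] by (auto split: if_splits)
  ultimately show "z \<in> {z \<in> I \<rightarrow>\<^sub>E D. \<forall>i\<in>T. z i = x i}"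
    using z by (auto simp: PiE_iff)
qed (auto simp: PiE_iff)

lemma abs_marg_subset_le:
  assumes I: "finite I" and D: "finite D" and "U \<subseteq> T" "T \<subseteq> I"
    and \<eta>: "\<And>y. y \<in> (I \<rightarrow>\<^sub>E D) \<Longrightarrow> \<bar>marg I D T f y\<bar> \<le> \<eta>" "0 \<le> \<eta>"
    and x: "x \<in> (I \<rightarrow>\<^sub>E D)"
  shows "\<bar>marg I D U f x\<bar> \<le> real (card D ^ card I) * \<eta>"
proof -
  let ?Z = "I \<rightarrow>\<^sub>E D"
  define N where "N = (\<Prod>i\<in>I. if i \<in> T then 1 else card D)"
  have N: "card {y \<in> ?Z. \<forall>i\<in>T. z i = y i} = N" if "z \<in> ?Z" for z
  proof -
    have "{y \<in> ?Z. \<forall>i\<in>T. z i = y i} = PiE I (\<lambda>i. if i \<in> T then {z i} else D)"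
      using cube_agree_eq_PiE[OF assms(4) that] by (simp only: eq_commute)
    then show ?thesis
      using I by (simp add: card_PiE N_def if_distrib cong: if_cong)
  qed
  have "card {y \<in> ?Z. \<forall>i\<in>T. x i = y i} \<noteq> 0"
    using I D x by (subst card_0_eq) auto
  then have "N \<ge> 1" using N[OF x] by simp
  have "(\<Sum>y | y \<in> ?Z \<and> (\<forall>i\<in>U. y i = x i). marg I D T f y) =
      (\<Sum>y | y \<in> ?Z \<and> (\<forall>i\<in>U. y i = x i). \<Sum>z | z \<in> {z \<in> ?Z. \<forall>i\<in>U. z i = x i} \<and> (\<forall>i\<in>T. z i = y i). f z)"
    unfolding marg_def using assms(3) by (intro sum.cong refl) (auto simp: subset_iff)
  also have "\<dots> = (\<Sum>z\<in>{z \<in> ?Z. \<forall>i\<in>U. z i = x i}. \<Sum>y | y \<in> {z \<in> ?Z. \<forall>i\<in>U. z i = x i} \<and> (\<forall>i\<in>T. z i = y i). f z)"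
    using I D by (intro sum.swap_restrict) auto
  also have "\<dots> = (\<Sum>z\<in>{z \<in> ?Z. \<forall>i\<in>U. z i = x i}. real N * f z)"
  proof (intro sum.cong refl)
    fix z assume z: "z \<in> {z \<in> ?Z. \<forall>i\<in>U. z i = x i}"
    then have "{y. y \<in> {z \<in> ?Z. \<forall>i\<in>U. z i = x i} \<and> (\<forall>i\<in>T. z i = y i)} = {y \<in> ?Z. \<forall>i\<in>T. z i = y i}"
      using assms(3) by (auto simp: subset_iff)
    then show "(\<Sum>y | y \<in> {z \<in> ?Z. \<forall>i\<in>U. z i = x i} \<and> (\<forall>i\<in>T. z i = y i). f z) = real N * f z"
      using N[of z] z by simp
  qed
  also have "\<dots> = real N * marg I D U f x" by (simp add: marg_def sum_distrib_left)
  finally have "real N * \<bar>marg I D U f x\<bar> = \<bar>marg I D U (marg I D T f) x\<bar>"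
    by (simp add: abs_mult marg_def[of I D U "marg I D T f"])
  also have "\<dots> \<le> real (card D ^ card I) * \<eta>"
    using I D \<eta> by (intro abs_marg_le)
  finally have "real N * \<bar>marg I D U f x\<bar> \<le> real (card D ^ card I) * \<eta>" .
  moreover have "1 * \<bar>marg I D U f x\<bar> \<le> real N * \<bar>marg I D U f x\<bar>"
    using \<open>N \<ge> 1\<close> by (intro mult_right_mono) auto
  ultimately show ?thesis by simp
qed

text \<open>The recursion of \<open>kill_marginals\<close>: level \<open>s\<close> subtracts at most
  \<open>2 ^ k\<close> tensors, each bounded by \<eta> times
  \<open>1 + q * correction_bound k q s\<close>, for the marginal of the original function and that
  of the correction so far.\<close>

fun correction_bound :: "nat \<Rightarrow> real \<Rightarrow> nat \<Rightarrow> real" where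
  "correction_bound k q 0 = 0"
| "correction_bound k q (Suc s) = correction_bound k q s + 2 ^ k * (1 + q * correction_bound k q s)"

lemma correction_bound_nonneg: "0 \<le> q \<Longrightarrow> 0 \<le> correction_bound k q s"
  by (induction s) auto

lemma correction_bound_mono: "0 \<le> q \<Longrightarrow> s \<le> s' \<Longrightarrow> correction_bound k q s \<le> correction_bound k q s'"
  by (rule lift_Suc_mono_le[of "correction_bound k q"]) (simp_all add: correction_bound_nonneg)

text \<open>
  Marginals are killed level by level: once all marginals on fewer than \<open>s\<close> coordinates vanish,
  subtracting the \<open>s\<close>-marginals tensored with \<open>\<nu>\<close> kills those on \<open>s\<close> coordinates as well.
\<close>

lemma kill_marginals:
  fixes f :: "('i \<Rightarrow> 'a) \<Rightarrow> real"
  assumes I: "finite I" and D: "finite D" and \<nu>: "(\<Sum>a\<in>D. \<nu> a) = (1::real)" "\<And>a. a \<in> D \<Longrightarrow> 0 \<le> \<nu> a"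
    and "0 \<le> \<eta>"
    and f: "\<And>U x. U \<subseteq> I \<Longrightarrow> card U \<le> t \<Longrightarrow> x \<in> (I \<rightarrow>\<^sub>E D) \<Longrightarrow> \<bar>marg I D U f x\<bar> \<le> \<eta>"
  shows "s \<le> Suc t \<Longrightarrow> \<exists>c. (\<forall>x\<in>(I \<rightarrow>\<^sub>E D). \<bar>c x\<bar> \<le> correction_bound (card I) (real (card D ^ card I)) s * \<eta>) \<and>
    (\<forall>U x. U \<subseteq> I \<longrightarrow> card U < s \<longrightarrow> x \<in> (I \<rightarrow>\<^sub>E D) \<longrightarrow> marg I D U (\<lambda>z. f z - c z) x = 0)"
proof (induction s)
  case 0
  show ?case by (intro exI[of _ "\<lambda>_. 0"]) simp
next
  case (Suc s)
  let ?Z = "I \<rightarrow>\<^sub>E D"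
  define q where "q = real (card D ^ card I)"
  define b where "b = correction_bound (card I) q s"
  have b: "0 \<le> b" by (simp add: b_def correction_bound_nonneg q_def)
  have "\<exists>c. (\<forall>x\<in>?Z. \<bar>c x\<bar> \<le> b * \<eta>) \<and>
    (\<forall>U x. U \<subseteq> I \<longrightarrow> card U < s \<longrightarrow> x \<in> ?Z \<longrightarrow> marg I D U (\<lambda>z. f z - c z) x = 0)"
    using Suc.IH Suc.prems unfolding b_def q_def by simp
  then obtain c where c: "\<And>x. x \<in> ?Z \<Longrightarrow> \<bar>c x\<bar> \<le> b * \<eta>"
    and c0: "\<And>U x. U \<subseteq> I \<Longrightarrow> card U < s \<Longrightarrow> x \<in> ?Z \<Longrightarrow> marg I D U (\<lambda>z. f z - c z) x = 0"
    by blast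
  define g where "g z = f z - c z" for z
  define \<S> where "\<S> = {S. S \<subseteq> I \<and> card S = s}"
  have fin\<S>: "finite \<S>" unfolding \<S>_def by (rule finite_subset[of _ "Pow I"]) (use I in auto)
  define h where "h S z = marg I D S g z * (\<Prod>i\<in>I-S. \<nu> (z i))" for S z
  define c' where "c' z = c z + (\<Sum>S\<in>\<S>. h S z)" for z
  have g: "\<bar>marg I D S g x\<bar> \<le> \<eta> + q * (b * \<eta>)" if "S \<in> \<S>" "x \<in> ?Z" for S x
  proof -
    have "\<bar>marg I D S g x\<bar> = \<bar>marg I D S f x - marg I D S c x\<bar>"
      by (simp add: g_def[abs_def] marg_diff)
    also have "\<dots> \<le> \<bar>marg I D S f x\<bar> + \<bar>marg I D S c x\<bar>" by simp
    also have "\<dots> \<le> \<eta> + q * (b * \<eta>)"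
      unfolding q_def using that Suc.prems I D c b \<open>0 \<le> \<eta>\<close>
      by (intro add_mono f abs_marg_le) (auto simp: \<S>_def)
    finally show ?thesis .
  qed
  have \<nu>1: "\<nu> a \<le> 1" if "a \<in> D" for a
    using member_le_sum[of a D \<nu>] \<nu> D that by auto
  have h: "\<bar>h S x\<bar> \<le> \<eta> + q * (b * \<eta>)" if "S \<in> \<S>" "x \<in> ?Z" for S x
  proof -
    have "\<And>i. i \<in> I \<Longrightarrow> x i \<in> D" using that by auto
    then have "0 \<le> (\<Prod>i\<in>I-S. \<nu> (x i))" "(\<Prod>i\<in>I-S. \<nu> (x i)) \<le> 1"
      using \<nu>1 \<nu>(2) by (auto intro!: prod_nonneg prod_le_1)
    then have "\<bar>h S x\<bar> \<le> \<bar>marg I D S g x\<bar>"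
      by (simp add: h_def abs_mult mult_left_le)
    with g[OF that] show ?thesis by simp
  qed
  have "\<bar>c' x\<bar> \<le> correction_bound (card I) q (Suc s) * \<eta>" if "x \<in> ?Z" for x
  proof -
    have nn: "0 \<le> \<eta> + q * (b * \<eta>)" using b \<open>0 \<le> \<eta>\<close> by (simp add: q_def)
    have "card \<S> \<le> card (Pow I)" unfolding \<S>_def using I by (intro card_mono) auto
    then have "real (card \<S>) \<le> real (2 ^ card I)" using I by (simp only: card_Pow of_nat_le_iff)
    then have card: "real (card \<S>) \<le> 2 ^ card I" by simp
    have "\<bar>c' x\<bar> \<le> \<bar>c x\<bar> + \<bar>\<Sum>S\<in>\<S>. h S x\<bar>" by (simp add: c'_def)
    also have "\<bar>\<Sum>S\<in>\<S>. h S x\<bar> \<le> (\<Sum>S\<in>\<S>. \<eta> + q * (b * \<eta>))"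
      using h that by (intro order_trans[OF sum_abs] sum_mono)
    also have "\<dots> \<le> 2 ^ card I * (\<eta> + q * (b * \<eta>))"
      using card nn by (simp add: mult_right_mono)
    finally have "\<bar>c' x\<bar> \<le> b * \<eta> + 2 ^ card I * (\<eta> + q * (b * \<eta>))"
      using c[OF that] by simp
    also have "\<dots> = correction_bound (card I) q (Suc s) * \<eta>"
      by (simp add: b_def algebra_simps)
    finally show ?thesis .
  qed
  moreover have "marg I D U (\<lambda>z. f z - c' z) x = 0"
    if U: "U \<subseteq> I" "card U < Suc s" and x: "x \<in> ?Z" for U x
  proof -
    have finU: "finite U" using U I finite_subset by blast
    have "(\<lambda>z. f z - c' z) = (\<lambda>z. g z - (\<Sum>S\<in>\<S>. h S z))"
      by (auto simp: c'_def g_def)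
    then have "marg I D U (\<lambda>z. f z - c' z) x = marg I D U g x - (\<Sum>S\<in>\<S>. marg I D U (h S) x)"
      by (simp add: marg_diff marg_sum)
    also have "(\<Sum>S\<in>\<S>. marg I D U (h S) x) = (\<Sum>S\<in>\<S>. marg I D (S \<inter> U) g x * (\<Prod>i\<in>U-S. \<nu> (x i)))"
      unfolding h_def[abs_def] using I D \<nu> U x by (intro sum.cong marg_tensor refl) (auto simp: \<S>_def)
    \<comment> \<open>If \<open>S\<close> differs from \<open>U\<close>, then
      \<open>S \<inter> U\<close> has fewer than \<open>s\<close> elements and its marginal of
      \<open>g\<close> already vanishes. Only \<open>S = U\<close> survives, and it cancels the
      marginal of \<open>g\<close> on \<open>U\<close>.\<close>
    also have "\<dots> = (\<Sum>S\<in>\<S>. if S = U then marg I D U g x else 0)"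
    proof (intro sum.cong refl)
      fix S assume S: "S \<in> \<S>"
      show "marg I D (S \<inter> U) g x * (\<Prod>i\<in>U-S. \<nu> (x i)) = (if S = U then marg I D U g x else 0)"
      proof (cases "S = U")
        case False
        have "finite S" "card S = s" using S I finite_subset[of S I] by (auto simp: \<S>_def)
        have "card (S \<inter> U) < s"
        proof (cases "S \<subseteq> U")
          case True
          then have "S \<subset> U" using False by blast
          then have "card S < card U" using finU psubset_card_mono by blast
          with U \<open>card S = s\<close> show ?thesis by simp
        next
          case False
          then have "S \<inter> U \<subset> S" by blast
          then show ?thesis using \<open>finite S\<close> \<open>card S = s\<close> psubset_card_mono by blast
        qed
        then show ?thesis
          using c0[of "S \<inter> U" x] U x False by (simp add: g_def[abs_def] le_infI2)
      qed simp
    qed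
    also have "\<dots> = (if card U = s then marg I D U g x else 0)"
      using U fin\<S> by (auto simp: \<S>_def)
    also have "marg I D U g x - \<dots> = 0"
      using c0[of U x] U x by (auto simp: g_def[abs_def])
    finally show ?thesis .
  qed
  ultimately show ?case unfolding q_def by blast
qed

text \<open>Of the expanded product only the two extreme terms are kept. This yields the slack
  between the product of the mixed weights and the scaled product of \<nu>.\<close>

lemma prod_add_ge_add_prod:
  fixes a b :: "'i \<Rightarrow> real"
  assumes "finite I" "I \<noteq> {}" "\<And>i. i \<in> I \<Longrightarrow> 0 \<le> a i" "\<And>i. i \<in> I \<Longrightarrow> 0 \<le> b i"
  shows "prod a I + prod b I \<le> (\<Prod>i\<in>I. a i + b i)"
  using assms
proof (induction I rule: finite_ne_induct)
  case (singleton x)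
  then show ?case by simp
next
  case (insert x F)
  have nn: "0 \<le> prod a F" "0 \<le> prod b F" using insert by (auto intro!: prod_nonneg)
  have "prod a (insert x F) + prod b (insert x F) = a x * prod a F + b x * prod b F"
    using insert by simp
  also have "\<dots> \<le> (a x + b x) * (prod a F + prod b F)"
    using nn insert.prems by (simp add: algebra_simps)
  also have "\<dots> \<le> (a x + b x) * (\<Prod>i\<in>F. a i + b i)"
    using insert by (intro mult_left_mono) auto
  finally show ?case using insert by simp
qed

text \<open>Passes from full points to restrictions: a pattern on \<open>T\<close> with values in
  \<open>D\<close> extends to a full point by any element of \<open>D\<close>, and all other
  patterns have probability 0 on both sides.\<close>

lemma twise_indepI:
  fixes \<mu> :: "(nat \<Rightarrow> 'a) pmf"
  assumes I: "I = {1..k}" and D: "finite D" "D \<noteq> {}" and \<nu>: "set_pmf \<nu> \<subseteq> D" and \<mu>: "set_pmf \<mu> \<subseteq> (I \<rightarrow>\<^sub>E D)"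
    and m: "\<And>T x. T \<subseteq> I \<Longrightarrow> card T = t \<Longrightarrow> x \<in> (I \<rightarrow>\<^sub>E D) \<Longrightarrow>
      marg I D T (pmf \<mu>) x = (\<Prod>i\<in>T. pmf \<nu> (x i))"
  shows "twise_indep t k D \<nu> \<mu>"
  unfolding twise_indep_def I[symmetric]
proof (intro conjI allI impI \<mu> pmf_eqI)
  fix T f assume T: "T \<subseteq> I \<and> card T = t"
  then have finT: "finite T" using finite_subset I by blast
  let ?Z = "I \<rightarrow>\<^sub>E D"
  have "pmf (map_pmf (\<lambda>x. restrict x T) \<mu>) f = measure_pmf.prob \<mu> ((\<lambda>x. restrict x T) -` {f})"
    by (simp add: pmf_map)
  also have "\<dots> = measure_pmf.prob \<mu> {z \<in> ?Z. restrict z T = f}"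
    using \<mu> by (intro measure_prob_cong_0) (auto simp: set_pmf_eq)
  also have "\<dots> = (\<Sum>z | z \<in> ?Z \<and> restrict z T = f. pmf \<mu> z)"
    using D I by (intro measure_measure_pmf_finite) auto
  finally have L: "pmf (map_pmf (\<lambda>x. restrict x T) \<mu>) f = (\<Sum>z | z \<in> ?Z \<and> restrict z T = f. pmf \<mu> z)" .
  show "pmf (map_pmf (\<lambda>x. restrict x T) \<mu>) f = pmf (Pi_pmf T undefined (\<lambda>_. \<nu>)) f"
  proof (cases "f \<in> T \<rightarrow>\<^sub>E D")
    case True
    obtain a where a: "a \<in> D" using D by blast
    define x where "x i = (if i \<in> T then f i else if i \<in> I then a else undefined)" for i
    have x: "x \<in> ?Z" using True a T by (auto simp: x_def PiE_iff extensional_def)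
    have "{z. z \<in> ?Z \<and> restrict z T = f} = {z. z \<in> ?Z \<and> (\<forall>i\<in>T. z i = x i)}"
      using True by (auto simp: x_def PiE_iff extensional_def restrict_def fun_eq_iff)
    then have "pmf (map_pmf (\<lambda>x. restrict x T) \<mu>) f = marg I D T (pmf \<mu>) x"
      unfolding L marg_def by simp
    also have "\<dots> = (\<Prod>i\<in>T. pmf \<nu> (x i))" using T x by (intro m) auto
    also have "\<dots> = (\<Prod>i\<in>T. pmf \<nu> (f i))" by (simp add: x_def)
    finally show ?thesis
      using finT True by (simp add: pmf_Pi PiE_iff extensional_def)
  next
    case False
    have "{z. z \<in> ?Z \<and> restrict z T = f} = {}"
      using False T by (auto simp: PiE_iff extensional_def)
    then have "pmf (map_pmf (\<lambda>x. restrict x T) \<mu>) f = 0" unfolding L by (simp only: sum.empty)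
    moreover have "pmf (Pi_pmf T undefined (\<lambda>_. \<nu>)) f = 0"
    proof (cases "\<forall>i. i \<notin> T \<longrightarrow> f i = undefined")
      case True
      with False obtain i where "i \<in> T" "f i \<notin> D" by (auto simp: PiE_iff extensional_def)
      then have "pmf \<nu> (f i) = 0" using \<nu> by (auto simp: set_pmf_eq)
      with \<open>i \<in> T\<close> finT show ?thesis by (auto simp: pmf_Pi intro!: prod_zero)
    qed (use finT in \<open>auto simp: pmf_Pi\<close>)
    ultimately show ?thesis by simp
  qed
qed

text \<open>The order of quantifiers matters: \<nu>' depends on \<nu> alone and serves every \<mu>,
  since \<open>opt\<close> asks for one distribution on \<open>D\<close> shared by all
  relations.\<close>

definition repairable :: "nat \<Rightarrow> nat \<Rightarrow> 'a set \<Rightarrow> real \<Rightarrow> real \<Rightarrow> bool" where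
  "repairable t k D \<eta> \<epsilon> \<longleftrightarrow> (\<forall>\<nu>::'a \<Rightarrow> real. (\<forall>a\<in>D. 0 \<le> \<nu> a) \<longrightarrow> sum \<nu> D = 1 \<longrightarrow>
     (\<exists>\<nu>'. set_pmf \<nu>' \<subseteq> D \<and> (\<forall>\<mu>. (\<forall>x\<in>({1..k} \<rightarrow>\<^sub>E D). 0 \<le> \<mu> x) \<longrightarrow> sum \<mu> ({1..k} \<rightarrow>\<^sub>E D) = 1 \<longrightarrow>
       (\<forall>T x. T \<subseteq> {1..k} \<longrightarrow> card T = t \<longrightarrow> x \<in> ({1..k} \<rightarrow>\<^sub>E D) \<longrightarrow>
          \<bar>marg {1..k} D T \<mu> x - (\<Prod>i\<in>T. \<nu> (x i))\<bar> \<le> \<eta>) \<longrightarrow>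
       (\<exists>\<mu>'. twise_indep t k D \<nu>' \<mu>' \<and>
         (\<forall>R. R \<subseteq> ({1..k} \<rightarrow>\<^sub>E D) \<longrightarrow> (\<Sum>x\<in>R. \<mu> x) - \<epsilon> \<le> measure_pmf.prob \<mu>' R)))))"

text \<open>
  The witness is \<open>\<mu>' = \<nu>'\<^sup>k + (1 - \<alpha>)\<^sup>k (\<mu> - \<nu>\<^sup>k - c)\<close> with \<open>\<nu>' = (1 - \<alpha>) \<nu> + \<alpha> \<cdot> uniform\<close>, where \<open>c\<close> is the
  small correction that removes the \<open>t\<close>-marginals of \<open>\<mu> - \<nu>\<^sup>k\<close>. It is nonnegative because
  \<open>\<nu>'\<^sup>k - (1 - \<alpha>)\<^sup>k \<nu>\<^sup>k \<ge> (\<alpha>/q)\<^sup>k\<close> pointwise.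
\<close>

lemma exists_repairable:
  assumes "k \<ge> 1" "q \<ge> 1" "\<epsilon> > 0"
  shows "\<exists>\<eta>>0. \<forall>(D::'a set) t. finite D \<longrightarrow> card D = q \<longrightarrow> t \<le> k \<longrightarrow> repairable t k D \<eta> \<epsilon>"
proof -
  define I where I: "I = {1..k}"
  have finI: "finite I" and cardI: "card I = k" and I0: "I \<noteq> {}" using I assms by auto
  define Q where "Q = real (q ^ k)"
  \<comment> \<open>By Bernoulli's inequality this \<alpha> makes \<open>(1 - \<alpha>) ^ k\<close>
    at least \<open>1 - \<epsilon> / 2\<close>.\<close>
  define \<alpha> where "\<alpha> = min (1/2) (\<epsilon> / (2 * real k))"
  \<comment> \<open>A pointwise bound for the correction: not above the slack
    \<open>(\<alpha> / real q) ^ k\<close>, and at most \<open>\<epsilon> / 2\<close> when summed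
    over the cube.\<close>
  define \<beta> where "\<beta> = min ((\<alpha> / real q) ^ k) (\<epsilon> / (2 * Q))"
  define B where "B = correction_bound k Q (Suc k)"
  \<comment> \<open>The factor \<open>Q\<close> is lost in passing from marginals on
    \<open>t\<close> coordinates to smaller ones, \<open>B\<close> in removing them all;
    \<open>B\<close> is taken at \<open>Suc k\<close> to cover every
    \<open>t \<le> k\<close>.\<close>
  define \<eta> where "\<eta> = \<beta> / (B * Q + 1)"
  have Q: "Q \<ge> 1" using assms by (simp add: Q_def)
  have \<alpha>: "0 < \<alpha>" "\<alpha> \<le> 1/2" "real k * \<alpha> \<le> \<epsilon> / 2"
    using assms by (auto simp: \<alpha>_def min_def field_simps)
  have \<beta>: "0 < \<beta>" "\<beta> \<le> (\<alpha> / real q) ^ k" "Q * \<beta> \<le> \<epsilon> / 2"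
    using assms \<alpha> Q by (auto simp: \<beta>_def min_def field_simps)
  have B: "0 \<le> B" using Q by (simp add: B_def correction_bound_nonneg del: correction_bound.simps)
  have \<eta>: "0 < \<eta>" using \<beta> B Q by (simp add: \<eta>_def add_nonneg_pos)
  have BQ: "B * (Q * \<eta>) \<le> \<beta>"
  proof -
    have "B * (Q * \<eta>) \<le> (B * Q + 1) * \<eta>" using \<eta> by (simp add: algebra_simps)
    also have "\<dots> = \<beta>" using B Q by (simp add: \<eta>_def add_nonneg_pos less_imp_neq[symmetric])
    finally show ?thesis .
  qed
  show ?thesis
  proof (intro exI[of _ \<eta>] conjI allI impI \<eta>)
    fix D :: "'a set" and t
    assume D: "finite D" "card D = q" and t: "t \<le> k"
    show "repairable t k D \<eta> \<epsilon>"
      unfolding repairable_def I[symmetric]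
    proof (intro allI impI)
      fix \<nu> :: "'a \<Rightarrow> real"
      assume "\<forall>a\<in>D. 0 \<le> \<nu> a" and "sum \<nu> D = 1"
      then have \<nu>: "\<And>a. a \<in> D \<Longrightarrow> 0 \<le> \<nu> a" "sum \<nu> D = 1" by auto
      let ?Z = "I \<rightarrow>\<^sub>E D"
      have D0: "D \<noteq> {}" using D assms by auto
      have Zin: "z i \<in> D" if "z \<in> ?Z" "i \<in> I" for z i using that by auto
      define \<nu>'' where "\<nu>'' a = (1 - \<alpha>) * \<nu> a + \<alpha> / real q" for a
      have \<nu>''0: "0 \<le> \<nu>'' a" if "a \<in> D" for a using \<nu>(1)[OF that] \<alpha> by (simp add: \<nu>''_def)
      have \<nu>''1: "sum \<nu>'' D = 1"
        using assms D by (simp add: \<nu>''_def sum.distrib \<nu>(2) flip: sum_distrib_left)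
      obtain \<nu>' where \<nu>': "\<And>a. pmf \<nu>' a = (if a \<in> D then \<nu>'' a else 0)"
        using exists_pmf_of_weights[of D \<nu>''] D \<nu>''0 \<nu>''1 by blast
      define P where "P z = (\<Prod>i\<in>I. \<nu> (z i))" for z
      define P' where "P' z = (\<Prod>i\<in>I. \<nu>'' (z i))" for z
      have P: "marg I D T P x = (\<Prod>i\<in>T. \<nu> (x i))" "marg I D T P' x = (\<Prod>i\<in>T. \<nu>'' (x i))"
        if "T \<subseteq> I" "x \<in> ?Z" for T x
        unfolding P_def[abs_def] P'_def[abs_def] using that finI D \<nu>''1 \<nu>(2) by (auto intro!: marg_prod finI)
      have PP': "(1 - \<alpha>) ^ k * P z + (\<alpha> / real q) ^ k \<le> P' z" if "z \<in> ?Z" for z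
      proof -
        have "(\<Prod>i\<in>I. (1 - \<alpha>) * \<nu> (z i)) + (\<Prod>i\<in>I. \<alpha> / real q) \<le> P' z"
          unfolding P'_def \<nu>''_def using finI I0 \<alpha> Zin[OF that] \<nu>(1)
          by (intro prod_add_ge_add_prod) auto
        then show ?thesis by (simp add: prod.distrib P_def cardI)
      qed
      have P0: "0 \<le> P z" if "z \<in> ?Z" for z
        unfolding P_def using that \<nu>(1) by (intro prod_nonneg) auto
      show "\<exists>\<nu>'. set_pmf \<nu>' \<subseteq> D \<and> (\<forall>\<mu>. (\<forall>x\<in>?Z. 0 \<le> \<mu> x) \<longrightarrow> sum \<mu> ?Z = 1 \<longrightarrow>
          (\<forall>T x. T \<subseteq> I \<longrightarrow> card T = t \<longrightarrow> x \<in> ?Z \<longrightarrow>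
             \<bar>marg I D T \<mu> x - (\<Prod>i\<in>T. \<nu> (x i))\<bar> \<le> \<eta>) \<longrightarrow>
          (\<exists>\<mu>'. twise_indep t k D \<nu>' \<mu>' \<and>
            (\<forall>R. R \<subseteq> ?Z \<longrightarrow> (\<Sum>x\<in>R. \<mu> x) - \<epsilon> \<le> measure_pmf.prob \<mu>' R)))"
      proof (intro exI[of _ \<nu>'] conjI allI impI)
        show set\<nu>': "set_pmf \<nu>' \<subseteq> D" by (auto simp: set_pmf_eq \<nu>')
        fix \<mu> :: "(nat \<Rightarrow> 'a) \<Rightarrow> real"
        assume \<mu>: "\<forall>x\<in>?Z. 0 \<le> \<mu> x" "sum \<mu> ?Z = 1"
          and close: "\<forall>T x. T \<subseteq> I \<longrightarrow> card T = t \<longrightarrow> x \<in> ?Z \<longrightarrow>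
             \<bar>marg I D T \<mu> x - (\<Prod>i\<in>T. \<nu> (x i))\<bar> \<le> \<eta>"
        define f where "f z = \<mu> z - P z" for z
        have f: "\<bar>marg I D U f x\<bar> \<le> Q * \<eta>" if U: "U \<subseteq> I" "card U \<le> t" and x: "x \<in> ?Z" for U x
        proof -
          have "\<exists>T. U \<subseteq> T \<and> T \<subseteq> I \<and> card T = t"
            using U t by (intro exists_subset_between) (auto simp: finI cardI)
          then obtain T where T: "U \<subseteq> T" "T \<subseteq> I" "card T = t" by blast
          have "\<bar>marg I D T f y\<bar> \<le> \<eta>" if "y \<in> ?Z" for y
            using close T that P(1)[OF T(2) that] by (simp add: f_def[abs_def] marg_diff)
          then show ?thesis
            using abs_marg_subset_le[OF finI D(1) T(1,2), of f \<eta> x] \<eta> x by (simp add: Q_def D cardI)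
        qed
        have "\<exists>c. (\<forall>x\<in>?Z. \<bar>c x\<bar> \<le> correction_bound (card I) (real (card D ^ card I)) (Suc t) * (Q * \<eta>)) \<and>
          (\<forall>U x. U \<subseteq> I \<longrightarrow> card U < Suc t \<longrightarrow> x \<in> ?Z \<longrightarrow> marg I D U (\<lambda>z. f z - c z) x = 0)"
          using \<eta> Q by (intro kill_marginals[OF finI D(1) \<nu>(2) \<nu>(1) _ f]) auto
        then obtain c where c: "\<And>x. x \<in> ?Z \<Longrightarrow> \<bar>c x\<bar> \<le> correction_bound k Q (Suc t) * (Q * \<eta>)"
          and c0: "\<And>U x. U \<subseteq> I \<Longrightarrow> card U < Suc t \<Longrightarrow> x \<in> ?Z \<Longrightarrow> marg I D U (\<lambda>z. f z - c z) x = 0"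
          unfolding cardI D(2) Q_def[symmetric] by blast
        have c: "\<bar>c x\<bar> \<le> \<beta>" if "x \<in> ?Z" for x
        proof -
          have "\<bar>c x\<bar> \<le> correction_bound k Q (Suc t) * (Q * \<eta>)" by (rule c[OF that])
          also have "\<dots> \<le> B * (Q * \<eta>)"
            unfolding B_def using Q \<eta> t by (intro mult_right_mono correction_bound_mono) auto
          finally show ?thesis using BQ by simp
        qed
        define \<mu>'' where "\<mu>'' z = P' z + (1 - \<alpha>) ^ k * (f z - c z)" for z
        have pk: "0 \<le> (1 - \<alpha>) ^ k" "(1 - \<alpha>) ^ k \<le> 1" using \<alpha> by (auto intro: power_le_one)
        have low: "(1 - \<alpha>) ^ k * \<mu> z - \<beta> + (\<alpha> / real q) ^ k \<le> \<mu>'' z" if "z \<in> ?Z" for z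
        proof -
          have "(1 - \<alpha>) ^ k * c z \<le> (1 - \<alpha>) ^ k * \<bar>c z\<bar>" using pk by (intro mult_left_mono) auto
          also have "\<dots> \<le> 1 * \<beta>" using pk c[OF that] \<beta> by (intro mult_mono) auto
          finally show ?thesis
            using PP'[OF that] by (simp add: \<mu>''_def f_def algebra_simps)
        qed
        have nn: "0 \<le> \<mu>'' z" if "z \<in> ?Z" for z
        proof -
          have "0 \<le> (1 - \<alpha>) ^ k * \<mu> z" using pk \<mu> that by auto
          with low[OF that] \<beta> show ?thesis by simp
        qed
        \<comment> \<open>The marginals of \<open>f - c\<close> vanish, so \<mu>'' has those of
          \<open>P'\<close>; the case \<open>T = {}\<close> gives total mass 1.\<close>
        have m'': "marg I D T \<mu>'' x = (\<Prod>i\<in>T. \<nu>'' (x i))" if "T \<subseteq> I" "card T \<le> t" "x \<in> ?Z" for T x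
          unfolding \<mu>''_def[abs_def] marg_add marg_cmult using that c0 P by simp
        obtain a where a: "a \<in> D" using D0 by blast
        define x0 where "x0 = (\<lambda>i\<in>I. a)"
        have x0: "x0 \<in> ?Z" using a by (auto simp: x0_def I)
        have "sum \<mu>'' ?Z = 1"
          using m''[of "{}" x0] x0 by (simp add: marg_def)
        then obtain \<mu>' where \<mu>': "\<And>x. pmf \<mu>' x = (if x \<in> ?Z then \<mu>'' x else 0)"
          using exists_pmf_of_weights[of ?Z \<mu>''] finI D nn by auto
        have set\<mu>': "set_pmf \<mu>' \<subseteq> ?Z" by (auto simp: set_pmf_eq \<mu>')
        have "twise_indep t k D \<nu>' \<mu>'"
        proof (rule twise_indepI[OF I D(1) D0 set\<nu>' set\<mu>'])
          fix T x assume T: "T \<subseteq> I" "card T = t" and x: "x \<in> ?Z"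
          have "marg I D T (pmf \<mu>') x = marg I D T \<mu>'' x"
            unfolding marg_def by (intro sum.cong) (auto simp: \<mu>')
          also have "\<dots> = (\<Prod>i\<in>T. \<nu>'' (x i))" using T x by (intro m'') auto
          also have "\<dots> = (\<Prod>i\<in>T. pmf \<nu>' (x i))" using T x Zin[OF x] by (intro prod.cong) (auto simp: \<nu>')
          finally show "marg I D T (pmf \<mu>') x = (\<Prod>i\<in>T. pmf \<nu>' (x i))" .
        qed
        moreover have "(\<Sum>x\<in>R. \<mu> x) - \<epsilon> \<le> measure_pmf.prob \<mu>' R" if R: "R \<subseteq> ?Z" for R
        proof -
          have finR: "finite R" using finite_subset[OF R] finI D by simp
          have R1: "(\<Sum>x\<in>R. \<mu> x) \<le> 1"
            using sum_mono2[OF _ R, of \<mu>] \<mu> finI D by auto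
          have cR: "real (card R) \<le> Q"
            using card_mono[OF _ R] finI D by (simp add: Q_def card_cube cardI flip: of_nat_power)
          have R0: "0 \<le> (\<Sum>x\<in>R. \<mu> x)" using R \<mu> by (intro sum_nonneg) auto
          have "1 + real k * (- \<alpha>) \<le> (1 + (- \<alpha>)) ^ k"
            using \<alpha> by (intro Bernoulli_inequality) auto
          then have bern: "1 - real k * \<alpha> \<le> (1 - \<alpha>) ^ k" by simp
          have "(\<Sum>x\<in>R. \<mu> x) - \<epsilon> / 2 \<le> (1 - real k * \<alpha>) * (\<Sum>x\<in>R. \<mu> x)"
          proof -
            have "real k * \<alpha> * (\<Sum>x\<in>R. \<mu> x) \<le> \<epsilon> / 2 * 1" using R1 R0 \<alpha> assms by (intro mult_mono) auto
            then show ?thesis by (simp add: algebra_simps)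
          qed
          also have "\<dots> \<le> (1 - \<alpha>) ^ k * (\<Sum>x\<in>R. \<mu> x)"
            using bern R0 by (intro mult_right_mono)
          finally have 1: "(\<Sum>x\<in>R. \<mu> x) - \<epsilon> / 2 \<le> (1 - \<alpha>) ^ k * (\<Sum>x\<in>R. \<mu> x)" .
          have "(1 - \<alpha>) ^ k * (\<Sum>x\<in>R. \<mu> x) - real (card R) * \<beta> = (\<Sum>x\<in>R. (1 - \<alpha>) ^ k * \<mu> x - \<beta>)"
            by (simp add: sum_subtractf sum_distrib_left)
          also have "\<dots> \<le> (\<Sum>x\<in>R. \<mu>'' x)"
          proof (intro sum_mono)
            fix x assume "x \<in> R"
            then have "x \<in> ?Z" using R by blast
            moreover have "0 \<le> (\<alpha> / real q) ^ k" using \<alpha> by simp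
            ultimately show "(1 - \<alpha>) ^ k * \<mu> x - \<beta> \<le> \<mu>'' x" using low[of x] by simp
          qed
          also have "\<dots> = measure_pmf.prob \<mu>' R"
            using R finR by (subst measure_measure_pmf_finite) (auto simp: \<mu>' intro!: sum.cong)
          finally have 2: "(1 - \<alpha>) ^ k * (\<Sum>x\<in>R. \<mu> x) - real (card R) * \<beta> \<le> measure_pmf.prob \<mu>' R" .
          have "real (card R) * \<beta> \<le> Q * \<beta>" using cR \<beta> by (intro mult_right_mono) auto
          with 1 2 \<beta>(3) show ?thesis by linarith
        qed
        ultimately show "\<exists>\<mu>'. twise_indep t k D \<nu>' \<mu>' \<and>
            (\<forall>R. R \<subseteq> ?Z \<longrightarrow> (\<Sum>x\<in>R. \<mu> x) - \<epsilon> \<le> measure_pmf.prob \<mu>' R)" by blast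
      qed
    qed
  qed
qed

section \<open>From pseudo-distributions to moments of \<open>x\<^sup>2\<close>\<close>

definition mdeg :: "('x \<Rightarrow>\<^sub>0 nat) \<Rightarrow> nat" where
  "mdeg s = (\<Sum>i\<in>Poly_Mapping.keys s. Poly_Mapping.lookup s i)"

lemma mdeg_add: "mdeg (s + s') = mdeg s + mdeg s'"
proof -
  have sup: "mdeg u = (\<Sum>i\<in>A. Poly_Mapping.lookup u i)" if "finite A" "Poly_Mapping.keys u \<subseteq> A"
    for u :: "'a \<Rightarrow>\<^sub>0 nat" and A
    unfolding mdeg_def using that by (intro sum.mono_neutral_left) (auto simp: in_keys_iff)
  let ?A = "Poly_Mapping.keys s \<union> Poly_Mapping.keys s'"
  have "mdeg (s + s') = (\<Sum>i\<in>?A. Poly_Mapping.lookup (s + s') i)"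
    by (intro sup) (auto dest: Poly_Mapping.keys_add[THEN subsetD])
  also have "\<dots> = mdeg s + mdeg s'"
    using sup[of ?A s] sup[of ?A s'] by (simp add: lookup_add sum.distrib)
  finally show ?thesis .
qed

lemma total_degree_le_iff: "total_degree p \<le> d \<longleftrightarrow> (\<forall>s\<in>Poly_Mapping.keys p. mdeg s \<le> d)"
  unfolding total_degree_def mdeg_def by auto

lemma polys_upto_iff:
  "p \<in> polys_upto d V D \<longleftrightarrow> (\<forall>s\<in>Poly_Mapping.keys p. Poly_Mapping.keys s \<subseteq> V \<times> D \<and> mdeg s \<le> d)"
  unfolding polys_upto_def polys_def poly_vars_def mem_Collect_eq total_degree_le_iff by blast

lemma polys_upto_0 [simp]: "0 \<in> polys_upto d V D"
  and polys_upto_Const [simp]: "Const c \<in> polys_upto d V D"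
  and polys_upto_1 [simp]: "1 \<in> polys_upto d V D"
  by (simp_all add: polys_upto_iff Const_def mdeg_def)

lemma polys_upto_mono: "p \<in> polys_upto d V D \<Longrightarrow> d \<le> e \<Longrightarrow> p \<in> polys_upto e V D"
  by (force simp: polys_upto_iff)

lemma polys_upto_Var: "x \<in> V \<times> D \<Longrightarrow> Var x \<in> polys_upto 1 V D"
  by (auto simp: polys_upto_iff Var_def mdeg_def)

lemma polys_upto_add: "p \<in> polys_upto d V D \<Longrightarrow> q \<in> polys_upto d V D \<Longrightarrow> p + q \<in> polys_upto d V D"
  using Poly_Mapping.keys_add[of p q] unfolding polys_upto_iff by blast

lemma polys_upto_diff: "p \<in> polys_upto d V D \<Longrightarrow> q \<in> polys_upto d V D \<Longrightarrow> p - q \<in> polys_upto d V D"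
  using keys_diff[of p q] unfolding polys_upto_iff by blast

lemma polys_upto_mult:
  assumes "p \<in> polys_upto d V D" "q \<in> polys_upto e V D"
  shows "p * q \<in> polys_upto (d + e) V D"
  unfolding polys_upto_iff
proof (intro ballI)
  fix s assume "s \<in> Poly_Mapping.keys (p * q)"
  then obtain a b where ab: "s = a + b" "a \<in> Poly_Mapping.keys p" "b \<in> Poly_Mapping.keys q"
    using Poly_Mapping.keys_mult[of p q] by blast
  then show "Poly_Mapping.keys s \<subseteq> V \<times> D \<and> mdeg s \<le> d + e"
    using assms Poly_Mapping.keys_add[of a b] unfolding polys_upto_iff ab(1) mdeg_add
    by (meson Un_least add_mono order_trans)
qed

lemma polys_upto_cmult: "p \<in> polys_upto d V D \<Longrightarrow> Const c * p \<in> polys_upto d V D"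
  using polys_upto_mult[of "Const c" 0 V D p d] by simp

lemma polys_upto_sum:
  "(\<And>i. i \<in> A \<Longrightarrow> p i \<in> polys_upto d V D) \<Longrightarrow> (\<Sum>i\<in>A. p i) \<in> polys_upto d V D"
  by (induction A rule: infinite_finite_induct) (auto intro: polys_upto_add)

section \<open>Monomials as lists and the moments of their squares\<close>

definition Vars :: "'x list \<Rightarrow> 'x rpoly" where
  "Vars ps = prod_list (map Var ps)"

lemma Vars_simps [simp]: "Vars [] = 1" "Vars (p # ps) = Var p * Vars ps" "Vars (ps @ qs) = Vars ps * Vars qs"
  by (simp_all add: Vars_def)

lemma Vars_mset_cong: "mset ps = mset qs \<Longrightarrow> Vars ps = Vars qs"
  unfolding Vars_def by (metis mset_map prod_mset_prod_list)

lemma polys_upto_Vars: "set ps \<subseteq> V \<times> D \<Longrightarrow> length ps \<le> d \<Longrightarrow> Vars ps \<in> polys_upto d V D"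
proof (induction ps arbitrary: d)
  case (Cons p ps)
  then have "Var p * Vars ps \<in> polys_upto (1 + length ps) V D"
    by (intro polys_upto_mult polys_upto_Var) auto
  then show ?case using polys_upto_mono Cons.prems by force
qed simp

lemma polys_upto_Vars_sq: "set ps \<subseteq> V \<times> D \<Longrightarrow> 2 * length ps \<le> d \<Longrightarrow> (Vars ps)\<^sup>2 \<in> polys_upto d V D"
  using polys_upto_Vars[of "ps @ ps" V D d] by (simp add: power2_eq_square)

lemma Const_mult: "Const c * Const d = Const (c * d)"
  by (simp add: Const_def mult_single)

text \<open>What remains of a pseudo-distribution after passing to squares: \<open>M ps\<close>
  stands for the expectation of the squared monomial of \<open>ps\<close>. The prefix \<alpha> in
  \<open>moment_psd\<close> makes the interface stable under conditioning.\<close>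

locale pseudo_moments =
  fixes V :: "'v set" and D :: "'a set" and L :: nat and M :: "('v \<times> 'a) list \<Rightarrow> real"
  assumes finite_D: "finite D"
    and moment_Nil: "M [] = 1"
    and moment_perm: "mset ps = mset qs \<Longrightarrow> M ps = M qs"
    and moment_nonneg: "set ps \<subseteq> V \<times> D \<Longrightarrow> length ps \<le> L \<Longrightarrow> 0 \<le> M ps"
    and moment_marginal: "v \<in> V \<Longrightarrow> set ps \<subseteq> V \<times> D \<Longrightarrow> length ps < L \<Longrightarrow>
      (\<Sum>a\<in>D. M ((v, a) # ps)) = M ps"
    and moment_psd: "finite Q \<Longrightarrow> set \<alpha> \<subseteq> V \<times> D \<Longrightarrow>
      (\<And>q. q \<in> Q \<Longrightarrow> set q \<subseteq> V \<times> D \<and> length \<alpha> + 2 * length q \<le> L) \<Longrightarrow>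
      0 \<le> (\<Sum>q\<in>Q. \<Sum>q'\<in>Q. c q * c q' * M (\<alpha> @ q @ q'))"

locale pseudo_dist =
  fixes K :: nat and V :: "'v set" and D :: "'a set" and E :: "('v \<times> 'a) rpoly \<Rightarrow> real"
  assumes fin: "finite D" and pd: "pseudo_distribution K V D E"
begin

lemma E_add: "p \<in> polys_upto K V D \<Longrightarrow> q \<in> polys_upto K V D \<Longrightarrow> E (p + q) = E p + E q"
  using pd unfolding pseudo_distribution_def by blast

lemma E_cmult: "p \<in> polys_upto K V D \<Longrightarrow> E (Const c * p) = c * E p"
  using pd unfolding pseudo_distribution_def by blast

lemma E_one: "E 1 = 1"
  using pd unfolding pseudo_distribution_def by blast

lemma E_zero: "E 0 = 0"
  using E_cmult[of 1 0] by (simp add: Const_def)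

lemma E_sum: "(\<And>i. i \<in> A \<Longrightarrow> p i \<in> polys_upto K V D) \<Longrightarrow> E (\<Sum>i\<in>A. p i) = (\<Sum>i\<in>A. E (p i))"
  by (induction A rule: infinite_finite_induct) (auto simp: E_zero E_add polys_upto_sum)

lemma E_diff: "p \<in> polys_upto K V D \<Longrightarrow> q \<in> polys_upto K V D \<Longrightarrow> E (p - q) = E p - E q"
  using E_add[of "p - q" q] polys_upto_diff[of p K V D q] by simp

lemma E_square: "q \<in> polys_upto d V D \<Longrightarrow> 2 * d \<le> K \<Longrightarrow> 0 \<le> E (q\<^sup>2)"
  using pd unfolding pseudo_distribution_def polys_upto_def by auto

lemma E_axiom: "h \<in> assignment_axioms V D \<Longrightarrow> q \<in> polys_upto d V D \<Longrightarrow> h * q \<in> polys_upto K V D \<Longrightarrow> E (h * q) = 0"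
  using pd unfolding pseudo_distribution_def polys_upto_def by auto

lemma E_sum_sq:
  assumes "v \<in> V" "q \<in> polys_upto d V D" "d + 2 \<le> K"
  shows "(\<Sum>a\<in>D. E ((Var (v, a))\<^sup>2 * q)) = E q"
proof -
  let ?h = "(\<Sum>a\<in>D. (Var (v, a))\<^sup>2) - 1"
  have q: "q \<in> polys_upto K V D" using assms polys_upto_mono by force
  have vq: "(Var (v, a))\<^sup>2 * q \<in> polys_upto K V D" if "a \<in> D" for a
    using polys_upto_mult[OF polys_upto_Vars_sq[of "[(v, a)]" V D 2] assms(2)] that assms polys_upto_mono
    by force
  have eq: "?h * q = (\<Sum>a\<in>D. (Var (v, a))\<^sup>2 * q) - q"
    by (simp add: left_diff_distrib sum_distrib_right)
  have "?h * q \<in> polys_upto K V D"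
    unfolding eq by (intro polys_upto_diff polys_upto_sum vq q)
  then have "E (?h * q) = 0"
    using assms by (intro E_axiom) (auto simp: assignment_axioms_def)
  then show ?thesis
    unfolding eq using E_diff[OF polys_upto_sum[of D "\<lambda>a. (Var (v, a))\<^sup>2 * q"] q] E_sum[of D "\<lambda>a. (Var (v, a))\<^sup>2 * q"] vq
    by simp
qed

text \<open>The normalisation axiom times \<open>Var x * r\<close> leaves only the square of
  \<open>Var x\<close> itself: every other value of the same variable is killed by the orthogonality
  axiom.\<close>

lemma E_cube_Var:
  assumes x: "x \<in> V \<times> D" and r: "r \<in> polys_upto d V D" and "d + 3 \<le> K"
  shows "E (Var x ^ 3 * r) = E (Var x * r)"
proof -
  obtain v a where va: "x = (v, a)" "v \<in> V" "a \<in> D" using x by auto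
  have xr: "Var x * r \<in> polys_upto (1 + d) V D"
    by (intro polys_upto_mult polys_upto_Var x r)
  have "E ((Var (v, b))\<^sup>2 * (Var x * r)) = 0" if b: "b \<in> D" "b \<noteq> a" for b
  proof -
    have eq: "(Var (v, b))\<^sup>2 * (Var x * r) = (Var (v, b) * Var (v, a)) * (Var (v, b) * r)"
      by (simp add: va power2_eq_square algebra_simps)
    have "(Var (v, b) * Var (v, a)) * (Var (v, b) * r) \<in> polys_upto (1 + 1 + (1 + d)) V D"
      using va b by (intro polys_upto_mult polys_upto_Var r) auto
    then have "(Var (v, b) * Var (v, a)) * (Var (v, b) * r) \<in> polys_upto K V D"
      using assms(3) polys_upto_mono by force
    then show ?thesis unfolding eq using va b r
      by (intro E_axiom[of _ _ "1 + d"] polys_upto_mult polys_upto_Var) (auto simp: assignment_axioms_def)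
  qed
  then have "(\<Sum>b\<in>D. E ((Var (v, b))\<^sup>2 * (Var x * r))) = (\<Sum>b\<in>D. if b = a then E ((Var x)\<^sup>2 * (Var x * r)) else 0)"
    by (intro sum.cong) (auto simp: va)
  also have "\<dots> = E (Var x ^ 3 * r)"
    using va fin by (simp add: power3_eq_cube power2_eq_square algebra_simps)
  finally show ?thesis
    using E_sum_sq[OF va(2) xr] assms(3) by simp
qed

lemma E_cube_Vars:
  assumes "set ps \<subseteq> V \<times> D" "r \<in> polys_upto d V D" "d + 3 * length ps \<le> K"
  shows "E (Vars ps ^ 3 * r) = E (Vars ps * r)"
  using assms
proof (induction ps arbitrary: r d)
  case (Cons p ps)
  have "Vars (ps @ ps @ ps) * r \<in> polys_upto (3 * length ps + d) V D"
    using Cons.prems by (intro polys_upto_mult polys_upto_Vars) auto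
  then have 3: "Vars ps ^ 3 * r \<in> polys_upto (3 * length ps + d) V D"
    by (simp add: power3_eq_cube mult.assoc)
  have "E (Vars (p # ps) ^ 3 * r) = E (Var p ^ 3 * (Vars ps ^ 3 * r))"
    by (simp add: power_mult_distrib mult.assoc)
  also have "\<dots> = E (Var p * (Vars ps ^ 3 * r))"
    using Cons.prems by (intro E_cube_Var[OF _ 3]) auto
  also have "\<dots> = E (Vars ps ^ 3 * (Var p * r))" by (simp add: mult_ac)
  also have "\<dots> = E (Vars ps * (Var p * r))"
  proof (rule Cons.IH)
    show "Var p * r \<in> polys_upto (1 + d) V D"
      using Cons.prems by (intro polys_upto_mult polys_upto_Var) auto
  qed (use Cons.prems in auto)
  finally show ?case by (simp add: mult_ac)
qed simp

text \<open>The axioms only force \<open>x \<in> {-1, 0, 1}\<close>; modulo \<open>x\<^sup>3 = x\<close> a monomial \<open>P\<close> satisfies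
  \<open>2 (P\<^sup>2 - P) = (P - P\<^sup>2)\<^sup>2\<close>.\<close>

lemma E_Vars_le_square:
  assumes "set ps \<subseteq> V \<times> D" "4 * length ps \<le> K"
  shows "E (Vars ps) \<le> E ((Vars ps)\<^sup>2)"
proof -
  let ?P = "Vars ps"
  have mem: "?P ^ j \<in> polys_upto (j * length ps) V D" for j
    by (induction j) (auto intro!: polys_upto_mult polys_upto_Vars assms)
  then have mem': "?P ^ j \<in> polys_upto K V D" if "j \<le> 4" for j
    using polys_upto_mono[OF mem, of j K] assms(2) mult_le_mono1[OF that, of "length ps"] by simp
  have 3: "E (?P ^ 3) = E ?P"
    using E_cube_Vars[OF assms(1), of 1 0] assms(2) by simp
  have "E (?P ^ 3 * ?P) = E (?P * ?P)"
    using assms by (intro E_cube_Vars[of _ _ "length ps"] polys_upto_Vars) auto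
  then have 4: "E (?P ^ 4) = E (?P\<^sup>2)"
    by (simp add: power2_eq_square power3_eq_cube power4_eq_xxxx mult.assoc)
  have "?P - ?P\<^sup>2 \<in> polys_upto (2 * length ps) V D"
    using mem[of 2] polys_upto_Vars[OF assms(1), of "2 * length ps"] by (intro polys_upto_diff) auto
  then have "0 \<le> E ((?P - ?P\<^sup>2)\<^sup>2)"
    using assms by (intro E_square) auto
  also have "(?P - ?P\<^sup>2)\<^sup>2 = (?P\<^sup>2 - (?P ^ 3 + ?P ^ 3)) + ?P ^ 4"
    by (simp add: power2_eq_square power3_eq_cube power4_eq_xxxx algebra_simps)
  also have "E \<dots> = E (?P\<^sup>2) - (E (?P ^ 3) + E (?P ^ 3)) + E (?P ^ 4)"
    using mem'[of 2] mem'[of 3] mem'[of 4]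
    by (simp only: E_add E_diff polys_upto_add polys_upto_diff)
  finally show ?thesis unfolding 3 4 by simp
qed

text \<open>A list of length \<open>L\<close> has a squared monomial of degree \<open>2 * L\<close>,
  whence the condition on \<open>K\<close>.\<close>

lemma pseudo_moments: 
  assumes "2 * L \<le> K"
  shows "pseudo_moments V D L (\<lambda>ps. E ((Vars ps)\<^sup>2))"
proof
  show "finite D" by (rule fin)
  show "E ((Vars [])\<^sup>2) = 1" by (simp add: E_one)
  show "E ((Vars ps)\<^sup>2) = E ((Vars qs)\<^sup>2)" if "mset ps = mset qs" for ps qs :: "('v \<times> 'a) list"
    using Vars_mset_cong[OF that] by simp
  show "0 \<le> E ((Vars ps)\<^sup>2)" if "set ps \<subseteq> V \<times> D" "length ps \<le> L" for ps
    using that assms by (intro E_square[of _ "length ps"] polys_upto_Vars) auto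
  show "(\<Sum>a\<in>D. E ((Vars ((v, a) # ps))\<^sup>2)) = E ((Vars ps)\<^sup>2)"
    if "v \<in> V" "set ps \<subseteq> V \<times> D" "length ps < L" for v ps
    using E_sum_sq[OF that(1) polys_upto_Vars_sq[OF that(2) order_refl]] that assms
    by (simp add: power_mult_distrib)
next
  fix Q \<alpha> and c :: "('v \<times> 'a) list \<Rightarrow> real"
  assume Q: "finite Q" and \<alpha>: "set \<alpha> \<subseteq> V \<times> D"
    and len: "\<And>q. q \<in> Q \<Longrightarrow> set q \<subseteq> V \<times> D \<and> length \<alpha> + 2 * length q \<le> L"
  show "0 \<le> (\<Sum>q\<in>Q. \<Sum>q'\<in>Q. c q * c q' * E ((Vars (\<alpha> @ q @ q'))\<^sup>2))"
  proof (cases "Q = {}")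
    case False
    then have \<alpha>L: "length \<alpha> \<le> L" using len by fastforce
    \<comment> \<open>In \<open>p\<^sup>2\<close> the products combine to the squared monomials of
      \<open>\<alpha> @ q @ q'\<close>, so the form in \<open>moment_psd\<close> is the expectation
      of a square.\<close>
    define p where "p = (\<Sum>q\<in>Q. Const (c q) * (Vars \<alpha> * (Vars q)\<^sup>2))"
    have "Vars \<alpha> * (Vars q)\<^sup>2 \<in> polys_upto L V D" if "q \<in> Q" for q
    proof -
      have "Vars (\<alpha> @ q @ q) \<in> polys_upto L V D"
        using len[OF that] \<alpha> by (intro polys_upto_Vars) auto
      then show ?thesis by (simp add: power2_eq_square)
    qed
    then have "p \<in> polys_upto L V D" unfolding p_def by (intro polys_upto_sum polys_upto_cmult)
    then have "0 \<le> E (p\<^sup>2)" using assms by (intro E_square)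
    also have "p\<^sup>2 = (\<Sum>q\<in>Q. \<Sum>q'\<in>Q. Const (c q * c q') * (Vars (\<alpha> @ q @ q'))\<^sup>2)"
      by (simp add: p_def power2_eq_square sum_product Const_mult[symmetric] mult_ac)
    also have "E \<dots> = (\<Sum>q\<in>Q. \<Sum>q'\<in>Q. c q * c q' * E ((Vars (\<alpha> @ q @ q'))\<^sup>2))"
    proof -
      have m: "(Vars (\<alpha> @ q @ q'))\<^sup>2 \<in> polys_upto K V D" if "q \<in> Q" "q' \<in> Q" for q q'
        using len[OF that(1)] len[OF that(2)] \<alpha> assms by (intro polys_upto_Vars_sq) auto
      show ?thesis
        by (subst E_sum; (intro polys_upto_sum polys_upto_cmult m; assumption)?)
           (intro sum.cong refl, subst E_sum; (intro polys_upto_cmult m; assumption)?;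
            intro sum.cong refl E_cmult m; assumption)
    qed
    finally show ?thesis .
  qed simp
qed

text \<open>Replacing monomials by their squares can only increase the value, constraint by
  constraint; from here on only non-negative moments are dealt with.\<close>

lemma E_Val_le:
  fixes cs :: "('v, 'a) csp_constraint list"
  assumes cs: "\<And>\<sigma> R. (\<sigma>, R) \<in> set cs \<Longrightarrow> \<sigma> \<in> {1..k} \<rightarrow> V \<and> R \<subseteq> ({1..k} \<rightarrow>\<^sub>E D)" and "4 * k \<le> K"
  shows "E (Val k (V, mset cs)) \<le>
    (\<Sum>(\<sigma>, R)\<leftarrow>cs. \<Sum>b\<in>R. E ((Vars (map (\<lambda>i. (\<sigma> i, b i)) [1..<Suc k]))\<^sup>2)) / real (length cs)"
proof -
  let ?X = "\<lambda>\<sigma> b. map (\<lambda>i. (\<sigma> i, b i)) [1..<Suc k]"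
  have prod: "(\<Prod>i=1..k. Var (\<sigma> i, b i)) = Vars (?X \<sigma> b)" for \<sigma> :: "nat \<Rightarrow> 'v" and b :: "nat \<Rightarrow> 'a"
  proof -
    have "(\<Prod>i=1..k. Var (\<sigma> i, b i)) = (\<Prod>i\<in>set [1..<Suc k]. Var (\<sigma> i, b i))"
      by (intro prod.cong) auto
    also have "\<dots> = prod_list (map (\<lambda>i. Var (\<sigma> i, b i)) [1..<Suc k])"
      by (intro prod.distinct_set_conv_list) simp
    finally show ?thesis by (simp add: Vars_def comp_def del: upt_Suc)
  qed
  have X: "set (?X \<sigma> b) \<subseteq> V \<times> D" if "(\<sigma>, R) \<in> set cs" "b \<in> R" for \<sigma> R b
  proof
    fix x assume "x \<in> set (?X \<sigma> b)"
    then obtain i where "i \<in> set [1..<Suc k]" and x: "x = (\<sigma> i, b i)" unfolding set_map by blast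
    then have i: "i \<in> {1..k}" by (simp del: upt_Suc)
    have "\<sigma> i \<in> V" using cs[OF that(1)] i by auto
    moreover have "b \<in> ({1..k} \<rightarrow>\<^sub>E D)" using cs[OF that(1)] that(2) by blast
    then have "b i \<in> D" using i by (rule PiE_mem)
    ultimately show "x \<in> V \<times> D" using x by simp
  qed
  have mem: "(\<Sum>(\<sigma>, R)\<leftarrow>cs'. \<Sum>b\<in>R. Vars (?X \<sigma> b)) \<in> polys_upto K V D \<and>
     E (\<Sum>(\<sigma>, R)\<leftarrow>cs'. \<Sum>b\<in>R. Vars (?X \<sigma> b)) \<le>
      (\<Sum>(\<sigma>, R)\<leftarrow>cs'. \<Sum>b\<in>R. E ((Vars (?X \<sigma> b))\<^sup>2))" if "set cs' \<subseteq> set cs" for cs'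
    using that
  proof (induction cs')
    case Nil
    then show ?case by (simp add: E_zero)
  next
    case (Cons c cs')
    obtain \<sigma> R where c: "c = (\<sigma>, R)" by force
    with Cons.prems have in_cs: "(\<sigma>, R) \<in> set cs" by simp
    have m: "Vars (?X \<sigma> b) \<in> polys_upto K V D" if "b \<in> R" for b
      using X[OF in_cs that] assms(2) by (intro polys_upto_Vars) (simp_all del: upt_Suc)
    have le: "E (Vars (?X \<sigma> b)) \<le> E ((Vars (?X \<sigma> b))\<^sup>2)" if "b \<in> R" for b
      using X[OF in_cs that] assms(2) by (intro E_Vars_le_square) (simp_all del: upt_Suc)
    have s: "(\<Sum>b\<in>R. Vars (?X \<sigma> b)) \<in> polys_upto K V D" by (intro polys_upto_sum m)
    have "E (\<Sum>b\<in>R. Vars (?X \<sigma> b)) = (\<Sum>b\<in>R. E (Vars (?X \<sigma> b)))"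
      by (intro E_sum m)
    also have "\<dots> \<le> (\<Sum>b\<in>R. E ((Vars (?X \<sigma> b))\<^sup>2))"
      by (intro sum_mono le)
    finally have e: "E (\<Sum>b\<in>R. Vars (?X \<sigma> b)) \<le> (\<Sum>b\<in>R. E ((Vars (?X \<sigma> b))\<^sup>2))" .
    have IH: "(\<Sum>(\<sigma>, R)\<leftarrow>cs'. \<Sum>b\<in>R. Vars (?X \<sigma> b)) \<in> polys_upto K V D"
      "E (\<Sum>(\<sigma>, R)\<leftarrow>cs'. \<Sum>b\<in>R. Vars (?X \<sigma> b)) \<le>
      (\<Sum>(\<sigma>, R)\<leftarrow>cs'. \<Sum>b\<in>R. E ((Vars (?X \<sigma> b))\<^sup>2))"
      using Cons by auto
    show ?case
      using polys_upto_add[OF s IH(1)] E_add[OF s IH(1)] e IH(2) by (simp add: c del: upt_Suc)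
  qed
  have "Val k (V, mset cs) = Const (1 / real (length cs)) * (\<Sum>(\<sigma>, R)\<leftarrow>cs. \<Sum>b\<in>R. Vars (?X \<sigma> b))"
    unfolding Val_def prod
    by (simp del: upt_Suc add: sum_mset_sum_list flip: mset_map)
  then have "E (Val k (V, mset cs)) = 1 / real (length cs) * E (\<Sum>(\<sigma>, R)\<leftarrow>cs. \<Sum>b\<in>R. Vars (?X \<sigma> b))"
    using mem[OF order_refl] by (simp only: E_cmult)
  also have "\<dots> \<le> 1 / real (length cs) * (\<Sum>(\<sigma>, R)\<leftarrow>cs. \<Sum>b\<in>R. E ((Vars (?X \<sigma> b))\<^sup>2))"
    using mem[OF order_refl] by (intro mult_left_mono) auto
  finally show ?thesis by simp
qed

end

section \<open>Conditioning\<close>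

text \<open>Repetitions are allowed, so a uniform tuple has independent entries.\<close>

definition tuples :: "'x set \<Rightarrow> nat \<Rightarrow> 'x list set" where
  "tuples A s = {xs. set xs \<subseteq> A \<and> length xs = s}"

lemma tuples_0 [simp]: "tuples A 0 = {[]}"
  by (auto simp: tuples_def)

lemma finite_tuples [simp]: "finite A \<Longrightarrow> finite (tuples A s)"
  unfolding tuples_def by (rule finite_lists_length_eq)

lemma card_tuples: "finite A \<Longrightarrow> card (tuples A s) = card A ^ s"
  unfolding tuples_def by (rule card_lists_length_eq)

lemma sum_tuples_Suc:
  fixes f :: "'x list \<Rightarrow> real"
  shows "sum f (tuples A (Suc s)) = (\<Sum>x\<in>A. \<Sum>xs\<in>tuples A s. f (x # xs))"
proof -
  have "sum f (tuples A (Suc s)) = (\<Sum>(x, xs)\<in>A \<times> tuples A s. f (x # xs))"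
    by (rule sum.reindex_bij_witness[of _ "\<lambda>(x, xs). x # xs" "\<lambda>xs. (hd xs, tl xs)"])
       (auto simp: tuples_def length_Suc_conv)
  then show ?thesis by (simp add: sum.cartesian_product)
qed

lemma set_zip_tuples: "l \<in> tuples A s \<Longrightarrow> a \<in> tuples B s \<Longrightarrow> set (zip l a) \<subseteq> A \<times> B"
  by (auto simp: tuples_def dest: set_zip_leftD set_zip_rightD)

lemma length_zip_tuples: "l \<in> tuples A s \<Longrightarrow> a \<in> tuples B s \<Longrightarrow> length (zip l a) = s"
  by (auto simp: tuples_def)

text \<open>Pinning the variables in \<alpha> to their values. If \<open>M \<alpha> = 0\<close>,
  division makes it 0.\<close>

definition cond :: "('x list \<Rightarrow> real) \<Rightarrow> 'x list \<Rightarrow> 'x list \<Rightarrow> real" where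
  "cond M \<alpha> ps = M (\<alpha> @ ps) / M \<alpha>"

text \<open>For each length \<open>s < t\<close>, the average over an \<open>s\<close>-tuple and one
  more variable of the squared covariances between their assignments. All lengths below
  \<open>t\<close> occur because tuples are later peeled one entry at a time.\<close>

definition global_corr :: "'v set \<Rightarrow> 'a set \<Rightarrow> nat \<Rightarrow> (('v \<times> 'a) list \<Rightarrow> real) \<Rightarrow> real" where
  "global_corr V D t M = (\<Sum>s<t. \<Sum>l\<in>tuples V s. \<Sum>a\<in>tuples D s. \<Sum>w\<in>V. \<Sum>\<beta>\<in>D.
     (M ((w, \<beta>) # zip l a) - M (zip l a) * M [(w, \<beta>)])\<^sup>2 / real (card V) ^ Suc s)"

text \<open>Law of total variance. Read \<open>p b\<close> as the probability of the pinned part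
  together with \<open>w = b\<close>, and \<open>c b\<close> as that of a further event in addition:
  the right side is the weighted gain in second moment from conditioning on \<open>w\<close>, and it
  dominates the squared covariances since \<open>p b \<le> P\<close>.\<close>

lemma conditional_variance_gain:
  fixes p c :: "'b \<Rightarrow> real"
  assumes "finite D" and c: "\<And>b. b \<in> D \<Longrightarrow> 0 \<le> c b" "\<And>b. b \<in> D \<Longrightarrow> c b \<le> p b"
    and P: "sum p D = P" and x: "sum c D = x"
  shows "P * (\<Sum>b\<in>D. (c b / P - x / P * (p b / P))\<^sup>2) \<le> (\<Sum>b\<in>D. (c b)\<^sup>2 / p b) - x\<^sup>2 / P"
proof (cases "P = 0")
  case True
  have "0 \<le> p b" if "b \<in> D" for b using c[OF that] by simp
  then have "p b = 0" if "b \<in> D" for b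
    using sum_nonneg_eq_0_iff[of D p] assms(1) P True that by auto
  with True show ?thesis by simp
next
  case False
  have p0: "0 \<le> p b" if "b \<in> D" for b using c[OF that] by simp
  have pP: "p b \<le> P" if "b \<in> D" for b using member_le_sum[of b D p] p0 that assms(1) P by auto
  have "0 < P" using False p0 P sum_nonneg[of D p] by force
  define y where "y = x / P"
  have "P * (\<Sum>b\<in>D. (c b / P - x / P * (p b / P))\<^sup>2) = (\<Sum>b\<in>D. (c b - y * p b)\<^sup>2 / P)"
    unfolding sum_distrib_left
  proof (intro sum.cong refl)
    fix b
    have "c b / P - x / P * (p b / P) = (c b - y * p b) / P"
      using \<open>0 < P\<close> by (simp add: y_def field_simps)
    then show "P * (c b / P - x / P * (p b / P))\<^sup>2 = (c b - y * p b)\<^sup>2 / P"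
      using \<open>0 < P\<close> by (simp add: power2_eq_square)
  qed
  also have "\<dots> \<le> (\<Sum>b\<in>D. (c b)\<^sup>2 / p b - 2 * y * c b + y\<^sup>2 * p b)"
  proof (intro sum_mono)
    fix b assume b: "b \<in> D"
    show "(c b - y * p b)\<^sup>2 / P \<le> (c b)\<^sup>2 / p b - 2 * y * c b + y\<^sup>2 * p b"
    proof (cases "p b = 0")
      \<comment> \<open>Here \<open>c b \<le> p b\<close> forces \<open>c b = 0\<close>, so the
        division by 0 does no harm.\<close>
      case True
      with c[OF b] show ?thesis by simp
    next
      case False
      with p0[OF b] have "0 < p b" by simp
      then have "(c b - y * p b)\<^sup>2 / P \<le> (c b - y * p b)\<^sup>2 / p b"
        using pP[OF b] by (intro divide_left_mono) auto
      also have "\<dots> = (c b)\<^sup>2 / p b - 2 * y * c b + y\<^sup>2 * p b"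
        using \<open>0 < p b\<close> by (simp add: power2_eq_square field_simps)
      finally show ?thesis .
    qed
  qed
  also have "\<dots> = (\<Sum>b\<in>D. (c b)\<^sup>2 / p b) - 2 * y * x + y\<^sup>2 * P"
    by (simp add: sum.distrib sum_subtractf P x flip: sum_distrib_left)
  also have "\<dots> = (\<Sum>b\<in>D. (c b)\<^sup>2 / p b) - x\<^sup>2 / P"
    using \<open>0 < P\<close> by (simp add: y_def power2_eq_square field_simps)
  finally show ?thesis .
qed

section \<open>Pinning variables until correlations are small\<close>

context pseudo_moments
begin

lemma moment_Cons_le:
  assumes "set (p # ps) \<subseteq> V \<times> D" "length ps < L"
  shows "M (p # ps) \<le> M ps"
proof -
  obtain v a where p: "p = (v, a)" "v \<in> V" "a \<in> D" using assms(1) by auto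
  have "M ((v, a) # ps) \<le> (\<Sum>a\<in>D. M ((v, a) # ps))"
    using assms p finite_D by (intro member_le_sum[of a D "\<lambda>a. M ((v, a) # ps)"] moment_nonneg) auto
  with moment_marginal[of v ps] assms p show ?thesis by simp
qed

lemma moment_append_le:
  "set qs \<subseteq> V \<times> D \<Longrightarrow> set ps \<subseteq> V \<times> D \<Longrightarrow> length qs + length ps \<le> L \<Longrightarrow> M (qs @ ps) \<le> M ps"
proof (induction qs)
  case (Cons q qs)
  then have "M (q # (qs @ ps)) \<le> M (qs @ ps)" by (intro moment_Cons_le) auto
  with Cons show ?case by simp
qed simp

lemma moment_append_le': "set qs \<subseteq> V \<times> D \<Longrightarrow> set ps \<subseteq> V \<times> D \<Longrightarrow> length qs + length ps \<le> L \<Longrightarrow> M (qs @ ps) \<le> M qs"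
  using moment_append_le[of ps qs] moment_perm[of "qs @ ps" "ps @ qs"] by simp

lemma moment_le_1: "set ps \<subseteq> V \<times> D \<Longrightarrow> length ps \<le> L \<Longrightarrow> M ps \<le> 1"
  using moment_append_le[of ps "[]"] moment_Nil by simp

lemma moment_sum_zip:
  assumes "set ps \<subseteq> V \<times> D"
  shows "l \<in> tuples V s \<Longrightarrow> s + length ps \<le> L \<Longrightarrow> (\<Sum>a\<in>tuples D s. M (zip l a @ ps)) = M ps"
proof (induction s arbitrary: l)
  case 0
  then show ?case by simp
next
  case (Suc s)
  then obtain v l' where l: "l = v # l'" "v \<in> V" "l' \<in> tuples V s"
    by (auto simp: tuples_def length_Suc_conv)
  have "(\<Sum>a\<in>tuples D (Suc s). M (zip l a @ ps)) = (\<Sum>a\<in>tuples D s. \<Sum>b\<in>D. M ((v, b) # (zip l' a @ ps)))"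
    unfolding sum_tuples_Suc l by (subst sum.swap) simp
  also have "\<dots> = (\<Sum>a\<in>tuples D s. M (zip l' a @ ps))"
  proof (intro sum.cong refl moment_marginal l)
    fix a assume a: "a \<in> tuples D s"
    show "set (zip l' a @ ps) \<subseteq> V \<times> D" using set_zip_tuples[OF l(3) a] assms by simp
    show "length (zip l' a @ ps) < L" using length_zip_tuples[OF l(3) a] Suc.prems by simp
  qed
  also have "\<dots> = M ps" using Suc l by simp
  finally show ?case .
qed

text \<open>The prefix in \<open>moment_psd\<close> absorbs \<alpha>; conditioning only uses up
  \<open>length \<alpha>\<close> of the available length.\<close>

lemma cond_pseudo_moments:
  assumes \<alpha>: "set \<alpha> \<subseteq> V \<times> D" "length \<alpha> \<le> L" "0 < M \<alpha>"
  shows "pseudo_moments V D (L - length \<alpha>) (cond M \<alpha>)"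
proof
  show "finite D" by (rule finite_D)
  show "cond M \<alpha> [] = 1" using \<alpha> by (simp add: cond_def)
  show "cond M \<alpha> ps = cond M \<alpha> qs" if "mset ps = mset qs" for ps qs
    using moment_perm[of "\<alpha> @ ps" "\<alpha> @ qs"] that by (simp add: cond_def)
  show "0 \<le> cond M \<alpha> ps" if "set ps \<subseteq> V \<times> D" "length ps \<le> L - length \<alpha>" for ps
    unfolding cond_def using that \<alpha> by (intro divide_nonneg_pos moment_nonneg) auto
  show "(\<Sum>a\<in>D. cond M \<alpha> ((v, a) # ps)) = cond M \<alpha> ps"
    if "v \<in> V" "set ps \<subseteq> V \<times> D" "length ps < L - length \<alpha>" for v ps
  proof -
    have "(\<Sum>a\<in>D. M (\<alpha> @ (v, a) # ps)) = (\<Sum>a\<in>D. M ((v, a) # (\<alpha> @ ps)))"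
      by (intro sum.cong refl moment_perm) simp
    also have "\<dots> = M (\<alpha> @ ps)" using that \<alpha> by (intro moment_marginal) auto
    finally show ?thesis by (simp add: cond_def flip: sum_divide_distrib)
  qed
next
  fix Q \<alpha>' and c :: "('v \<times> 'a) list \<Rightarrow> real"
  assume Q: "finite Q" "set \<alpha>' \<subseteq> V \<times> D"
    and len: "\<And>q. q \<in> Q \<Longrightarrow> set q \<subseteq> V \<times> D \<and> length \<alpha>' + 2 * length q \<le> L - length \<alpha>"
  have "0 \<le> (\<Sum>q\<in>Q. \<Sum>q'\<in>Q. c q * c q' * M ((\<alpha> @ \<alpha>') @ q @ q'))"
  proof (intro moment_psd Q conjI)
    fix q assume "q \<in> Q"
    from len[OF this] \<alpha> show "set q \<subseteq> V \<times> D" "length (\<alpha> @ \<alpha>') + 2 * length q \<le> L" by auto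
  qed (use \<alpha> Q in auto)
  then have "0 \<le> (\<Sum>q\<in>Q. \<Sum>q'\<in>Q. c q * c q' * M ((\<alpha> @ \<alpha>') @ q @ q')) / M \<alpha>"
    using \<alpha> by (intro divide_nonneg_pos)
  then show "0 \<le> (\<Sum>q\<in>Q. \<Sum>q'\<in>Q. c q * c q' * cond M \<alpha> (\<alpha>' @ q @ q'))"
    by (simp add: cond_def sum_divide_distrib)
qed

text \<open>The quotient is \<open>M \<alpha>\<close> times the square of the conditional moment of
  \<open>zip l a\<close>. With this weight, the sum over all outcomes of the pinned variables in
  \<open>total_pot\<close> is an expectation.\<close>

definition pot :: "nat \<Rightarrow> ('v \<times> 'a) list \<Rightarrow> real" where
  "pot t \<alpha> = (\<Sum>s<t. \<Sum>l\<in>tuples V s. \<Sum>a\<in>tuples D s. (M (\<alpha> @ zip l a))\<^sup>2 / M \<alpha> / real (card V) ^ s)"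

definition total_pot :: "nat \<Rightarrow> 'v list \<Rightarrow> real" where
  "total_pot t u = (\<Sum>c\<in>tuples D (length u). pot t (zip u c))"

text \<open>\<open>conditional_variance_gain\<close> for each tuple and each assignment: averaged
  over the choice of \<open>w\<close>, pinning one more variable raises the potential by at least
  the weighted correlation.\<close>

lemma pot_gain:
  assumes \<alpha>: "set \<alpha> \<subseteq> V \<times> D" "length \<alpha> + 1 + t \<le> L" and V: "finite V" "V \<noteq> {}"
  shows "real (card V) * (M \<alpha> * global_corr V D t (cond M \<alpha>)) \<le> (\<Sum>w\<in>V. (\<Sum>\<beta>\<in>D. pot t ((w, \<beta>) # \<alpha>)) - pot t \<alpha>)"
proof -
  let ?n = "real (card V)"
  let ?d = "\<lambda>w l a. (\<Sum>\<beta>\<in>D. (M (((w, \<beta>) # \<alpha>) @ zip l a))\<^sup>2 / M ((w, \<beta>) # \<alpha>)) - (M (\<alpha> @ zip l a))\<^sup>2 / M \<alpha>"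
  let ?e = "\<lambda>w l a \<beta>. cond M \<alpha> ((w, \<beta>) # zip l a) - cond M \<alpha> (zip l a) * cond M \<alpha> [(w, \<beta>)]"
  have n: "?n > 0" using V by (simp add: card_gt_0_iff)
  have step: "M \<alpha> * (\<Sum>\<beta>\<in>D. (?e w l a \<beta>)\<^sup>2)
     \<le> ?d w l a"
    if s: "s < t" and l: "l \<in> tuples V s" and a: "a \<in> tuples D s" and w: "w \<in> V" for s l a w
  proof -
    have z: "set (zip l a) \<subseteq> V \<times> D" "length (zip l a) = s" using set_zip_tuples[OF l a] length_zip_tuples[OF l a] by auto
    have "M \<alpha> * (\<Sum>\<beta>\<in>D. (M ((w, \<beta>) # \<alpha> @ zip l a) / M \<alpha> - M (\<alpha> @ zip l a) / M \<alpha> * (M ((w, \<beta>) # \<alpha>) / M \<alpha>))\<^sup>2)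
      \<le> (\<Sum>\<beta>\<in>D. (M ((w, \<beta>) # \<alpha> @ zip l a))\<^sup>2 / M ((w, \<beta>) # \<alpha>)) - (M (\<alpha> @ zip l a))\<^sup>2 / M \<alpha>"
    proof (intro conditional_variance_gain finite_D moment_marginal w)
      fix \<beta> assume "\<beta> \<in> D"
      with \<alpha> z s w show "0 \<le> M ((w, \<beta>) # \<alpha> @ zip l a)" by (intro moment_nonneg) auto
      show "M ((w, \<beta>) # \<alpha> @ zip l a) \<le> M ((w, \<beta>) # \<alpha>)"
        using moment_append_le'[of "(w, \<beta>) # \<alpha>" "zip l a"] \<alpha> z s w \<open>\<beta> \<in> D\<close> by simp
    qed (use \<alpha> z s in auto)
    moreover have "M (\<alpha> @ (w, \<beta>) # zip l a) = M ((w, \<beta>) # \<alpha> @ zip l a)"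
      "M (\<alpha> @ [(w, \<beta>)]) = M ((w, \<beta>) # \<alpha>)" for \<beta>
      by (intro moment_perm; simp)+
    ultimately show ?thesis by (simp add: cond_def)
  qed
  have "?n * (M \<alpha> * global_corr V D t (cond M \<alpha>)) =
      (\<Sum>s<t. \<Sum>l\<in>tuples V s. \<Sum>a\<in>tuples D s. \<Sum>w\<in>V. (M \<alpha> * (\<Sum>\<beta>\<in>D.
       (?e w l a \<beta>)\<^sup>2)) / ?n ^ s)"
    unfolding global_corr_def sum_distrib_left sum_divide_distrib using n
    by (intro sum.cong refl) (simp add: field_simps)
  also have "\<dots> \<le> (\<Sum>s<t. \<Sum>l\<in>tuples V s. \<Sum>a\<in>tuples D s. \<Sum>w\<in>V. ?d w l a / ?n ^ s)"
    using n by (intro sum_mono divide_right_mono step) auto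
  also have "\<dots> = (\<Sum>w\<in>V. \<Sum>s<t. \<Sum>l\<in>tuples V s. \<Sum>a\<in>tuples D s.  ?d w l a / ?n ^ s)"
    by (simp only: sum.swap[where B = V])
  also have "\<dots> = (\<Sum>w\<in>V. (\<Sum>\<beta>\<in>D. pot t ((w, \<beta>) # \<alpha>)) - pot t \<alpha>)"
  proof (intro sum.cong refl)
    fix w
    have "(\<Sum>\<beta>\<in>D. pot t ((w, \<beta>) # \<alpha>)) = (\<Sum>s<t. \<Sum>l\<in>tuples V s. \<Sum>a\<in>tuples D s. \<Sum>\<beta>\<in>D.
        (M (((w, \<beta>) # \<alpha>) @ zip l a))\<^sup>2 / M ((w, \<beta>) # \<alpha>) / ?n ^ s)"
      unfolding pot_def by (simp only: sum.swap[where A = D])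
    then show "(\<Sum>s<t. \<Sum>l\<in>tuples V s. \<Sum>a\<in>tuples D s.  ?d w l a / ?n ^ s)
      = (\<Sum>\<beta>\<in>D. pot t ((w, \<beta>) # \<alpha>)) - pot t \<alpha>"
      by (simp add: pot_def diff_divide_distrib sum_subtractf sum_divide_distrib)
  qed
  finally show ?thesis .
qed

text \<open>The square of a number in \<open>[0, 1]\<close> is at most that number, and the local
  distribution on each tuple has total mass 1; every length \<open>s < t\<close> thus contributes at
  most \<open>M \<alpha>\<close>.\<close>

lemma pot_le:
  assumes \<alpha>: "set \<alpha> \<subseteq> V \<times> D" "length \<alpha> + t \<le> L" and V: "finite V" "V \<noteq> {}"
  shows "pot t \<alpha> \<le> real t * M \<alpha>"
proof -
  let ?n = "real (card V)"
  have n: "?n > 0" using V by (simp add: card_gt_0_iff)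
  have "pot t \<alpha> \<le> (\<Sum>s<t. \<Sum>l\<in>tuples V s. \<Sum>a\<in>tuples D s. M (\<alpha> @ zip l a) / ?n ^ s)"
    unfolding pot_def
  proof (intro sum_mono divide_right_mono)
    fix s l a assume s: "s \<in> {..<t}" and l: "l \<in> tuples V s" and a: "a \<in> tuples D s"
    have z: "set (zip l a) \<subseteq> V \<times> D" "length (zip l a) = s" using set_zip_tuples[OF l a] length_zip_tuples[OF l a] by auto
    have le: "M (\<alpha> @ zip l a) \<le> M \<alpha>" "0 \<le> M (\<alpha> @ zip l a)"
      using z \<alpha> s by (auto intro!: moment_append_le' moment_nonneg)
    show "(M (\<alpha> @ zip l a))\<^sup>2 / M \<alpha> \<le> M (\<alpha> @ zip l a)"
    proof (cases "M \<alpha> = 0")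
      case False
      with le have "0 < M \<alpha>" by simp
      then show ?thesis using mult_left_mono[OF le] by (simp add: power2_eq_square divide_le_eq)
    qed (use le in simp)
  qed auto
  also have "\<dots> = (\<Sum>s<t. \<Sum>l\<in>tuples V s. M \<alpha> / ?n ^ s)"
  proof (intro sum.cong refl)
    fix s l assume "s \<in> {..<t}" "l \<in> tuples V s"
    then have "(\<Sum>a\<in>tuples D s. M (zip l a @ \<alpha>)) = M \<alpha>" using \<alpha> by (intro moment_sum_zip) auto
    moreover have "M (\<alpha> @ zip l a) = M (zip l a @ \<alpha>)" for a by (intro moment_perm) simp
    ultimately show "(\<Sum>a\<in>tuples D s. M (\<alpha> @ zip l a) / ?n ^ s) = M \<alpha> / ?n ^ s"
      by (simp flip: sum_divide_distrib)
  qed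
  also have "\<dots> = real t * M \<alpha>"
    using V n by (simp add: card_tuples)
  finally show ?thesis .
qed

lemma total_pot_le:
  assumes "set u \<subseteq> V" "length u + t \<le> L" "finite V" "V \<noteq> {}"
  shows "total_pot t u \<le> real t"
proof -
  have u: "u \<in> tuples V (length u)" using assms by (simp add: tuples_def)
  have "total_pot t u \<le> (\<Sum>c\<in>tuples D (length u). real t * M (zip u c @ []))"
    unfolding total_pot_def
  proof (intro sum_mono)
    fix c assume "c \<in> tuples D (length u)"
    with set_zip_tuples[OF u this] length_zip_tuples[OF u this] assms
    show "pot t (zip u c) \<le> real t * M (zip u c @ [])" by (simp add: pot_le)
  qed
  also have "\<dots> = real t * M []"
    using moment_sum_zip[OF _ u, of "[]"] assms by (simp flip: sum_distrib_left)
  finally show ?thesis by (simp add: moment_Nil)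
qed

text \<open>The potential starts non-negative and never exceeds \<open>t\<close>. If the expected
  correlation stayed above \<epsilon>, each of \<open>Suc r\<close> well chosen pinned variables
  would add more than \<epsilon>, against \<open>t \<le> r * \<epsilon>\<close>.\<close>

lemma pinning_low_correlation:
  assumes V: "finite V" "V \<noteq> {}" and \<epsilon>: "0 < \<epsilon>" "real t \<le> real r * \<epsilon>" and L: "r + 1 + t \<le> L"
  obtains u where "set u \<subseteq> V" "length u \<le> r"
    and "(\<Sum>c\<in>tuples D (length u). M (zip u c) * global_corr V D t (cond M (zip u c))) \<le> \<epsilon>"
proof -
  let ?C = "\<lambda>u. \<Sum>c\<in>tuples D (length u). M (zip u c) * global_corr V D t (cond M (zip u c))"
  have "\<exists>u. set u \<subseteq> V \<and> length u \<le> r \<and> ?C u \<le> \<epsilon>"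
  proof (rule ccontr)
    assume "\<not> ?thesis"
    then have no: "?C u > \<epsilon>" if "set u \<subseteq> V" "length u \<le> r" for u
      using that by force
    have "\<exists>u. set u \<subseteq> V \<and> length u = j \<and> real j * \<epsilon> \<le> total_pot t u" if "j \<le> Suc r" for j
      using that
    proof (induction j)
      case 0
      have "0 \<le> total_pot t []"
        unfolding total_pot_def pot_def by (simp add: sum_nonneg moment_Nil)
      then show ?case by simp
    next
      case (Suc j)
      then obtain u where u: "set u \<subseteq> V" "length u = j" "real j * \<epsilon> \<le> total_pot t u" by auto
      have u': "u \<in> tuples V (length u)" using u by (simp add: tuples_def)
      have "real (card V) * \<epsilon> < real (card V) * (\<Sum>c\<in>tuples D (length u). M (zip u c) * global_corr V D t (cond M (zip u c)))"
        using no[of u] u Suc.prems V by (intro mult_strict_left_mono) (auto simp: card_gt_0_iff)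
      also have "\<dots> \<le> (\<Sum>c\<in>tuples D (length u). \<Sum>w\<in>V. (\<Sum>\<beta>\<in>D. pot t ((w, \<beta>) # zip u c)) - pot t (zip u c))"
        unfolding sum_distrib_left using V Suc.prems L u set_zip_tuples[OF u'] length_zip_tuples[OF u']
        by (intro sum_mono pot_gain) auto
      also have "\<dots> = (\<Sum>w\<in>V. (\<Sum>c\<in>tuples D (length u). \<Sum>\<beta>\<in>D. pot t ((w, \<beta>) # zip u c)) - total_pot t u)"
        unfolding total_pot_def sum_subtractf[symmetric] by (rule sum.swap)
      also have "\<dots> = (\<Sum>w\<in>V. total_pot t (w # u) - total_pot t u)"
      proof (intro sum.cong refl)
        fix w
        have "total_pot t (w # u) = (\<Sum>c\<in>tuples D (length u). \<Sum>\<beta>\<in>D. pot t ((w, \<beta>) # zip u c))"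
          unfolding total_pot_def by (simp add: sum_tuples_Suc) (rule sum.swap)
        then show "(\<Sum>c\<in>tuples D (length u). \<Sum>\<beta>\<in>D. pot t ((w, \<beta>) # zip u c)) - total_pot t u
          = total_pot t (w # u) - total_pot t u" by simp
      qed
      finally have gt: "real (card V) * \<epsilon> < (\<Sum>w\<in>V. total_pot t (w # u) - total_pot t u)" .
      \<comment> \<open>The gain was summed over all \<open>w\<close>; some \<open>w\<close> does at
        least as well as the average.\<close>
      have "\<exists>w\<in>V. \<epsilon> < total_pot t (w # u) - total_pot t u"
      proof (rule ccontr)
        assume "\<not> ?thesis"
        then have "(\<Sum>w\<in>V. total_pot t (w # u) - total_pot t u) \<le> real (card V) * \<epsilon>"
          by (intro sum_bounded_above) auto
        with gt show False by simp
      qed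
      then obtain w where "w \<in> V" "\<epsilon> < total_pot t (w # u) - total_pot t u" by blast
      with u show ?case by (intro exI[of _ "w # u"]) (auto simp: algebra_simps)
    qed
    from this[of "Suc r"] obtain u where "set u \<subseteq> V" "length u = Suc r" "real (Suc r) * \<epsilon> \<le> total_pot t u" by auto
    moreover from this have "total_pot t u \<le> real t" using V L by (intro total_pot_le) auto
    ultimately show False using \<epsilon> by (simp add: algebra_simps)
  qed
  then show ?thesis using that by blast
qed

text \<open>By total probability the first sum keeps its mean over the outcomes of the pinned
  variables, while the mean correlation is at most \<epsilon>. Combining both in one objective with
  penalty \<kappa> lets a single outcome be good for both.\<close>

lemma pinning:
  assumes V: "finite V" "V \<noteq> {}" and \<epsilon>: "0 < \<epsilon>" "real t \<le> real r * \<epsilon>" and L: "r + 1 + t \<le> L"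
    and q: "\<And>x. x \<in> X \<Longrightarrow> set (q x) \<subseteq> V \<times> D \<and> r + length (q x) \<le> L" and "0 \<le> \<kappa>"
  obtains \<alpha> where "set \<alpha> \<subseteq> V \<times> D" "length \<alpha> \<le> r" "0 < M \<alpha>"
    and "(\<Sum>x\<in>X. M (q x)) - \<kappa> * \<epsilon> \<le> (\<Sum>x\<in>X. cond M \<alpha> (q x)) - \<kappa> * global_corr V D t (cond M \<alpha>)"
proof -
  obtain u where u: "set u \<subseteq> V" "length u \<le> r"
    and corr: "(\<Sum>c\<in>tuples D (length u). M (zip u c) * global_corr V D t (cond M (zip u c))) \<le> \<epsilon>"
    using pinning_low_correlation[OF V \<epsilon> L] by blast
  have u': "u \<in> tuples V (length u)" using u by (simp add: tuples_def)
  let ?C = "tuples D (length u)"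
  have M0: "0 \<le> M (zip u c)" if "c \<in> ?C" for c
    using set_zip_tuples[OF u' that] length_zip_tuples[OF u' that] u L by (intro moment_nonneg) auto
  have one: "(\<Sum>c\<in>?C. M (zip u c)) = 1"
    using moment_sum_zip[OF _ u', of "[]"] u L by (simp add: moment_Nil)
  have "(\<Sum>c\<in>?C. M (zip u c) * cond M (zip u c) (q x)) = M (q x)" if "x \<in> X" for x
  proof -
    have qx: "set (q x) \<subseteq> V \<times> D" "r + length (q x) \<le> L" using q[OF that] by auto
    have "(\<Sum>c\<in>?C. M (zip u c) * cond M (zip u c) (q x)) = (\<Sum>c\<in>?C. M (zip u c @ q x))"
    proof (intro sum.cong refl)
      fix c assume c: "c \<in> ?C"
      \<comment> \<open>If the outcome \<open>c\<close> has weight 0, the longer moment is 0 as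
        well, in agreement with division by 0.\<close>
      have "0 \<le> M (zip u c @ q x)" "M (zip u c @ q x) \<le> M (zip u c)"
        using set_zip_tuples[OF u' c] length_zip_tuples[OF u' c] u qx
        by (auto intro!: moment_nonneg moment_append_le')
      then show "M (zip u c) * cond M (zip u c) (q x) = M (zip u c @ q x)"
        by (auto simp: cond_def)
    qed
    also have "\<dots> = M (q x)" using qx u u' by (intro moment_sum_zip) auto
    finally show ?thesis .
  qed
  then have val: "(\<Sum>c\<in>?C. M (zip u c) * (\<Sum>x\<in>X. cond M (zip u c) (q x))) = (\<Sum>x\<in>X. M (q x))"
    unfolding sum_distrib_left by (subst sum.swap) simp
  let ?v = "(\<Sum>x\<in>X. M (q x)) - \<kappa> * \<epsilon>"
  let ?w = "\<lambda>\<alpha>. (\<Sum>x\<in>X. cond M \<alpha> (q x)) - \<kappa> * global_corr V D t (cond M \<alpha>)"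
  have "\<exists>c\<in>?C. 0 < M (zip u c) \<and> ?v \<le> ?w (zip u c)"
  proof (rule ccontr)
    assume "\<not> ?thesis"
    then have less: "?w (zip u c) < ?v" if "c \<in> ?C" "0 < M (zip u c)" for c using that by force
    have "?v \<le> (\<Sum>x\<in>X. M (q x)) - \<kappa> * (\<Sum>c\<in>?C. M (zip u c) * global_corr V D t (cond M (zip u c)))"
      using corr \<open>0 \<le> \<kappa>\<close> by (simp add: mult_left_mono)
    also have "\<dots> = (\<Sum>c\<in>?C. M (zip u c) * ?w (zip u c))"
      using val by (simp add: right_diff_distrib sum_subtractf sum_distrib_left mult_ac)
    also have "\<dots> < (\<Sum>c\<in>?C. M (zip u c) * ?v)"
    proof (rule sum_strict_mono_ex1)
      show "finite ?C" by (simp add: finite_D)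
      show "\<forall>c\<in>?C. M (zip u c) * ?w (zip u c) \<le> M (zip u c) * ?v"
      proof
        fix c assume c: "c \<in> ?C"
        show "M (zip u c) * ?w (zip u c) \<le> M (zip u c) * ?v"
        proof (cases "M (zip u c) = 0")
          case False
          with M0[OF c] less[OF c] show ?thesis by (intro mult_left_mono) auto
        qed simp
      qed
      have "\<exists>c\<in>?C. M (zip u c) \<noteq> 0" using one by (metis sum.neutral zero_neq_one)
      then obtain c where c: "c \<in> ?C" "0 < M (zip u c)" using M0 by force
      with less[OF c] show "\<exists>c\<in>?C. M (zip u c) * ?w (zip u c) < M (zip u c) * ?v"
        by (intro bexI[of _ c] mult_strict_left_mono)
    qed
    also have "\<dots> = ?v" using one by (simp flip: sum_distrib_right)
    finally show False by simp
  qed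
  then obtain c where c: "c \<in> ?C" "0 < M (zip u c)" "?v \<le> ?w (zip u c)" by blast
  show ?thesis
    using that[of "zip u c"] set_zip_tuples[OF u' c(1)] length_zip_tuples[OF u' c(1)] u c by simp
qed

text \<open>For \<open>b = [\<beta>]\<close> this is the weight of \<beta> in the one-variable
  distribution shared by all relations; longer lists give the law of the pattern at a uniformly
  random tuple.\<close>

definition avg :: "'a list \<Rightarrow> real" where
  "avg b = (\<Sum>l\<in>tuples V (length b). M (zip l b)) / real (card V) ^ length b"

text \<open>The difference is the mean covariance for a fixed pattern. By Cauchy-Schwarz its square
  is at most the mean squared covariance, which is part of the non-negative sum
  \<open>global_corr\<close>.\<close>

lemma avg_Cons:
  assumes V: "finite V" "V \<noteq> {}" and b: "\<beta> \<in> D" "set b \<subseteq> D" "length b < t"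
  shows "\<bar>avg (\<beta> # b) - avg [\<beta>] * avg b\<bar> \<le> sqrt (global_corr V D t M)"
proof -
  let ?n = "real (card V)" and ?s = "length b"
  have n: "?n > 0" using V by (simp add: card_gt_0_iff)
  let ?X = "tuples V ?s \<times> V"
  let ?c = "\<lambda>l a w \<beta>. (M ((w, \<beta>) # zip l a) - M (zip l a) * M [(w, \<beta>)])\<^sup>2 / ?n ^ Suc ?s"
  define f where "f = (\<lambda>(l, w). M ((w, \<beta>) # zip l b) - M (zip l b) * M [(w, \<beta>)])"
  have cX: "real (card ?X) = ?n ^ Suc ?s" using V by (simp add: card_cartesian_product card_tuples)
  have a1: "avg [\<beta>] = (\<Sum>w\<in>V. M [(w, \<beta>)]) / ?n"
    by (simp add: avg_def sum_tuples_Suc)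
  have a2: "avg (\<beta> # b) = (\<Sum>l\<in>tuples V ?s. \<Sum>w\<in>V. M ((w, \<beta>) # zip l b)) / ?n ^ Suc ?s"
    by (simp add: avg_def sum_tuples_Suc sum.swap[of _ "tuples V ?s" V])
  have a3: "avg [\<beta>] * avg b = (\<Sum>l\<in>tuples V ?s. \<Sum>w\<in>V. M (zip l b) * M [(w, \<beta>)]) / ?n ^ Suc ?s"
    unfolding a1 avg_def[of b] sum_product[symmetric] by (simp add: mult.commute)
  have "avg (\<beta> # b) - avg [\<beta>] * avg b = sum f ?X / ?n ^ Suc ?s"
    unfolding a2 a3 f_def sum.cartesian_product[symmetric]
    by (simp add: sum_subtractf diff_divide_distrib)
  moreover have "(sum f ?X / ?n ^ Suc ?s)\<^sup>2 \<le> global_corr V D t M"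
  proof -
    have "(sum f ?X)\<^sup>2 \<le> (\<Sum>x\<in>?X. (f x)\<^sup>2) * (\<Sum>x\<in>?X. 1\<^sup>2)"
      using Cauchy_Schwarz_ineq_sum[of f "\<lambda>_. 1" ?X] by simp
    then have "(sum f ?X / ?n ^ Suc ?s)\<^sup>2 \<le> ((\<Sum>x\<in>?X. (f x)\<^sup>2) * ?n ^ Suc ?s) / (?n ^ Suc ?s)\<^sup>2"
      using n cX by (simp add: power_divide divide_right_mono del: power_Suc)
    also have "\<dots> = (\<Sum>x\<in>?X. (f x)\<^sup>2) / ?n ^ Suc ?s"
      using n by (simp add: power2_eq_square del: power_Suc)
    also have "\<dots> = (\<Sum>l\<in>tuples V ?s. \<Sum>w\<in>V. ?c l b w \<beta>)"
      unfolding f_def sum.cartesian_product sum_divide_distrib by (intro sum.cong) auto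
    also have "\<dots> \<le> (\<Sum>l\<in>tuples V ?s. \<Sum>a\<in>tuples D ?s. \<Sum>w\<in>V. \<Sum>\<beta>\<in>D. ?c l a w \<beta>)"
    proof (intro sum_mono)
      fix l assume "l \<in> tuples V ?s"
      have "(\<Sum>w\<in>V. ?c l b w \<beta>)
         \<le> (\<Sum>w\<in>V. \<Sum>\<beta>\<in>D. ?c l b w \<beta>)"
        using b finite_D n
        by (intro sum_mono member_le_sum[of \<beta> D "\<lambda>\<beta>. ?c l b w \<beta>" for w]) auto
      also have "\<dots> \<le> (\<Sum>a\<in>tuples D ?s. \<Sum>w\<in>V. \<Sum>\<beta>\<in>D. ?c l a w \<beta>)"
        using b finite_D n
        by (intro member_le_sum[of b "tuples D ?s" "\<lambda>a. \<Sum>w\<in>V. \<Sum>\<beta>\<in>D. ?c l a w \<beta>"])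
          (auto simp: tuples_def intro!: sum_nonneg finite_lists_length_eq)
      finally show "(\<Sum>w\<in>V. ?c l b w \<beta>)
        \<le> (\<Sum>a\<in>tuples D ?s. \<Sum>w\<in>V. \<Sum>\<beta>\<in>D. ?c l a w \<beta>)" .
    qed
    also have "\<dots> \<le> global_corr V D t M"
      unfolding global_corr_def using b n
      by (intro member_le_sum[of ?s "{..<t}" "\<lambda>s. \<Sum>l\<in>tuples V s. \<Sum>a\<in>tuples D s. \<Sum>w\<in>V. \<Sum>\<beta>\<in>D.
         (M ((w, \<beta>) # zip l a) - M (zip l a) * M [(w, \<beta>)])\<^sup>2 / ?n ^ Suc s"])
        (auto intro!: sum_nonneg)
    finally show ?thesis .
  qed
  ultimately have "(avg (\<beta> # b) - avg [\<beta>] * avg b)\<^sup>2 \<le> global_corr V D t M" by (simp only:)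
  then show ?thesis by (intro real_le_rsqrt) simp
qed

lemma avg_single_bounds:
  assumes V: "finite V" "V \<noteq> {}" and "1 \<le> L"
  shows "\<beta> \<in> D \<Longrightarrow> 0 \<le> avg [\<beta>]" "\<beta> \<in> D \<Longrightarrow> avg [\<beta>] \<le> 1" "(\<Sum>\<beta>\<in>D. avg [\<beta>]) = 1"
proof -
  let ?n = "real (card V)"
  have n: "?n > 0" using V by (simp add: card_gt_0_iff)
  have a1: "avg [\<beta>] = (\<Sum>w\<in>V. M [(w, \<beta>)]) / ?n" for \<beta>
    by (simp add: avg_def sum_tuples_Suc)
  show nn: "0 \<le> avg [\<beta>]" if "\<beta> \<in> D" for \<beta>
    unfolding a1 using that assms by (intro divide_nonneg_nonneg sum_nonneg moment_nonneg) auto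
  have "(\<Sum>\<beta>\<in>D. \<Sum>w\<in>V. M [(w, \<beta>)]) = (\<Sum>w\<in>V. \<Sum>\<beta>\<in>D. M [(w, \<beta>)])" by (rule sum.swap)
  also have "\<dots> = (\<Sum>w\<in>V. 1)"
    using moment_marginal[of _ "[]"] assms by (intro sum.cong refl) (auto simp: moment_Nil)
  finally show one: "(\<Sum>\<beta>\<in>D. avg [\<beta>]) = 1" unfolding a1 using n by (simp flip: sum_divide_distrib)
  show "avg [\<beta>] \<le> 1" if "\<beta> \<in> D" for \<beta>
    using member_le_sum[of \<beta> D "\<lambda>\<beta>. avg [\<beta>]"] nn that finite_D one by auto
qed

text \<open>One entry is split off at a time; the error of the rest is multiplied by
  \<open>avg [\<beta>] \<le> 1\<close>, so errors merely add up.\<close>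

lemma avg_close_to_product:
  assumes V: "finite V" "V \<noteq> {}" and "1 \<le> L"
  shows "set b \<subseteq> D \<Longrightarrow> length b \<le> t \<Longrightarrow>
    \<bar>avg b - (\<Prod>\<beta>\<leftarrow>b. avg [\<beta>])\<bar> \<le> real (length b) * sqrt (global_corr V D t M)"
proof (induction b)
  case Nil
  then show ?case by (simp add: avg_def moment_Nil)
next
  case (Cons \<beta> b)
  let ?c = "sqrt (global_corr V D t M)" and ?P = "\<Prod>\<beta>\<leftarrow>b. avg [\<beta>]"
  have "\<bar>avg (\<beta> # b) - avg [\<beta>] * ?P\<bar> \<le> \<bar>avg (\<beta> # b) - avg [\<beta>] * avg b\<bar> + \<bar>avg [\<beta>] * (avg b - ?P)\<bar>"
    by (simp add: algebra_simps)
  also have "\<bar>avg (\<beta> # b) - avg [\<beta>] * avg b\<bar> \<le> ?c"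
    using Cons.prems V by (intro avg_Cons) auto
  also have "\<bar>avg [\<beta>] * (avg b - ?P)\<bar> \<le> 1 * (real (length b) * ?c)"
    unfolding abs_mult using Cons avg_single_bounds(1,2)[OF assms, of \<beta>] by (intro mult_mono) auto
  finally show ?case by (simp add: algebra_simps)
qed

end

section \<open>Random constraints\<close>

definition idx :: "nat \<Rightarrow> nat list" where
  "idx k = [1..<Suc k]"

lemma set_idx [simp]: "set (idx k) = {1..k}" and distinct_idx [simp]: "distinct (idx k)"
  and length_idx [simp]: "length (idx k) = k"
  by (auto simp: idx_def)

text \<open>An ordered enumeration of \<open>T\<close>, so that \<open>take\<close> and
  \<open>drop\<close> can cut it into two halves.\<close>

definition sel :: "nat \<Rightarrow> nat set \<Rightarrow> nat list" where
  "sel k T = filter (\<lambda>i. i \<in> T) (idx k)"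

lemma set_sel: "T \<subseteq> {1..k} \<Longrightarrow> set (sel k T) = T" and distinct_sel: "distinct (sel k T)"
  by (auto simp: sel_def)

lemma length_sel: "T \<subseteq> {1..k} \<Longrightarrow> length (sel k T) = card T"
  using distinct_card[OF distinct_sel[of k T]] set_sel[of T k] by simp

definition inj_tuples :: "'i set \<Rightarrow> 'v set \<Rightarrow> ('i \<Rightarrow> 'v) set" where
  "inj_tuples I V = {\<sigma> \<in> I \<rightarrow>\<^sub>E V. inj_on \<sigma> I}"

lemma bij_betw_inj_tuples:
  assumes "distinct js" "set js = I"
  shows "bij_betw (\<lambda>\<sigma>. map \<sigma> js) (inj_tuples I V) {l. length l = length js \<and> distinct l \<and> set l \<subseteq> V}"
  unfolding bij_betw_def
proof
  show "inj_on (\<lambda>\<sigma>. map \<sigma> js) (inj_tuples I V)"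
  proof (rule inj_onI)
    fix x y assume "x \<in> inj_tuples I V" "y \<in> inj_tuples I V" "map x js = map y js"
    then show "x = y"
      using assms by (intro PiE_ext[of x I "\<lambda>_. V" y]) (auto simp: inj_tuples_def)
  qed
  show "(\<lambda>\<sigma>. map \<sigma> js) ` inj_tuples I V = {l. length l = length js \<and> distinct l \<and> set l \<subseteq> V}" (is "?A = ?B")
  proof
    show "?A \<subseteq> ?B" using assms by (auto simp: inj_tuples_def distinct_map PiE_iff)
    show "?B \<subseteq> ?A"
    proof
      fix l assume l: "l \<in> ?B"
      define f where "f = (\<lambda>i\<in>I. the (map_of (zip js l) i))"
      have nth: "f (js ! j) = l ! j" if "j < length js" for j
        using that l assms by (auto simp: f_def map_of_zip_nth)
      have "map f js = l" using l nth by (intro nth_equalityI) auto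
      moreover have "f \<in> inj_tuples I V"
      proof -
        have "f \<in> I \<rightarrow>\<^sub>E V"
        proof
          fix i assume "i \<in> I"
          then obtain j where "j < length js" "i = js ! j" using assms by (metis in_set_conv_nth)
          then show "f i \<in> V" using nth[of j] l by (auto simp: subset_iff)
        qed (simp add: f_def)
        moreover have "inj_on f I"
        proof -
          have "distinct (map f js)" using \<open>map f js = l\<close> l by simp
          then show ?thesis using assms by (simp add: distinct_map)
        qed
        ultimately show ?thesis by (simp add: inj_tuples_def)
      qed
      ultimately show "l \<in> ?A" by blast
    qed
  qed
qed

lemma card_inj_tuples:
  assumes "finite I" "finite V" "card I \<le> card V"
  shows "card (inj_tuples I V) = \<Prod>{card V - card I + 1..card V}"
proof -
  obtain js where js: "set js = I" "distinct js" using finite_distinct_list[OF assms(1)] by blast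
  then have "length js = card I" using distinct_card by fastforce
  then show ?thesis
    using bij_betw_same_card[OF bij_betw_inj_tuples[OF js(2,1), of V]]
      card_lists_distinct_length_eq[OF assms(2), of "card I"] assms by simp
qed

lemma finite_inj_tuples: "finite I \<Longrightarrow> finite V \<Longrightarrow> finite (inj_tuples I V)"
  unfolding inj_tuples_def by (rule finite_subset[of _ "I \<rightarrow>\<^sub>E V"]) (auto intro: finite_PiE)

lemma card_inj_tuples_pos: "finite I \<Longrightarrow> finite V \<Longrightarrow> card I \<le> card V \<Longrightarrow> 0 < card (inj_tuples I V)"
  by (subst card_inj_tuples) (auto simp: prod_pos)

text \<open>Every \<open>k\<close>-subset has the same number of bijections, so choosing the subset
  and then the bijection is uniform on injective tuples; the relation is drawn
  independently.\<close>

lemma random_constraint_eq_pair: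
  fixes V :: "'v set"
  assumes "finite V" "k \<le> card V"
  shows "random_constraint k \<rho> V = pair_pmf (pmf_of_set (inj_tuples {1..k} V)) \<rho>"
proof -
  let ?E = "{e. e \<subseteq> V \<and> card e = k}"
  let ?B = "\<lambda>e. {\<sigma> \<in> {1..k} \<rightarrow>\<^sub>E e. bij_betw \<sigma> {1..k} e}"
  have fin: "finite e" if "e \<in> ?E" for e using that assms finite_subset by blast
  have B: "?B e = inj_tuples {1..k} e" if e: "e \<in> ?E" for e
  proof -
    have "\<sigma> ` {1..k} = e" if "\<sigma> \<in> {1..k} \<rightarrow>\<^sub>E e" "inj_on \<sigma> {1..k}" for \<sigma>
      using that e fin[OF e] by (intro card_subset_eq) (auto simp: card_image)
    then show ?thesis by (auto simp: inj_tuples_def bij_betw_def)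
  qed
  have card: "card (?B e) = \<Prod>{1..k}" if "e \<in> ?E" for e
    unfolding B[OF that] using that fin[OF that] by (subst card_inj_tuples) auto
  have un: "(\<Union>e\<in>?E. ?B e) = inj_tuples {1..k} V"
  proof
    show "(\<Union>e\<in>?E. ?B e) \<subseteq> inj_tuples {1..k} V"
      by (auto simp: inj_tuples_def bij_betw_def PiE_iff)
    show "inj_tuples {1..k} V \<subseteq> (\<Union>e\<in>?E. ?B e)"
    proof
      fix \<sigma> assume \<sigma>: "\<sigma> \<in> inj_tuples {1..k} V"
      then have "\<sigma> ` {1..k} \<in> ?E" by (auto simp: inj_tuples_def card_image PiE_iff)
      moreover have "\<sigma> \<in> ?B (\<sigma> ` {1..k})" using \<sigma> by (auto simp: inj_tuples_def bij_betw_def PiE_iff)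
      ultimately show "\<sigma> \<in> (\<Union>e\<in>?E. ?B e)" by blast
    qed
  qed
  have E0: "?E \<noteq> {}" using obtain_subset_with_card_n[OF assms(2)] by blast
  have "pmf_of_set (inj_tuples {1..k} V) = do {e \<leftarrow> pmf_of_set ?E; pmf_of_set (?B e)}"
    unfolding un[symmetric]
  proof (rule pmf_of_set_UN)
    show "finite (\<Union>e\<in>?E. ?B e)" unfolding un using assms finite_inj_tuples by blast
    show "?E \<noteq> {}" by (rule E0)
    show "?B e \<noteq> {}" if "e \<in> ?E" for e
    proof
      assume "?B e = {}"
      then have "card (?B e) = 0" by (simp only: card.empty)
      with card[OF that] show False by (simp add: prod_zero_iff)
    qed
    show "card (?B e) = \<Prod>{1..k}" if "e \<in> ?E" for e using card[OF that] .
    show "disjoint_family_on ?B ?E" by (auto simp: disjoint_family_on_def bij_betw_def)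
  qed
  then show ?thesis
    unfolding random_constraint_def pair_pmf_def by (simp add: bind_assoc_pmf)
qed

lemma expectation_random_constraint:
  fixes g :: "(nat \<Rightarrow> 'v) \<Rightarrow> real"
  assumes "finite V" "k \<le> card V" "\<And>\<sigma>. \<bar>g \<sigma>\<bar> \<le> 1"
  shows "measure_pmf.expectation (random_constraint k \<rho> V) (\<lambda>(\<sigma>, R'). if R' = R then g \<sigma> else 0) =
    pmf \<rho> R * ((\<Sum>\<sigma>\<in>inj_tuples {1..k} V. g \<sigma>) / real (card (inj_tuples {1..k} V)))"
proof -
  let ?A = "inj_tuples {1..k} V"
  have A: "finite ?A" "?A \<noteq> {}"
    using assms finite_inj_tuples[of "{1..k}" V] card_inj_tuples_pos[of "{1..k}" V] by (auto simp: card_gt_0_iff)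
  have "measure_pmf.expectation (random_constraint k \<rho> V) (\<lambda>(\<sigma>, R'). if R' = R then g \<sigma> else 0)
     = (\<Sum>x\<in>?A \<times> {R}. (case x of (\<sigma>, R') \<Rightarrow> if R' = R then g \<sigma> else 0) * pmf (random_constraint k \<rho> V) x)"
    using A by (intro integral_measure_pmf_real)
      (auto simp: random_constraint_eq_pair[OF assms(1,2)] split: if_splits)
  also have "\<dots> = (\<Sum>\<sigma>\<in>?A. g \<sigma> * (pmf \<rho> R / real (card ?A)))"
    unfolding sum.cartesian_product' using A by (simp add: random_constraint_eq_pair[OF assms(1,2)] pmf_pair)
  also have "\<dots> = pmf \<rho> R * ((\<Sum>\<sigma>\<in>?A. g \<sigma>) / real (card ?A))"
    by (simp add: sum_distrib_left sum_divide_distrib mult_ac)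
  finally show ?thesis .
qed

section \<open>Injective tuples compared with all tuples\<close>

lemma sum_tuples_take:
  fixes h :: "'x list \<Rightarrow> real"
  assumes "finite A"
  shows "(\<Sum>l\<in>tuples A (t + d). h (take t l)) = real (card A) ^ d * (\<Sum>l\<in>tuples A t. h l)"
proof (induction t arbitrary: h)
  case 0
  then show ?case using assms by (simp add: card_tuples)
next
  case (Suc t)
  show ?case
    using Suc[of "\<lambda>l. h (x # l)" for x] by (simp add: sum_tuples_Suc sum_distrib_left)
qed

text \<open>Going from \<open>B\<close> to its part \<open>A\<close> has two effects of opposite
  sign, the new normalisation and the omitted points; each is at most the omitted fraction, since
  \<open>f\<close> takes values in \<open>[0, 1]\<close>.\<close>

lemma abs_diff_averages_le:
  fixes f :: "'x \<Rightarrow> real"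
  assumes "finite B" "A \<subseteq> B" "A \<noteq> {}" and f: "\<And>x. x \<in> B \<Longrightarrow> 0 \<le> f x" "\<And>x. x \<in> B \<Longrightarrow> f x \<le> 1"
  shows "\<bar>sum f A / real (card A) - sum f B / real (card B)\<bar> \<le> 1 - real (card A) / real (card B)"
proof -
  have finA: "finite A" using assms finite_subset by blast
  define a b where "a = real (card A)" and "b = real (card B)"
  have a: "0 < a" and ab: "a \<le> b"
    using assms finA card_mono[of B A] by (auto simp: a_def b_def card_gt_0_iff)
  have split: "sum f B = sum f A + sum f (B - A)"
    using assms by (metis add.commute sum.subset_diff)
  have SA: "0 \<le> sum f A" "sum f A \<le> a"
    using assms sum_bounded_above[of A f 1] by (auto simp: a_def intro!: sum_nonneg)
  have "sum f (B - A) \<le> real (card (B - A))" using sum_bounded_above[of "B - A" f 1] f by auto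
  also have "\<dots> = b - a" using assms card_Diff_subset[OF finA assms(2)] card_mono[of B A]
    by (simp add: a_def b_def of_nat_diff)
  finally have SB: "0 \<le> sum f (B - A)" "sum f (B - A) \<le> b - a"
    using f by (auto intro!: sum_nonneg)
  have x: "sum f A / a - sum f A / b = sum f A / a * (1 - a / b)"
    using a ab by (simp add: field_simps)
  have 1: "0 \<le> sum f A / a - sum f A / b" "sum f A / a - sum f A / b \<le> 1 * (1 - a / b)"
    unfolding x using SA a ab by (intro mult_nonneg_nonneg mult_right_mono; simp)+
  have 2: "0 \<le> sum f (B - A) / b" "sum f (B - A) / b \<le> 1 - a / b"
    using SB a ab by (auto simp: field_simps)
  have "sum f A / a - sum f B / b = (sum f A / a - sum f A / b) - sum f (B - A) / b"
    by (simp add: split add_divide_distrib)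
  with 1 2 show ?thesis unfolding a_def[symmetric] b_def[symmetric] by (simp add: abs_le_iff)
qed

text \<open>The list \<tau> is completed to an enumeration of all \<open>k\<close> positions. Among
  all \<open>k\<close>-tuples the injective ones have share at least \<open>(1 - k / n) ^ k\<close>,
  hence at least \<open>1 - k ^ 2 / n\<close> by Bernoulli's inequality.\<close>

lemma average_inj_tuples_close:
  fixes h :: "'v list \<Rightarrow> real"
  assumes V: "finite V" "card V = n" "k \<le> n" "0 < n" and \<tau>: "distinct \<tau>" "set \<tau> \<subseteq> {1..k}"
    and h: "\<And>l. l \<in> tuples V (length \<tau>) \<Longrightarrow> 0 \<le> h l" "\<And>l. l \<in> tuples V (length \<tau>) \<Longrightarrow> h l \<le> 1"
  shows "\<bar>(\<Sum>\<sigma>\<in>inj_tuples {1..k} V. h (map \<sigma> \<tau>)) / real (card (inj_tuples {1..k} V)) -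
    (\<Sum>l\<in>tuples V (length \<tau>). h l) / real n ^ length \<tau>\<bar> \<le> real k ^ 2 / real n"
proof -
  let ?t = "length \<tau>"
  obtain rest where rest: "set rest = {1..k} - set \<tau>" "distinct rest"
    using finite_distinct_list[of "{1..k} - set \<tau>"] by auto
  define js where "js = \<tau> @ rest"
  have js: "distinct js" "set js = {1..k}" using rest \<tau> by (auto simp: js_def)
  then have len: "length js = k" using distinct_card[OF js(1)] by simp
  then have k: "k = ?t + length rest" by (simp add: js_def)
  let ?DL = "{l. length l = length js \<and> distinct l \<and> set l \<subseteq> V}"
  have bij: "bij_betw (\<lambda>\<sigma>. map \<sigma> js) (inj_tuples {1..k} V) ?DL"
    by (rule bij_betw_inj_tuples[OF js])
  define f where "f l = h (take ?t l)" for l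
  have cardDL: "card ?DL = card (inj_tuples {1..k} V)" using bij_betw_same_card[OF bij] by simp
  have "(\<Sum>\<sigma>\<in>inj_tuples {1..k} V. h (map \<sigma> \<tau>)) = (\<Sum>\<sigma>\<in>inj_tuples {1..k} V. f (map \<sigma> js))"
    by (simp add: f_def js_def)
  also have "\<dots> = sum f ?DL" by (rule sum.reindex_bij_betw[OF bij])
  finally have 1: "(\<Sum>\<sigma>\<in>inj_tuples {1..k} V. h (map \<sigma> \<tau>)) = sum f ?DL" .
  have "sum f (tuples V k) = real n ^ length rest * (\<Sum>l\<in>tuples V ?t. h l)"
    unfolding f_def k using sum_tuples_take[OF V(1), of h ?t "length rest"] V by simp
  then have 2: "sum f (tuples V k) / real n ^ k = (\<Sum>l\<in>tuples V ?t. h l) / real n ^ ?t"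
    using V by (subst (2) k) (simp add: power_add)
  have cardT: "real (card (tuples V k)) = real n ^ k" using V by (simp add: card_tuples)
  have pos: "0 < card ?DL" unfolding cardDL using V by (intro card_inj_tuples_pos) auto
  have "\<bar>sum f ?DL / real (card ?DL) - sum f (tuples V k) / real (card (tuples V k))\<bar>
     \<le> 1 - real (card ?DL) / real (card (tuples V k))"
  proof (rule abs_diff_averages_le)
    show "finite (tuples V k)" using V by simp
    show "?DL \<subseteq> tuples V k" by (auto simp: tuples_def len)
    show "?DL \<noteq> {}" using pos by (metis card.empty less_irrefl)
    fix l assume "l \<in> tuples V k"
    then have "take ?t l \<in> tuples V ?t" using k by (auto simp: tuples_def dest: in_set_takeD)
    with h show "0 \<le> f l" "f l \<le> 1" by (auto simp: f_def)
  qed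
  also have "1 - real (card ?DL) / real (card (tuples V k)) \<le> real k ^ 2 / real n"
  proof -
    have "(n - k) ^ k \<le> \<Prod>{n - k + 1..n}"
    proof -
      have "(n - k) ^ k = (\<Prod>i\<in>{n - k + 1..n}. n - k)" using V by simp
      also have "\<dots> \<le> \<Prod>{n - k + 1..n}" by (intro prod_mono) auto
      finally show ?thesis .
    qed
    also have "\<dots> = card ?DL" unfolding cardDL using V by (subst card_inj_tuples) auto
    finally have "real ((n - k) ^ k) \<le> real (card ?DL)" by (rule of_nat_mono)
    then have "(real n - real k) ^ k / real n ^ k \<le> real (card ?DL) / real n ^ k"
      using V by (intro divide_right_mono) (auto simp: of_nat_diff)
    moreover have "(real n - real k) ^ k / real n ^ k = (1 + (- (real k / real n))) ^ k"
      using V by (simp add: power_divide[symmetric] diff_divide_distrib)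
    moreover have "1 + real k * (- (real k / real n)) \<le> (1 + (- (real k / real n))) ^ k"
      using V by (intro Bernoulli_inequality) auto
    ultimately show ?thesis unfolding cardT by (simp add: power2_eq_square)
  qed
  finally show ?thesis unfolding 1 cardDL cardT 2 .
qed

section \<open>Rounding on a good instance\<close>

context pseudo_moments
begin

text \<open>The kernel \<open>M (q @ q')\<close> on half-tuples is positive semidefinite by
  \<open>moment_psd\<close> with empty prefix. Both half-patterns \<open>b\<close> and
  \<open>b'\<close> go into one label set \<open>Q\<close>, so rows and columns come from the same
  Gram vectors.\<close>

lemma moment_grothendieck:
  fixes wt :: "'o \<Rightarrow> real"
  assumes V: "finite V" and \<Omega>: "finite \<Omega>" and L: "2 * s \<le> L"
    and fg: "\<And>\<omega>. \<omega> \<in> \<Omega> \<Longrightarrow> f \<omega> \<in> tuples V s" "\<And>\<omega>. \<omega> \<in> \<Omega> \<Longrightarrow> g \<omega> \<in> tuples V s"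
    and sign: "\<And>S T. S \<subseteq> tuples V s \<Longrightarrow> T \<subseteq> tuples V s \<Longrightarrow>
      (\<Sum>\<omega>\<in>\<Omega>. wt \<omega> * (sg S (f \<omega>) * sg T (g \<omega>))) \<le> \<tau>"
    and b: "b \<in> tuples D s" "b' \<in> tuples D s"
  shows "\<bar>\<Sum>\<omega>\<in>\<Omega>. wt \<omega> * M (zip (f \<omega>) b @ zip (g \<omega>) b')\<bar> \<le> 128 * \<tau>"
proof -
  let ?X = "tuples V s"
  define Q where "Q = (\<lambda>l. zip l b) ` ?X \<union> (\<lambda>l. zip l b') ` ?X"
  have Q: "set q \<subseteq> V \<times> D \<and> length q = s" if "q \<in> Q" for q
    using that b set_zip_tuples[of _ V s _ D] length_zip_tuples[of _ V s _ D]
    unfolding Q_def by (elim UnE imageE) metis+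
  have finQ: "finite Q" using V by (simp add: Q_def)
  have "0 \<le> (\<Sum>q\<in>Q. \<Sum>q'\<in>Q. c q * c q' * M ([] @ q @ q'))" for c
    using Q finQ L by (intro moment_psd) auto
  then have psd: "0 \<le> (\<Sum>q\<in>Q. \<Sum>q'\<in>Q. c q * c q' * M (q @ q'))" for c by simp
  show ?thesis
  proof (rule grothendieck_kernel[where G = "\<lambda>q q'. M (q @ q')" and p = "\<lambda>l. zip l b" and p' = "\<lambda>l. zip l b'"
      and I = ?X and J = ?X and Q = Q, OF \<Omega> _ _ fg sign])
    show "M (q @ q') = M (q' @ q)" for q q' by (intro moment_perm) simp
    show "M (q @ q) \<le> 1" if "q \<in> Q" for q using Q[OF that] L by (intro moment_le_1) auto
  qed (use V finQ psd in \<open>auto simp: Q_def\<close>)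
qed

text \<open>Free coordinates are summed out by \<open>moment_marginal\<close>; fixed ones move into
  the accumulator \<open>ps\<close>.\<close>

lemma moment_marginal_PiE:
  assumes "distinct js" "\<And>i. i \<in> set js \<Longrightarrow> \<sigma> i \<in> V" "\<And>i. i \<in> set js \<Longrightarrow> x i \<in> D"
    "set ps \<subseteq> V \<times> D" "length js + length ps \<le> L"
  shows "(\<Sum>z\<in>PiE (set js) (\<lambda>i. if i \<in> T then {x i} else D). M (map (\<lambda>i. (\<sigma> i, z i)) js @ ps)) =
    M (map (\<lambda>i. (\<sigma> i, x i)) (filter (\<lambda>i. i \<in> T) js) @ ps)"
  using assms
proof (induction js arbitrary: ps)
  case Nil
  then show ?case by simp
next
  case (Cons i js)
  let ?B = "\<lambda>i. if i \<in> T then {x i} else D"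
  have i: "i \<notin> set js" "\<sigma> i \<in> V" "x i \<in> D" using Cons.prems by auto
  have zD: "z j \<in> D" if "z \<in> PiE (set js) ?B" "j \<in> set js" for z j
    using PiE_mem[OF that] Cons.prems(3)[of j] that by (auto split: if_splits)
  have "(\<Sum>z\<in>PiE (set (i # js)) ?B. M (map (\<lambda>i. (\<sigma> i, z i)) (i # js) @ ps)) =
     (\<Sum>(y, z)\<in>?B i \<times> PiE (set js) ?B. M ((\<sigma> i, y) # map (\<lambda>i. (\<sigma> i, z i)) js @ ps))"
  proof -
    have eq: "PiE (set (i # js)) ?B = (\<lambda>(y, g). g(i := y)) ` (?B i \<times> PiE (set js) ?B)"
      by (simp only: list.set PiE_insert_eq)
    have upd: "map (\<lambda>j. (\<sigma> j, (z(i := y)) j)) js = map (\<lambda>j. (\<sigma> j, z j)) js" for z y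
      using i by (intro map_cong) auto
    show ?thesis
      unfolding eq using inj_combinator[OF i(1), of ?B]
      by (subst sum.reindex) (auto simp: comp_def upd[unfolded fun_upd_def] fun_upd_def split_def intro!: sum.cong arg_cong[where f = M])
  qed
  also have "\<dots> = (\<Sum>z\<in>PiE (set js) ?B. \<Sum>y\<in>?B i. M ((\<sigma> i, y) # map (\<lambda>i. (\<sigma> i, z i)) js @ ps))"
    by (subst sum.swap) (simp add: sum.cartesian_product)
  also have "\<dots> = M (map (\<lambda>i. (\<sigma> i, x i)) (filter (\<lambda>i. i \<in> T) (i # js)) @ ps)"
  proof (cases "i \<in> T")
    case True
    have "(\<Sum>z\<in>PiE (set js) ?B. \<Sum>y\<in>?B i. M ((\<sigma> i, y) # map (\<lambda>i. (\<sigma> i, z i)) js @ ps)) =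
       (\<Sum>z\<in>PiE (set js) ?B. M (map (\<lambda>i. (\<sigma> i, z i)) js @ (\<sigma> i, x i) # ps))"
      using True by (intro sum.cong refl) (auto intro!: moment_perm)
    also have "\<dots> = M (map (\<lambda>i. (\<sigma> i, x i)) (filter (\<lambda>i. i \<in> T) js) @ (\<sigma> i, x i) # ps)"
      using Cons.prems by (intro Cons.IH) auto
    also have "\<dots> = M (map (\<lambda>i. (\<sigma> i, x i)) (filter (\<lambda>i. i \<in> T) (i # js)) @ ps)"
      using True by (intro moment_perm) simp
    finally show ?thesis .
  next
    case False
    have "(\<Sum>z\<in>PiE (set js) ?B. \<Sum>y\<in>?B i. M ((\<sigma> i, y) # map (\<lambda>i. (\<sigma> i, z i)) js @ ps)) =
       (\<Sum>z\<in>PiE (set js) ?B. M (map (\<lambda>i. (\<sigma> i, z i)) js @ ps))"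
    proof (intro sum.cong refl)
      fix z assume z: "z \<in> PiE (set js) ?B"
      have "(\<Sum>y\<in>D. M ((\<sigma> i, y) # map (\<lambda>i. (\<sigma> i, z i)) js @ ps)) = M (map (\<lambda>i. (\<sigma> i, z i)) js @ ps)"
        using Cons.prems zD[OF z] i by (intro moment_marginal) auto
      then show "(\<Sum>y\<in>?B i. M ((\<sigma> i, y) # map (\<lambda>i. (\<sigma> i, z i)) js @ ps)) = M (map (\<lambda>i. (\<sigma> i, z i)) js @ ps)"
        using False by simp
    qed
    also have "\<dots> = M (map (\<lambda>i. (\<sigma> i, x i)) (filter (\<lambda>i. i \<in> T) js) @ ps)"
      using Cons.prems by (intro Cons.IH) auto
    finally show ?thesis using False by simp
  qed
  finally show ?case .
qed

lemma marg_moment: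
  assumes \<sigma>: "\<And>i. i \<in> {1..k} \<Longrightarrow> \<sigma> i \<in> V" and x: "x \<in> ({1..k} \<rightarrow>\<^sub>E D)" and T: "T \<subseteq> {1..k}" and "k \<le> L"
  shows "marg {1..k} D T (\<lambda>z. M (map (\<lambda>i. (\<sigma> i, z i)) (idx k))) x = M (map (\<lambda>i. (\<sigma> i, x i)) (sel k T))"
proof -
  have "marg {1..k} D T (\<lambda>z. M (map (\<lambda>i. (\<sigma> i, z i)) (idx k))) x =
     (\<Sum>z\<in>PiE (set (idx k)) (\<lambda>i. if i \<in> T then {x i} else D). M (map (\<lambda>i. (\<sigma> i, z i)) (idx k) @ []))"
    unfolding marg_def cube_agree_eq_PiE[OF T x] by simp
  also have "\<dots> = M (map (\<lambda>i. (\<sigma> i, x i)) (sel k T) @ [])"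
    unfolding sel_def using assms PiE_mem[OF x] by (intro moment_marginal_PiE) auto
  finally show ?thesis by simp
qed

end

lemma zip_map_split:
  "zip (map f xs) (map g xs) = zip (map f (take s xs)) (map g (take s xs)) @ zip (map f (drop s xs)) (map g (drop s xs))"
proof -
  have "zip (map f xs) (map g xs) = map (\<lambda>i. (f i, g i)) (take s xs @ drop s xs)"
    by (simp only: append_take_drop_id zip_map_map zip_same_conv_map) simp
  then show ?thesis by (simp only: map_append zip_map_map zip_same_conv_map) simp
qed

definition sign_test :: "nat \<Rightarrow> nat \<Rightarrow> nat set \<Rightarrow> nat list set \<Rightarrow> nat list set \<Rightarrow> (nat \<Rightarrow> nat) \<Rightarrow> real" where
  "sign_test k s T S S' \<sigma> = sg S (map \<sigma> (take s (sel k T))) * sg S' (map \<sigma> (drop s (sel k T)))"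

lemma finite_card_relations:
  fixes \<rho> :: "(nat \<Rightarrow> 'a) set pmf"
  assumes "finite D" "\<And>R. R \<in> set_pmf \<rho> \<Longrightarrow> R \<subseteq> ({1..k} \<rightarrow>\<^sub>E D)"
  shows "finite (set_pmf \<rho>)" and "card (set_pmf \<rho>) \<le> 2 ^ (card D ^ k)"
proof -
  have fin: "finite ({1..k} \<rightarrow>\<^sub>E D)" by (rule finite_cube[OF finite_atLeastAtMost assms(1)])
  have sub: "set_pmf \<rho> \<subseteq> Pow ({1..k} \<rightarrow>\<^sub>E D)" using assms(2) by blast
  then show "finite (set_pmf \<rho>)" using fin finite_subset by blast
  show "card (set_pmf \<rho>) \<le> 2 ^ (card D ^ k)"
    using card_mono[OF _ sub] fin by (simp add: card_Pow card_cube[OF finite_atLeastAtMost])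
qed

text \<open>The deterministic event behind the argument. It speaks of finitely many sign patterns
  and of no pseudo-distribution, so a union bound reaches it. One-sided bounds suffice, since
  exchanging \<open>S\<close> for its complement changes the sign of the test.\<close>

locale good_instance =
  fixes k t n m :: nat and D :: "'a set" and \<rho> :: "(nat \<Rightarrow> 'a) set pmf"
    and \<sigma> :: "nat \<Rightarrow> nat \<Rightarrow> nat" and Rel :: "nat \<Rightarrow> (nat \<Rightarrow> 'a) set" and \<tau> :: real
  assumes D: "finite D" "D \<noteq> {}" and t: "even t" "2 \<le> t" "t \<le> k" and n: "k \<le> n" and m: "0 < m"
    and rel: "\<And>R. R \<in> set_pmf \<rho> \<Longrightarrow> R \<subseteq> ({1..k} \<rightarrow>\<^sub>E D)"
    and Rel: "\<And>i. i < m \<Longrightarrow> Rel i \<in> set_pmf \<rho>"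
    and \<sigma>: "\<And>i. i < m \<Longrightarrow> \<sigma> i \<in> inj_tuples {1..k} {..<n}"
    and good: "\<And>R T S S'. R \<in> set_pmf \<rho> \<Longrightarrow> T \<subseteq> {1..k} \<Longrightarrow> card T = t \<Longrightarrow>
      S \<subseteq> tuples {..<n} (t div 2) \<Longrightarrow> S' \<subseteq> tuples {..<n} (t div 2) \<Longrightarrow>
      (\<Sum>i<m. if Rel i = R then sign_test k (t div 2) T S S' (\<sigma> i) else 0) / real m -
      pmf \<rho> R * ((\<Sum>\<pi>\<in>inj_tuples {1..k} {..<n}. sign_test k (t div 2) T S S' \<pi>) /
        real (card (inj_tuples {1..k} {..<n}))) \<le> \<tau>"
begin

abbreviation "Inj \<equiv> inj_tuples {1..k} {..<n}"

lemma finite_Inj: "finite Inj" and card_Inj: "0 < card Inj"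
  using n by (auto intro!: finite_inj_tuples card_inj_tuples_pos)

lemma Inj_mem: "\<pi> \<in> Inj \<Longrightarrow> i \<in> {1..k} \<Longrightarrow> \<pi> i < n"
  by (auto simp: inj_tuples_def PiE_iff)

lemma finite_rels: "finite (set_pmf \<rho>)" and card_rels: "card (set_pmf \<rho>) \<le> 2 ^ (card D ^ k)"
  by (rule finite_card_relations[OF D(1)], erule rel)+

lemma map_take_sel:
  assumes "T \<subseteq> {1..k}" "card T = t" "\<pi> \<in> Inj"
  shows "map \<pi> (take (t div 2) (sel k T)) \<in> tuples {..<n} (t div 2)"
    and "map \<pi> (drop (t div 2) (sel k T)) \<in> tuples {..<n} (t div 2)"
    and "map \<pi> (sel k T) \<in> tuples {..<n} t"
proof -
  have len: "length (sel k T) = t" using length_sel[of T k] assms by simp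
  have "t = t div 2 + t div 2" using t(1) by auto
  then have "t - t div 2 = t div 2" by simp
  moreover have "\<pi> i < n" if "i \<in> set (sel k T)" for i
    using that Inj_mem[OF assms(3), of i] set_sel[OF assms(1)] assms(1) by blast
  ultimately show "map \<pi> (take (t div 2) (sel k T)) \<in> tuples {..<n} (t div 2)"
    "map \<pi> (drop (t div 2) (sel k T)) \<in> tuples {..<n} (t div 2)" "map \<pi> (sel k T) \<in> tuples {..<n} t"
    using len by (auto simp: tuples_def dest: in_set_takeD in_set_dropD)
qed

lemma local_distribution:
  assumes M: "pseudo_moments {..<n} D L M" "k \<le> L" and i: "i < m"
  shows "z \<in> ({1..k} \<rightarrow>\<^sub>E D) \<Longrightarrow> 0 \<le> M (map (\<lambda>j. (\<sigma> i j, z j)) (idx k))"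
    and "(\<Sum>z\<in>({1..k} \<rightarrow>\<^sub>E D). M (map (\<lambda>j. (\<sigma> i j, z j)) (idx k))) = 1"
    and "R \<subseteq> ({1..k} \<rightarrow>\<^sub>E D) \<Longrightarrow> (\<Sum>z\<in>R. M (map (\<lambda>j. (\<sigma> i j, z j)) (idx k))) \<le> 1"
proof -
  interpret pseudo_moments "{..<n}" D L M by (rule M)
  let ?Z = "{1..k} \<rightarrow>\<^sub>E D" and ?X = "\<lambda>z. M (map (\<lambda>j. (\<sigma> i j, z j)) (idx k))"
  show nn: "0 \<le> ?X z" if "z \<in> ?Z" for z
    using Inj_mem[OF \<sigma>[OF i]] PiE_mem[OF that] M(2) by (intro moment_nonneg) auto
  obtain a where "a \<in> D" using D by blast
  then have "marg {1..k} D {} ?X (\<lambda>i\<in>{1..k}. a) = M (map (\<lambda>j. (\<sigma> i j, (\<lambda>i\<in>{1..k}. a) j)) (sel k {}))"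
    using Inj_mem[OF \<sigma>[OF i]] M(2) by (intro marg_moment) auto
  then show one: "sum ?X ?Z = 1" by (simp add: marg_def sel_def moment_Nil)
  show "sum ?X R \<le> 1" if "R \<subseteq> ?Z"
    using sum_mono2[OF finite_cube[OF finite_atLeastAtMost D(1)] that, of ?X] nn one by auto
qed

definition freq :: "(nat \<Rightarrow> 'a) set \<Rightarrow> real" where
  "freq R = (\<Sum>i<m. if Rel i = R then 1 else 0) / real m"

text \<open>With constant signs the tests merely count constraints: all signs positive gives one
  direction, \<open>S = {}\<close> the other.\<close>

lemma freq_close:
  assumes "R \<in> set_pmf \<rho>"
  shows "\<bar>freq R - pmf \<rho> R\<bar> \<le> \<tau>"
proof -
  let ?X = "tuples {..<n} (t div 2)"
  have T: "{1..t} \<subseteq> {1..k}" "card {1..t} = t" using t by auto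
  have pos: "sign_test k (t div 2) {1..t} ?X ?X \<pi> = 1" "sign_test k (t div 2) {1..t} {} ?X \<pi> = - 1" if "\<pi> \<in> Inj" for \<pi>
    using map_take_sel[OF T that] by (simp_all add: sign_test_def sg_def)
  have e1: "(\<Sum>i<m. if Rel i = R then sign_test k (t div 2) {1..t} ?X ?X (\<sigma> i) else 0) = (\<Sum>i<m. if Rel i = R then 1 else 0)"
    using pos \<sigma> by (intro sum.cong) auto
  have e2: "(\<Sum>i<m. if Rel i = R then sign_test k (t div 2) {1..t} {} ?X (\<sigma> i) else 0) = (\<Sum>i<m. - (if Rel i = R then 1 else 0))"
    using pos \<sigma> by (intro sum.cong) auto
  show ?thesis
    using good[OF assms T order_refl order_refl] good[OF assms T empty_subsetI order_refl] pos card_Inj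
    unfolding e1 e2 by (simp add: freq_def sum_negf abs_le_iff)
qed

text \<open>The average over constraints and that over all injective tuples are merged into one
  signed weight on a disjoint union, so one use of \<open>moment_grothendieck\<close> bounds their
  difference.\<close>

lemma empirical_marginal_close:
  assumes M: "pseudo_moments {..<n} D L M" "t \<le> L" and R: "R \<in> set_pmf \<rho>"
    and T: "T \<subseteq> {1..k}" "card T = t" and x: "x \<in> ({1..k} \<rightarrow>\<^sub>E D)"
  shows "\<bar>(\<Sum>i<m. if Rel i = R then M (zip (map (\<sigma> i) (sel k T)) (map x (sel k T))) else 0) / real m -
    pmf \<rho> R * ((\<Sum>\<pi>\<in>Inj. M (zip (map \<pi> (sel k T)) (map x (sel k T)))) / real (card Inj))\<bar> \<le> 128 * \<tau>"
proof -
  interpret pseudo_moments "{..<n}" D L M by (rule M)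
  let ?s = "t div 2" and ?sel = "sel k T"
  define \<Omega> where "\<Omega> = {..<m} <+> Inj"
  define pj where "pj = case_sum \<sigma> (\<lambda>\<pi>. \<pi>)"
  define wt where "wt = case_sum (\<lambda>i. if Rel i = R then 1 / real m else 0) (\<lambda>\<pi>::nat \<Rightarrow> nat. - (pmf \<rho> R / real (card Inj)))"
  have sum\<Omega>: "(\<Sum>\<omega>\<in>\<Omega>. wt \<omega> * h (pj \<omega>)) = (\<Sum>i<m. if Rel i = R then h (\<sigma> i) else 0) / real m -
     pmf \<rho> R * ((\<Sum>\<pi>\<in>Inj. h \<pi>) / real (card Inj))" for h
  proof -
    have "(\<Sum>\<omega>\<in>\<Omega>. wt \<omega> * h (pj \<omega>)) = (\<Sum>i<m. (if Rel i = R then 1 / real m else 0) * h (\<sigma> i)) +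
        (\<Sum>\<pi>\<in>Inj. - (pmf \<rho> R / real (card Inj)) * h \<pi>)"
      unfolding \<Omega>_def using finite_Inj by (simp add: sum.Plus wt_def pj_def comp_def)
    also have "(\<Sum>i<m. (if Rel i = R then 1 / real m else 0) * h (\<sigma> i)) = (\<Sum>i<m. if Rel i = R then h (\<sigma> i) else 0) / real m"
      unfolding sum_divide_distrib by (intro sum.cong) auto
    also have "(\<Sum>\<pi>\<in>Inj. - (pmf \<rho> R / real (card Inj)) * h \<pi>) = - (pmf \<rho> R * ((\<Sum>\<pi>\<in>Inj. h \<pi>) / real (card Inj)))"
      by (simp add: sum_negf sum_distrib_left sum_divide_distrib)
    finally show ?thesis by simp
  qed
  have pj: "pj \<omega> \<in> Inj" if "\<omega> \<in> \<Omega>" for \<omega> using that \<sigma> by (auto simp: \<Omega>_def pj_def)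
  have xb: "map x (take ?s ?sel) \<in> tuples D ?s" "map x (drop ?s ?sel) \<in> tuples D ?s"
  proof -
    have "length ?sel = t" using length_sel T by simp
    moreover have "x i \<in> D" if "i \<in> set ?sel" for i
      using PiE_mem[OF x, of i] that set_sel[OF T(1)] T by blast
    moreover have "t - ?s = ?s" using t(1) by auto
    ultimately show "map x (take ?s ?sel) \<in> tuples D ?s" "map x (drop ?s ?sel) \<in> tuples D ?s"
      by (auto simp: tuples_def dest: in_set_takeD in_set_dropD)
  qed
  have "\<bar>\<Sum>\<omega>\<in>\<Omega>. wt \<omega> * M (zip (map (pj \<omega>) (take ?s ?sel)) (map x (take ?s ?sel)) @
      zip (map (pj \<omega>) (drop ?s ?sel)) (map x (drop ?s ?sel)))\<bar> \<le> 128 * \<tau>"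
  proof (rule moment_grothendieck[OF _ _ _ _ _ _ xb])
    show "finite \<Omega>" using finite_Inj by (simp add: \<Omega>_def)
    show "2 * ?s \<le> L" using M(2) by simp
    show "(\<Sum>\<omega>\<in>\<Omega>. wt \<omega> * (sg S (map (pj \<omega>) (take ?s ?sel)) * sg S' (map (pj \<omega>) (drop ?s ?sel)))) \<le> \<tau>"
      if "S \<subseteq> tuples {..<n} ?s" "S' \<subseteq> tuples {..<n} ?s" for S S'
      using good[OF R T that] unfolding sign_test_def[symmetric] sum\<Omega> .
  qed (use map_take_sel[OF T pj] in auto)
  then show ?thesis
    unfolding zip_map_split[symmetric] sum\<Omega>[of "\<lambda>f. M (zip (map f ?sel) (map x ?sel))"] .
qed

text \<open>Three comparisons: constraints with relation \<open>R\<close> against injective tuples,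
  these against all tuples, and all tuples against the product. In the first, replacing
  \<open>pmf \<rho> R\<close> by \<open>freq R\<close> turns 128 into 129, and
  \<open>freq R \<ge> \<theta> / 2\<close> doubles it to 258.\<close>

lemma marginal_close_to_product:
  assumes M: "pseudo_moments {..<n} D L M" "k \<le> L" and R: "R \<in> set_pmf \<rho>"
    and T: "T \<subseteq> {1..k}" "card T = t" and x: "x \<in> ({1..k} \<rightarrow>\<^sub>E D)"
    and \<theta>: "0 < \<theta>" "\<theta> \<le> pmf \<rho> R" "\<tau> \<le> \<theta> / 2"
  shows "\<bar>marg {1..k} D T (\<lambda>z. (\<Sum>i<m. if Rel i = R then M (map (\<lambda>j. (\<sigma> i j, z j)) (idx k)) else 0) / real m / freq R) x -
     (\<Prod>i\<in>T. pseudo_moments.avg {..<n} M [x i])\<bar>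
     \<le> 258 * \<tau> / \<theta> + (real k ^ 2 / real n + real k * sqrt (global_corr {..<n} D t M))"
proof -
  interpret pseudo_moments "{..<n}" D L M by (rule M)
  let ?sel = "sel k T" and ?\<mu> = "\<lambda>z. (\<Sum>i<m. if Rel i = R then M (map (\<lambda>j. (\<sigma> i j, z j)) (idx k)) else 0) / real m / freq R"
  have n0: "0 < n" using t n by simp
  define X where "X = (\<Sum>i<m. if Rel i = R then M (zip (map (\<sigma> i) ?sel) (map x ?sel)) else 0) / real m"
  define y where "y = freq R"
  define E where "E = (\<Sum>\<pi>\<in>Inj. M (zip (map \<pi> ?sel) (map x ?sel))) / real (card Inj)"
  have y: "\<bar>y - pmf \<rho> R\<bar> \<le> \<tau>" unfolding y_def by (rule freq_close[OF R])
  then have y2: "\<theta> / 2 \<le> y" using \<theta> by (simp add: abs_le_iff)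
  have zipmap: "zip (map f ?sel) (map x ?sel) = map (\<lambda>j. (f j, x j)) ?sel" for f :: "nat \<Rightarrow> nat"
    by (simp add: zip_map_map zip_same_conv_map comp_def)
  have "marg {1..k} D T ?\<mu> x
     = (1 / real m / y) * (\<Sum>i<m. marg {1..k} D T (\<lambda>z. if Rel i = R then M (map (\<lambda>j. (\<sigma> i j, z j)) (idx k)) else 0) x)"
    unfolding marg_sum[symmetric] marg_cmult[symmetric] by (simp add: y_def)
  also have "(\<Sum>i<m. marg {1..k} D T (\<lambda>z. if Rel i = R then M (map (\<lambda>j. (\<sigma> i j, z j)) (idx k)) else 0) x)
     = (\<Sum>i<m. if Rel i = R then M (zip (map (\<sigma> i) ?sel) (map x ?sel)) else 0)"
  proof (intro sum.cong refl)
    fix i assume i: "i \<in> {..<m}"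
    have "marg {1..k} D T (\<lambda>z. M (map (\<lambda>j. (\<sigma> i j, z j)) (idx k))) x = M (map (\<lambda>j. (\<sigma> i j, x j)) ?sel)"
      using Inj_mem[OF \<sigma>, of i] i x T M(2) by (intro marg_moment) auto
    then show "marg {1..k} D T (\<lambda>z. if Rel i = R then M (map (\<lambda>j. (\<sigma> i j, z j)) (idx k)) else 0) x =
       (if Rel i = R then M (zip (map (\<sigma> i) ?sel) (map x ?sel)) else 0)"
      by (simp add: zipmap marg_def)
  qed
  finally have marg: "marg {1..k} D T ?\<mu> x = X / y"
    by (simp add: X_def)
  have bD: "map x ?sel \<in> tuples D t" 
    using length_sel[OF T(1)] T PiE_mem[OF x] set_sel[OF T(1)] by (auto simp: tuples_def)
  have Mb: "0 \<le> M (zip l (map x ?sel))" "M (zip l (map x ?sel)) \<le> 1" if "l \<in> tuples {..<n} t" for l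
    using set_zip_tuples[OF that bD] length_zip_tuples[OF that bD] M(2) t
    by (auto intro!: moment_nonneg moment_le_1)
  have E01: "0 \<le> E" "E \<le> 1"
  proof -
    show "0 \<le> E" unfolding E_def using Mb map_take_sel(3)[OF T] by (intro divide_nonneg_nonneg sum_nonneg) auto
    have "(\<Sum>\<pi>\<in>Inj. M (zip (map \<pi> ?sel) (map x ?sel))) \<le> real (card Inj) * 1"
      using Mb map_take_sel(3)[OF T] by (intro sum_bounded_above) auto
    then show "E \<le> 1" unfolding E_def using card_Inj by (simp add: divide_le_eq)
  qed
  have Xclose: "\<bar>X - pmf \<rho> R * E\<bar> \<le> 128 * \<tau>"
    unfolding X_def E_def using t M(2) by (intro empirical_marginal_close[OF M(1) _ R T x]) auto
  have \<tau>0: "0 \<le> \<tau>" using y by linarith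
  have 1: "\<bar>X / y - E\<bar> \<le> 258 * \<tau> / \<theta>"
  proof -
    have "\<bar>X - y * E\<bar> \<le> \<bar>X - pmf \<rho> R * E\<bar> + \<bar>(pmf \<rho> R - y) * E\<bar>"
      by (simp add: algebra_simps)
    also have "\<bar>(pmf \<rho> R - y) * E\<bar> \<le> \<tau> * 1"
      unfolding abs_mult using y E01 by (intro mult_mono) auto
    finally have "\<bar>X - y * E\<bar> \<le> 129 * \<tau>" using Xclose by simp
    moreover have ypos: "0 < y" using y2 \<theta> by simp
    moreover have "X / y - E = (X - y * E) / y" using ypos by (simp add: field_simps)
    ultimately have "\<bar>X / y - E\<bar> \<le> 129 * \<tau> / y" by (simp add: divide_right_mono)
    also have "\<dots> \<le> 129 * \<tau> / (\<theta> / 2)" using y2 \<theta> \<tau>0 ypos by (intro divide_left_mono) auto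
    finally show ?thesis by simp
  qed
  have avg: "avg (map x ?sel) = (\<Sum>l\<in>tuples {..<n} t. M (zip l (map x ?sel))) / real n ^ t"
    using length_sel[OF T(1)] T by (simp add: avg_def)
  have 2: "\<bar>E - avg (map x ?sel)\<bar> \<le> real k ^ 2 / real n"
    using average_inj_tuples_close[of "{..<n}" n k ?sel "\<lambda>l. M (zip l (map x ?sel))"] Mb n n0 distinct_sel[of k T] set_sel[OF T(1)] T length_sel[OF T(1)]
    unfolding E_def avg by simp
  have "\<bar>avg (map x ?sel) - (\<Prod>\<beta>\<leftarrow>map x ?sel. avg [\<beta>])\<bar> \<le> real (length (map x ?sel)) * sqrt (global_corr {..<n} D t M)"
    using n0 M(2) t bD by (intro avg_close_to_product) (auto simp: tuples_def)
  also have "(\<Prod>\<beta>\<leftarrow>map x ?sel. avg [\<beta>]) = (\<Prod>i\<in>T. avg [x i])"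
    using prod.distinct_set_conv_list[OF distinct_sel[of k T], of "\<lambda>i. avg [x i]"] set_sel[OF T(1)] by (simp add: comp_def)
  also have "real (length (map x ?sel)) * sqrt (global_corr {..<n} D t M) \<le> real k * sqrt (global_corr {..<n} D t M)"
    using length_sel[OF T(1)] T t
    by (intro mult_right_mono) (auto simp: global_corr_def intro!: sum_nonneg divide_nonneg_nonneg)
  finally have 3: "\<bar>avg (map x ?sel) - (\<Prod>i\<in>T. avg [x i])\<bar> \<le> real k * sqrt (global_corr {..<n} D t M)" .
  show ?thesis unfolding marg using 1 2 3 by linarith
qed

end

lemma opt_ge:
  fixes \<rho> :: "(nat \<Rightarrow> 'a) set pmf"
  assumes "finite (set_pmf \<rho>)" "set_pmf \<nu> \<subseteq> D" "\<And>R. R \<in> \<R> \<Longrightarrow> twise_indep t k D \<nu> (\<mu> R)"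
  shows "(\<Sum>R\<in>set_pmf \<rho>. pmf \<rho> R * measure_pmf.prob (\<mu> R) R) \<le> opt t k D \<R> \<rho>"
proof -
  have "(\<Sum>R\<in>set_pmf \<rho>. pmf \<rho> R * measure_pmf.prob (\<mu> R) R) =
      measure_pmf.expectation \<rho> (\<lambda>R. measure_pmf.prob (\<mu> R) R)"
    using assms(1) by (subst integral_measure_pmf_real[of "set_pmf \<rho>"]) (auto simp: mult.commute)
  also have "\<dots> \<le> opt t k D \<R> \<rho>"
    unfolding opt_def
  proof (rule cSup_upper)
    show "bdd_above {measure_pmf.expectation \<rho> (\<lambda>R. measure_pmf.prob (\<mu> R) R) | \<nu> \<mu>.
            set_pmf \<nu> \<subseteq> D \<and> (\<forall>R\<in>\<R>. twise_indep t k D \<nu> (\<mu> R))}"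
    proof (rule bdd_aboveI)
      fix v assume "v \<in> {measure_pmf.expectation \<rho> (\<lambda>R. measure_pmf.prob (\<mu> R) R) | \<nu> \<mu>.
            set_pmf \<nu> \<subseteq> D \<and> (\<forall>R\<in>\<R>. twise_indep t k D \<nu> (\<mu> R))}"
      then obtain \<mu>' where v: "v = measure_pmf.expectation \<rho> (\<lambda>R. measure_pmf.prob (\<mu>' R) R)" by blast
      have "v \<le> measure_pmf.expectation \<rho> (\<lambda>_. 1)"
        unfolding v using assms(1) by (intro integral_mono integrable_measure_pmf_finite) auto
      then show "v \<le> 1" by simp
    qed
  qed (use assms in blast)
  finally show ?thesis .
qed

context good_instance
begin

text \<open>Relations of probability at least \<theta> are rounded by repairing their averaged local
  distribution; any other one contributes at most its frequency, which is below
  \<open>\<tau> + \<theta>\<close>.\<close>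

lemma rounding_value:
  assumes M: "pseudo_moments {..<n} D L M" "k \<le> L"
    and \<R>: "set_pmf \<rho> \<subseteq> \<R>"
    and repair: "repairable t k D \<eta> \<epsilon>"
    and \<epsilon>: "0 \<le> \<epsilon>" and \<eta>: "0 \<le> \<eta>" and \<theta>: "0 < \<theta>" "\<tau> \<le> \<theta> / 2"
    and small: "258 * \<tau> / \<theta> + (real k ^ 2 / real n + real k * sqrt (global_corr {..<n} D t M)) \<le> \<eta>"
  shows "(\<Sum>i<m. \<Sum>b\<in>Rel i. M (map (\<lambda>j. (\<sigma> i j, b j)) (idx k))) / real m
    \<le> opt t k D \<R> \<rho> + \<epsilon> + real (card (set_pmf \<rho>)) * (\<tau> + \<theta>)"
proof -
  interpret pseudo_moments "{..<n}" D L M by (rule M)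
  let ?Z = "{1..k} \<rightarrow>\<^sub>E D"
  let ?X = "\<lambda>i z. M (map (\<lambda>j. (\<sigma> i j, z j)) (idx k))"
  have finZ: "finite ?Z" by (rule finite_cube[OF finite_atLeastAtMost D(1)])
  have n0: "0 < n" using t n by simp
  have L1: "1 \<le> L" using M(2) t by simp
  define \<nu> where "\<nu> a = avg [a]" for a
  have \<nu>: "\<And>a. a \<in> D \<Longrightarrow> 0 \<le> \<nu> a" "sum \<nu> D = 1"
    unfolding \<nu>_def using n0 L1 avg_single_bounds by auto
  from repair[unfolded repairable_def, rule_format, of \<nu>, OF \<nu>] obtain \<nu>' where \<nu>': "set_pmf \<nu>' \<subseteq> D"
    and rep: "\<And>\<mu>. (\<forall>x\<in>?Z. 0 \<le> \<mu> x) \<Longrightarrow> sum \<mu> ?Z = 1 \<Longrightarrow>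
        (\<forall>T x. T \<subseteq> {1..k} \<longrightarrow> card T = t \<longrightarrow> x \<in> ?Z \<longrightarrow> \<bar>marg {1..k} D T \<mu> x - (\<Prod>i\<in>T. \<nu> (x i))\<bar> \<le> \<eta>) \<Longrightarrow>
        (\<exists>\<mu>'. twise_indep t k D \<nu>' \<mu>' \<and> (\<forall>R. R \<subseteq> ?Z \<longrightarrow> (\<Sum>x\<in>R. \<mu> x) - \<epsilon> \<le> measure_pmf.prob \<mu>' R))"
    by blast
  obtain a0 where a0: "a0 \<in> D" using D by blast
  define x0 where "x0 = (\<lambda>i\<in>{1..k}. a0)"
  have x0: "x0 \<in> ?Z" using a0 by (simp add: x0_def)
  note X0 = local_distribution(1)[OF M] and X1 = local_distribution(2)[OF M] and XR = local_distribution(3)[OF M]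
  define \<mu> where "\<mu> R z = (\<Sum>i<m. if Rel i = R then ?X i z else 0) / real m / freq R" for R z
  have ex: "\<exists>\<mu>'. twise_indep t k D \<nu>' \<mu>' \<and>
      (R \<in> set_pmf \<rho> \<and> \<theta> \<le> pmf \<rho> R \<longrightarrow> (\<Sum>x\<in>R. \<mu> R x) - \<epsilon> \<le> measure_pmf.prob \<mu>' R)" for R
  proof (cases "R \<in> set_pmf \<rho> \<and> \<theta> \<le> pmf \<rho> R")
    case True
    have fr: "0 < freq R" using freq_close[of R] True \<theta> by (simp add: abs_le_iff)
    have "\<exists>\<mu>'. twise_indep t k D \<nu>' \<mu>' \<and> (\<forall>R'. R' \<subseteq> ?Z \<longrightarrow> (\<Sum>x\<in>R'. \<mu> R x) - \<epsilon> \<le> measure_pmf.prob \<mu>' R')"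
    proof (rule rep)
      show "\<forall>x\<in>?Z. 0 \<le> \<mu> R x"
        unfolding \<mu>_def using fr X0 by (intro ballI divide_nonneg_nonneg sum_nonneg) auto
      have "sum (\<mu> R) ?Z = (\<Sum>z\<in>?Z. \<Sum>i<m. if Rel i = R then ?X i z else 0) / real m / freq R"
        unfolding \<mu>_def by (simp flip: sum_divide_distrib)
      also have "(\<Sum>z\<in>?Z. \<Sum>i<m. if Rel i = R then ?X i z else 0) = (\<Sum>i<m. if Rel i = R then \<Sum>z\<in>?Z. ?X i z else 0)"
        by (subst sum.swap) (intro sum.cong refl, simp)
      also have "\<dots> = (\<Sum>i<m. if Rel i = R then 1 else 0)" by (intro sum.cong refl if_cong X1) simp
      also have "\<dots> / real m / freq R = 1" using fr unfolding freq_def[symmetric] by simp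
      finally show "sum (\<mu> R) ?Z = 1" .
      show "\<forall>T x. T \<subseteq> {1..k} \<longrightarrow> card T = t \<longrightarrow> x \<in> ?Z \<longrightarrow> \<bar>marg {1..k} D T (\<mu> R) x - (\<Prod>i\<in>T. \<nu> (x i))\<bar> \<le> \<eta>"
      proof (intro allI impI)
        fix T x assume "T \<subseteq> {1..k}" "card T = t" "x \<in> ?Z"
        from marginal_close_to_product[OF M _ this \<theta>(1) _ \<theta>(2), of R] True small
        show "\<bar>marg {1..k} D T (\<mu> R) x - (\<Prod>i\<in>T. \<nu> (x i))\<bar> \<le> \<eta>"
          unfolding \<nu>_def \<mu>_def[abs_def] by linarith
      qed
    qed
    with rel True show ?thesis by blast
  next
    case False
    \<comment> \<open>Relations that are rare or outside the support also need a
      \<open>t\<close>-wise independent distribution for the same \<nu>'; repairing the exact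
      product supplies one.\<close>
    have "\<exists>\<mu>'. twise_indep t k D \<nu>' \<mu>' \<and> (\<forall>R'. R' \<subseteq> ?Z \<longrightarrow> (\<Sum>x\<in>R'. \<Prod>i\<in>{1..k}. \<nu> (x i)) - \<epsilon> \<le> measure_pmf.prob \<mu>' R')"
    proof (rule rep)
      show "\<forall>x\<in>?Z. 0 \<le> (\<Prod>i\<in>{1..k}. \<nu> (x i))"
        using \<nu>(1) by (intro ballI prod_nonneg) (auto dest: PiE_mem)
      show "(\<Sum>x\<in>?Z. \<Prod>i\<in>{1..k}. \<nu> (x i)) = 1"
        using marg_prod[OF finite_atLeastAtMost D(1) empty_subsetI \<nu>(2) x0] by (simp add: marg_def)
      show "\<forall>T x. T \<subseteq> {1..k} \<longrightarrow> card T = t \<longrightarrow> x \<in> ?Z \<longrightarrow>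
          \<bar>marg {1..k} D T (\<lambda>x. \<Prod>i\<in>{1..k}. \<nu> (x i)) x - (\<Prod>i\<in>T. \<nu> (x i))\<bar> \<le> \<eta>"
      proof (intro allI impI)
        fix T x assume T: "T \<subseteq> {1..k}" and x: "x \<in> ?Z"
        show "\<bar>marg {1..k} D T (\<lambda>x. \<Prod>i\<in>{1..k}. \<nu> (x i)) x - (\<Prod>i\<in>T. \<nu> (x i))\<bar> \<le> \<eta>"
          unfolding marg_prod[OF finite_atLeastAtMost D(1) T \<nu>(2) x] using \<eta> by simp
      qed
    qed
    with False show ?thesis by blast
  qed
  then have "\<exists>f. \<forall>R. twise_indep t k D \<nu>' (f R) \<and>
      (R \<in> set_pmf \<rho> \<and> \<theta> \<le> pmf \<rho> R \<longrightarrow> (\<Sum>x\<in>R. \<mu> R x) - \<epsilon> \<le> measure_pmf.prob (f R) R)"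
    by (intro choice allI)
  then obtain \<mu>' where \<mu>'_all: "\<forall>R. twise_indep t k D \<nu>' (\<mu>' R) \<and>
      (R \<in> set_pmf \<rho> \<and> \<theta> \<le> pmf \<rho> R \<longrightarrow> (\<Sum>x\<in>R. \<mu> R x) - \<epsilon> \<le> measure_pmf.prob (\<mu>' R) R)" ..
  have \<mu>': "twise_indep t k D \<nu>' (\<mu>' R)"
    "R \<in> set_pmf \<rho> \<Longrightarrow> \<theta> \<le> pmf \<rho> R \<Longrightarrow> (\<Sum>x\<in>R. \<mu> R x) - \<epsilon> \<le> measure_pmf.prob (\<mu>' R) R" for R
    using spec[OF \<mu>'_all, of R] by simp_all
  define W where "W R = (\<Sum>i<m. if Rel i = R then \<Sum>b\<in>R. ?X i b else 0) / real m" for R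
  have W_le: "W R \<le> freq R" if R: "R \<in> set_pmf \<rho>" for R
  proof -
    have "(\<Sum>i<m. if Rel i = R then \<Sum>b\<in>R. ?X i b else 0) \<le> (\<Sum>i<m. if Rel i = R then 1 else 0)"
      using XR rel[OF R] by (intro sum_mono) auto
    then show ?thesis unfolding W_def freq_def by (intro divide_right_mono) auto
  qed
  have W: "W R \<le> pmf \<rho> R * measure_pmf.prob (\<mu>' R) R + pmf \<rho> R * \<epsilon> + (\<tau> + \<theta>)" if R: "R \<in> set_pmf \<rho>" for R
  proof (cases "\<theta> \<le> pmf \<rho> R")
    case True
    define v where "v = (\<Sum>x\<in>R. \<mu> R x)"
    have fr: "0 < freq R" using freq_close[OF R] True \<theta> by (simp add: abs_le_iff)
    have "v = (\<Sum>x\<in>R. \<Sum>i<m. if Rel i = R then ?X i x else 0) / real m / freq R"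
      unfolding v_def \<mu>_def by (simp flip: sum_divide_distrib)
    also have "(\<Sum>x\<in>R. \<Sum>i<m. if Rel i = R then ?X i x else 0) = (\<Sum>i<m. if Rel i = R then \<Sum>x\<in>R. ?X i x else 0)"
      by (subst sum.swap) (intro sum.cong refl, simp)
    finally have Wv: "W R = freq R * v" using fr by (simp add: W_def)
    have v1: "v \<le> 1" using W_le[OF R] fr by (simp add: Wv)
    have "0 \<le> v" unfolding v_def \<mu>_def using fr X0 rel[OF R]
      by (intro sum_nonneg divide_nonneg_nonneg) auto
    have "W R \<le> (pmf \<rho> R + \<tau>) * v"
      unfolding Wv using freq_close[OF R] \<open>0 \<le> v\<close> by (intro mult_right_mono) (auto simp: abs_le_iff)
    also have "\<dots> \<le> pmf \<rho> R * (measure_pmf.prob (\<mu>' R) R + \<epsilon>) + \<tau>"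
    proof -
      have "pmf \<rho> R * v \<le> pmf \<rho> R * (measure_pmf.prob (\<mu>' R) R + \<epsilon>)"
        using \<mu>'(2)[OF R True] by (intro mult_left_mono) (auto simp: v_def)
      moreover have "0 \<le> \<tau>" using freq_close[OF R] by linarith
      then have "\<tau> * v \<le> \<tau> * 1" using v1 by (intro mult_left_mono)
      ultimately show ?thesis by (simp add: algebra_simps)
    qed
    finally show ?thesis using \<theta> by (simp add: algebra_simps)
  next
    case False
    have "W R \<le> freq R" by (rule W_le[OF R])
    also have "\<dots> \<le> \<tau> + \<theta>" using freq_close[OF R] False by (simp add: abs_le_iff)
    also have "\<dots> \<le> pmf \<rho> R * measure_pmf.prob (\<mu>' R) R + pmf \<rho> R * \<epsilon> + (\<tau> + \<theta>)" using \<epsilon> by simp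
    finally show ?thesis .
  qed
  have "(\<Sum>i<m. \<Sum>b\<in>Rel i. ?X i b) = (\<Sum>i<m. \<Sum>R\<in>set_pmf \<rho>. if Rel i = R then \<Sum>b\<in>R. ?X i b else 0)"
    using Rel finite_rels by (intro sum.cong refl) simp
  also have "\<dots> / real m = (\<Sum>R\<in>set_pmf \<rho>. W R)"
    unfolding W_def by (subst sum.swap) (simp add: sum_divide_distrib)
  also have "\<dots> \<le> (\<Sum>R\<in>set_pmf \<rho>. pmf \<rho> R * measure_pmf.prob (\<mu>' R) R + pmf \<rho> R * \<epsilon> + (\<tau> + \<theta>))"
    by (intro sum_mono W)
  also have "\<dots> = (\<Sum>R\<in>set_pmf \<rho>. pmf \<rho> R * measure_pmf.prob (\<mu>' R) R) + \<epsilon> + real (card (set_pmf \<rho>)) * (\<tau> + \<theta>)"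
    using sum_pmf_eq_1[OF finite_rels order_refl] by (simp add: sum.distrib flip: sum_distrib_right)
  also have "\<dots> \<le> opt t k D \<R> \<rho> + \<epsilon> + real (card (set_pmf \<rho>)) * (\<tau> + \<theta>)"
    using opt_ge[OF finite_rels \<nu>', of \<R> t k \<mu>'] \<mu>'(1) by simp
  finally show ?thesis .
qed

end

section \<open>Pinning and rounding combined\<close>

context good_instance
begin

text \<open>Pinning with error \<open>\<zeta>\<^sup>2\<close> and penalty \<open>m / \<zeta>\<close>
  costs \<zeta> of the value. As values lie between 0 and 1, the penalty forces the correlation down
  to \<open>\<zeta> * (1 + \<zeta>)\<close>, at most \<open>2 * \<zeta>\<close>. Of the length
  \<open>r + 1 + 2 * k\<close> at most \<open>r\<close> is spent on pinning; squaring doubles the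
  length to the degree.\<close>

lemma refutation:
  assumes E: "pseudo_distribution (2 * (r + 1 + 2 * k)) {..<n} D E"
    and \<R>: "set_pmf \<rho> \<subseteq> \<R>"
    and repair: "repairable t k D \<eta> \<epsilon>"
    and \<epsilon>: "0 \<le> \<epsilon>" and \<eta>: "0 \<le> \<eta>" and \<theta>: "0 < \<theta>" "\<tau> \<le> \<theta> / 2"
    and \<zeta>: "0 < \<zeta>" "\<zeta> \<le> 1" "real k \<le> real r * \<zeta>\<^sup>2"
    and small: "258 * \<tau> / \<theta> + (real k ^ 2 / real n + real k * sqrt (2 * \<zeta>)) \<le> \<eta>"
  shows "E (Val k ({..<n}, mset (map (\<lambda>i. (\<sigma> i, Rel i)) [0..<m])))
    \<le> opt t k D \<R> \<rho> + \<epsilon> + real (card (set_pmf \<rho>)) * (\<tau> + \<theta>) + \<zeta>"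
proof -
  let ?Z = "{1..k} \<rightarrow>\<^sub>E D"
  let ?V = "{..<n}"
  let ?L = "r + 1 + 2 * k"
  have n0: "0 < n" using t n by simp
  interpret pseudo_dist "2 * ?L" ?V D E using D E by unfold_locales auto
  define M where "M ps = E ((Vars ps)\<^sup>2)" for ps
  interpret M: pseudo_moments ?V D ?L M
    unfolding M_def[abs_def] by (rule pseudo_moments) simp
  let ?q = "\<lambda>i b. map (\<lambda>j. (\<sigma> i j, b j)) (idx k)"
  define X where "X = Sigma {..<m} Rel"
  have finX: "finite (Rel i)" if "i < m" for i
    using rel[OF Rel[OF that]] finite_cube[OF finite_atLeastAtMost D(1)] finite_subset by blast
  have sumX: "(\<Sum>x\<in>X. f (case x of (i, b) \<Rightarrow> ?q i b)) = (\<Sum>i<m. \<Sum>b\<in>Rel i. f (?q i b))" for f :: "(nat \<times> 'a) list \<Rightarrow> real"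
    unfolding X_def using finX by (subst sum.Sigma) (auto simp: split_def intro!: sum.cong)
  have qV: "set (?q i b) \<subseteq> ?V \<times> D \<and> length (?q i b) = k" if "i < m" "b \<in> ?Z" for i b
    using Inj_mem[OF \<sigma>[OF that(1)]] PiE_mem[OF that(2)] by auto
  have qX: "set (case x of (i, b) \<Rightarrow> ?q i b) \<subseteq> ?V \<times> D \<and> length (case x of (i, b) \<Rightarrow> ?q i b) = k" if "x \<in> X" for x
  proof -
    obtain i b where x: "x = (i, b)" "i < m" "b \<in> Rel i" using \<open>x \<in> X\<close> by (auto simp: X_def)
    then have "b \<in> ?Z" using rel[OF Rel] by blast
    from qV[OF x(2) this] x show ?thesis by simp
  qed
  define val where "val f = (\<Sum>i<m. \<Sum>b\<in>Rel i. f (?q i b)) / real m" for f :: "(nat \<times> 'a) list \<Rightarrow> real"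
  have le1: "val f \<le> 1" if f: "pseudo_moments ?V D L f" "k \<le> L" for f L
  proof -
    have "(\<Sum>b\<in>Rel i. f (?q i b)) \<le> 1" if i: "i < m" for i
      using local_distribution(3)[OF f i rel[OF Rel[OF i]]] .
    then have "(\<Sum>i<m. \<Sum>b\<in>Rel i. f (?q i b)) \<le> real (card {..<m}) * 1"
      by (intro sum_bounded_above) auto
    then show ?thesis using m by (simp add: val_def divide_le_eq)
  qed
  have val0: "0 \<le> val M"
    unfolding val_def
  proof (intro divide_nonneg_nonneg sum_nonneg)
    fix i b assume i: "i \<in> {..<m}" and "b \<in> Rel i"
    then have "b \<in> ?Z" using rel[OF Rel, of i] by blast
    with i show "0 \<le> M (?q i b)" by (intro local_distribution(1)[OF M.pseudo_moments_axioms]) auto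
  qed simp
  have EV: "E (Val k (?V, mset (map (\<lambda>i. (\<sigma> i, Rel i)) [0..<m]))) \<le> val M"
  proof -
    have cs: "s \<in> {1..k} \<rightarrow> ?V \<and> R \<subseteq> ?Z" if "(s, R) \<in> set (map (\<lambda>i. (\<sigma> i, Rel i)) [0..<m])" for s R
    proof -
      from that obtain i where i: "i < m" "s = \<sigma> i" "R = Rel i" by auto
      then show ?thesis using Inj_mem[OF \<sigma>[OF i(1)]] rel[OF Rel[OF i(1)]] by auto
    qed
    have "E (Val k (?V, mset (map (\<lambda>i. (\<sigma> i, Rel i)) [0..<m]))) \<le>
      (\<Sum>(s, R)\<leftarrow>map (\<lambda>i. (\<sigma> i, Rel i)) [0..<m]. \<Sum>b\<in>R. E ((Vars (map (\<lambda>i. (s i, b i)) [1..<Suc k]))\<^sup>2)) /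
        real (length (map (\<lambda>i. (\<sigma> i, Rel i)) [0..<m]))"
      by (rule E_Val_le[OF cs]) auto
    also have "\<dots> = val M"
      unfolding idx_def[symmetric] val_def M_def
      by (simp add: comp_def interv_sum_list_conv_sum_set_nat atLeast0LessThan)
    finally show ?thesis .
  qed
  have a1: "finite ?V" and a2: "?V \<noteq> {}" and a3: "0 < \<zeta>\<^sup>2" and a4: "real t \<le> real r * \<zeta>\<^sup>2"
    and a5: "r + 1 + t \<le> ?L" and a7: "0 \<le> real m / \<zeta>"
    using n0 \<zeta> t by auto
  have a6: "set (case x of (i, b) \<Rightarrow> ?q i b) \<subseteq> ?V \<times> D \<and> r + length (case x of (i, b) \<Rightarrow> ?q i b) \<le> ?L" if "x \<in> X" for x
    using qX[OF that] by simp
  obtain \<alpha> where \<alpha>: "set \<alpha> \<subseteq> ?V \<times> D" "length \<alpha> \<le> r" "0 < M \<alpha>"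
    and pin: "(\<Sum>x\<in>X. M (case x of (i, b) \<Rightarrow> ?q i b)) - real m / \<zeta> * \<zeta>\<^sup>2 \<le>
       (\<Sum>x\<in>X. cond M \<alpha> (case x of (i, b) \<Rightarrow> ?q i b)) - real m / \<zeta> * global_corr ?V D t (cond M \<alpha>)"
    by (rule M.pinning[OF a1 a2 a3 a4 a5 a6 a7])
  have condM: "pseudo_moments ?V D (?L - length \<alpha>) (cond M \<alpha>)"
    using \<alpha> by (intro M.cond_pseudo_moments) auto
  define g where "g = global_corr ?V D t (cond M \<alpha>)"
  have g0: "0 \<le> g" unfolding g_def global_corr_def by (intro sum_nonneg divide_nonneg_nonneg) auto
  have "real m * (val M - \<zeta>) \<le> real m * (val (cond M \<alpha>) - g / \<zeta>)"
    using pin m \<zeta>(1) unfolding sumX g_def[symmetric]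
    by (simp add: val_def algebra_simps power2_eq_square)
  then have pin': "val M - \<zeta> \<le> val (cond M \<alpha>) - g / \<zeta>" using m by simp
  have kL: "k \<le> ?L - length \<alpha>" using \<alpha>(2) by simp
  have "g / \<zeta> \<le> 1 + \<zeta>" using pin' val0 le1[OF condM kL] by simp
  then have "g \<le> (1 + \<zeta>) * \<zeta>" using \<zeta>(1) by (simp add: divide_le_eq)
  also have "\<dots> \<le> 2 * \<zeta>" using \<zeta> by (intro mult_right_mono) auto
  finally have "sqrt g \<le> sqrt (2 * \<zeta>)" by simp
  then have "real k * sqrt g \<le> real k * sqrt (2 * \<zeta>)" by (intro mult_left_mono) auto
  then have "val (cond M \<alpha>) \<le> opt t k D \<R> \<rho> + \<epsilon> + real (card (set_pmf \<rho>)) * (\<tau> + \<theta>)"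
    unfolding val_def using small
    by (intro rounding_value[OF condM kL \<R> repair \<epsilon> \<eta> \<theta>]) (auto simp: g_def)
  moreover have "0 \<le> g / \<zeta>" using g0 \<zeta>(1) by simp
  ultimately show ?thesis using EV pin' by linarith
qed

end

section \<open>The random instance is good\<close>

text \<open>Over an empty domain the normalisation axiom is the polynomial -1, so \<open>E 1\<close>
  would be 0.\<close>

lemma no_pseudo_distribution_empty:
  assumes "pseudo_distribution K V {} E" "2 \<le> K" "v \<in> V"
  shows False
proof -
  interpret pseudo_dist K V "{}" E using assms by unfold_locales auto
  show False using E_sum_sq[OF assms(3), of 1 0] assms(2) by (simp add: E_one)
qed

text \<open>Union bound over the tests in \<open>J\<close>: for \<open>N = n ^ (t div 2)\<close>
  there are at most \<open>2 ^ (card D ^ k) * 2 ^ k * 4 ^ N\<close> of them. The constant 6 makes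
  each fail with probability at most \<open>exp (- 3 * N)\<close>, which beats
  \<open>4 ^ N \<le> exp (2 * N)\<close>.\<close>

lemma prob_bad_instance_le:
  fixes \<rho> :: "(nat \<Rightarrow> 'a) set pmf"
  assumes D: "finite D" "D \<noteq> {}" and t: "even t" "2 \<le> t" "t \<le> k" and n: "k \<le> n"
    and rel: "\<And>R. R \<in> set_pmf \<rho> \<Longrightarrow> R \<subseteq> ({1..k} \<rightarrow>\<^sub>E D)"
    and \<tau>: "0 < \<tau>" and m: "6 / \<tau>\<^sup>2 * real n ^ (t div 2) \<le> real m"
    and ok: "\<And>\<sigma> Rel. good_instance k t n m D \<rho> \<sigma> Rel \<tau> \<Longrightarrow>
      ({..<n}, mset (map (\<lambda>i. (\<sigma> i, Rel i)) [0..<m])) \<notin> Bad"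
  shows "measure_pmf.prob (random_instance k \<rho> n m) Bad \<le> 2 ^ (card D ^ k) * 2 ^ k * exp (- real n)"
proof -
  let ?s = "t div 2" and ?V = "{..<n}"
  let ?X = "tuples ?V ?s" and ?rc = "random_constraint k \<rho> ?V" and ?Inj = "inj_tuples {1..k} ?V"
  define N where "N = n ^ ?s"
  have n2: "2 \<le> n" using t n by simp
  have s1: "1 \<le> ?s" using t by simp
  have cX: "card ?X = N" by (simp add: card_tuples N_def)
  have nN: "n \<le> N" unfolding N_def using s1 n2 power_increasing[of 1 ?s n] by simp
  have "0 < 6 / \<tau>\<^sup>2 * real n ^ ?s" using \<tau> n2 by simp
  then have m0: "0 < m" using m by (metis gr0I of_nat_0 not_le)
  have fin\<rho>: "finite (set_pmf \<rho>)" and card\<rho>: "card (set_pmf \<rho>) \<le> 2 ^ (card D ^ k)"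
    by (rule finite_card_relations[OF D(1)], erule rel)+
  define f where "f = (\<lambda>(R :: (nat \<Rightarrow> 'a) set, T, S, S') (\<sigma>, R'). if R' = R then sign_test k ?s T S S' \<sigma> else 0)"
  define J where "J = set_pmf \<rho> \<times> Pow {1..k} \<times> Pow ?X \<times> Pow ?X"
  define B where "B j = {cs. sum_list (map (f j) cs) \<ge> real m * (measure_pmf.expectation ?rc (f j) + \<tau>) \<and> length cs = m}" for j
  have finJ: "finite J" unfolding J_def using fin\<rho> by auto
  have abs_st: "\<bar>sign_test k ?s T S S' \<sigma>\<bar> \<le> 1" for T S S' \<sigma> by (simp add: sign_test_def abs_mult)
  have f1: "\<bar>f j c\<bar> \<le> 1" for j c
    using abs_st by (auto simp: f_def split: prod.splits)
  \<comment> \<open>Intersecting with the support provides lists of length \<open>m\<close> whose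
    entries are injective tuples with relations of \<rho>, as \<open>good_instance\<close>
    requires.\<close>
  have sub_bad: "((\<lambda>cs. (?V, mset cs)) -` Bad) \<inter> set_pmf (replicate_pmf m ?rc) \<subseteq> (\<Union>j\<in>J. B j)"
  proof (rule subsetI, rule ccontr)
    fix cs assume cs: "cs \<in> ((\<lambda>cs. (?V, mset cs)) -` Bad) \<inter> set_pmf (replicate_pmf m ?rc)" and notB: "cs \<notin> (\<Union>j\<in>J. B j)"
    define \<sigma> where "\<sigma> i = fst (cs ! i)" for i
    define Rel where "Rel i = snd (cs ! i)" for i
    have len: "length cs = m" and mem: "set cs \<subseteq> set_pmf ?rc" using cs by (auto simp: set_replicate_pmf)
    have Injne: "?Inj \<noteq> {}" "finite ?Inj"
      using n finite_inj_tuples[of "{1..k}" ?V] card_inj_tuples_pos[of "{1..k}" ?V] by (auto simp: card_gt_0_iff)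
    have cs_nth: "\<sigma> i \<in> ?Inj" "Rel i \<in> set_pmf \<rho>" if "i < m" for i
    proof -
      have "cs ! i \<in> set_pmf ?rc" using mem len that by auto
      then show "\<sigma> i \<in> ?Inj" "Rel i \<in> set_pmf \<rho>"
        using n Injne by (auto simp: random_constraint_eq_pair \<sigma>_def Rel_def)
    qed
    have cs_eq: "cs = map (\<lambda>i. (\<sigma> i, Rel i)) [0..<m]"
      using len by (intro nth_equalityI) (auto simp: \<sigma>_def Rel_def)
    have "good_instance k t n m D \<rho> \<sigma> Rel \<tau>"
    proof
      fix R T S S'
      assume R: "R \<in> set_pmf \<rho>" and T: "T \<subseteq> {1..k}" "card T = t" and S: "S \<subseteq> ?X" "S' \<subseteq> ?X"
      then have "(R, T, S, S') \<in> J" by (auto simp: J_def)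
      with notB have "cs \<notin> B (R, T, S, S')" by blast
      then have less: "sum_list (map (f (R, T, S, S')) cs) < real m * (measure_pmf.expectation ?rc (f (R, T, S, S')) + \<tau>)"
        using len by (simp add: B_def)
      have "sum_list (map (f (R, T, S, S')) cs) = (\<Sum>i<m. if Rel i = R then sign_test k ?s T S S' (\<sigma> i) else 0)"
        unfolding cs_eq by (simp add: f_def comp_def interv_sum_list_conv_sum_set_nat atLeast0LessThan)
      moreover have "measure_pmf.expectation ?rc (f (R, T, S, S')) =
         pmf \<rho> R * ((\<Sum>\<pi>\<in>?Inj. sign_test k ?s T S S' \<pi>) / real (card ?Inj))"
        using expectation_random_constraint[of ?V k "sign_test k ?s T S S'" \<rho> R] abs_st n by (simp add: f_def)
      ultimately show "(\<Sum>i<m. if Rel i = R then sign_test k ?s T S S' (\<sigma> i) else 0) / real m -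
         pmf \<rho> R * ((\<Sum>\<pi>\<in>?Inj. sign_test k ?s T S S' \<pi>) / real (card ?Inj)) \<le> \<tau>"
        using less m0 by (simp add: field_simps)
    qed (use D t n m0 rel cs_nth in auto)
    from ok[OF this] cs cs_eq show False by auto
  qed
  have "measure_pmf.prob (random_instance k \<rho> n m) Bad =
     measure_pmf.prob (replicate_pmf m ?rc) (((\<lambda>cs. (?V, mset cs)) -` Bad) \<inter> set_pmf (replicate_pmf m ?rc))"
    unfolding random_instance_def by (simp add: measure_Int_set_pmf)
  also have "\<dots> \<le> measure_pmf.prob (replicate_pmf m ?rc) (\<Union>j\<in>J. B j)"
    using sub_bad by (intro measure_pmf.finite_measure_mono) auto
  also have "\<dots> \<le> (\<Sum>j\<in>J. measure_pmf.prob (replicate_pmf m ?rc) (B j))"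
    using finJ by (intro measure_pmf.finite_measure_subadditive_finite) auto
  also have "\<dots> \<le> (\<Sum>j\<in>J. exp (- (real m * \<tau>\<^sup>2 / 2)))"
    unfolding B_def by (intro sum_mono hoeffding_replicate_pmf f1 \<tau>)
  also have "\<dots> = real (card J) * exp (- (real m * \<tau>\<^sup>2 / 2))" by simp
  also have "\<dots> \<le> (2 ^ (card D ^ k) * 2 ^ k * exp (2 * real N)) * exp (- (3 * real N))"
  proof (intro mult_mono)
    have "card J = card (set_pmf \<rho>) * (2 ^ k * (2 ^ N * 2 ^ N))"
      unfolding J_def using fin\<rho> by (simp add: card_cartesian_product card_Pow cX)
    also have "real \<dots> = real (card (set_pmf \<rho>)) * (2 ^ k * (2 ^ N * 2 ^ N))" by simp
    also have "\<dots> \<le> 2 ^ (card D ^ k) * (2 ^ k * (exp (real N) * exp (real N)))"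
    proof (intro mult_mono)
      have "real (card (set_pmf \<rho>)) \<le> real (2 ^ (card D ^ k))" using card\<rho> by (rule of_nat_mono)
      then show "real (card (set_pmf \<rho>)) \<le> 2 ^ (card D ^ k)" by simp
      have "(2::real) ^ N \<le> exp 1 ^ N" using exp_ge_add_one_self[of 1] by (intro power_mono) auto
      then show "(2::real) ^ N \<le> exp (real N)" "(2::real) ^ N \<le> exp (real N)" by (simp_all flip: exp_of_nat_mult)
    qed auto
    also have "\<dots> = 2 ^ (card D ^ k) * 2 ^ k * exp (2 * real N)"
      by (simp flip: exp_add)
    finally show "real (card J) \<le> 2 ^ (card D ^ k) * 2 ^ k * exp (2 * real N)" .
    have "6 * real N \<le> real m * \<tau>\<^sup>2" using m \<tau> by (simp add: N_def divide_le_eq)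
    then show "exp (- (real m * \<tau>\<^sup>2 / 2)) \<le> exp (- (3 * real N))" by simp
  qed auto
  also have "\<dots> = 2 ^ (card D ^ k) * 2 ^ k * exp (- real N)"
    by (simp flip: exp_add)
  also have "\<dots> \<le> 2 ^ (card D ^ k) * 2 ^ k * exp (- real n)"
    using nN by (intro mult_left_mono) auto
  finally show ?thesis .
qed

section \<open>Choice of parameters and the limit\<close>

lemma exp_decay_smallo:
  fixes c :: real
  shows "(\<lambda>n. if n < n0 then 1 else c * exp (- real n)) \<in> o(\<lambda>_. 1 :: real)"
proof -
  have "(\<lambda>n. c * exp (- 1) ^ n) \<longlonglongrightarrow> c * 0"
    by (intro tendsto_mult tendsto_const LIMSEQ_realpow_zero) auto
  then have "(\<lambda>n. c * exp (- real n)) \<longlonglongrightarrow> 0"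
    by (simp flip: exp_of_nat_mult)
  then have "(\<lambda>n. if n < n0 then 1 else c * exp (- real n)) \<longlonglongrightarrow> 0"
    by (rule Lim_transform_eventually) (auto intro!: eventually_sequentiallyI[of n0])
  then show ?thesis by (intro smalloI_tendsto) auto
qed

text \<open>Since \<delta> precedes \<open>m\<close>, one bound serves all \<open>m\<close> above
  the threshold.\<close>

definition whp_refuted ::
    "nat \<Rightarrow> 'a set \<Rightarrow> (nat \<Rightarrow> 'a) set set \<Rightarrow> (nat \<Rightarrow> 'a) set pmf \<Rightarrow> nat \<Rightarrow> real \<Rightarrow> nat \<Rightarrow> real \<Rightarrow> bool" where
  "whp_refuted k D \<R> \<rho> t \<gamma> K C \<longleftrightarrow>
      (\<exists>\<delta> :: nat \<Rightarrow> real. \<delta> \<in> o(\<lambda>_. 1) \<and>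
        (\<forall>n m :: nat. k \<le> n \<and> real m \<ge> C * real n ^ (t div 2) \<longrightarrow>
          measure_pmf.prob (random_instance k \<rho> n m)
            {I. \<not> (\<forall>E. pseudo_distribution K (fst I) D E \<longrightarrow>
                    E (Val k I) \<le> opt t k D \<R> \<rho> + \<gamma>)} \<le> \<delta> n))"

text \<open>The degree is fixed before \<open>t\<close> is known. The loss is at most
  \<open>\<gamma> / 4\<close> each for the repair, for frequency errors and rare relations, and for
  pinning.\<close>

lemma refutation_parameters:
  assumes "1 \<le> k" "1 \<le> q" "0 < \<gamma>"
  shows "\<exists>K. \<forall>t. \<exists>C. \<forall>(D :: 'a set) \<R> \<rho>. card D = q \<longrightarrow> k_csp k D \<R> \<and> set_pmf \<rho> \<subseteq> \<R> \<and> even t \<and> 2 \<le> t \<and> t \<le> k \<longrightarrow>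
      whp_refuted k D \<R> \<rho> t \<gamma> K C"
proof -
  have \<gamma>4: "0 < \<gamma> / 4" using assms by simp
  obtain \<eta> :: real where \<eta>: "\<eta> > 0"
    and repair: "\<And>(D::'a set) t. finite D \<Longrightarrow> card D = q \<Longrightarrow> t \<le> k \<Longrightarrow> repairable t k D \<eta> (\<gamma> / 4)"
    using exists_repairable[OF assms(1,2) \<gamma>4, where 'a = 'a] by blast
  define Q :: real where "Q = 2 ^ (q ^ k)"
  \<comment> \<open>\<open>Q\<close> bounds the number of relations, and
    \<open>Q * (\<theta> + \<theta>)\<close> is \<open>\<gamma> / 4\<close>.\<close>
  define \<theta> where "\<theta> = \<gamma> / (8 * Q)"
  \<comment> \<open>\<open>1032 = 4 * 258\<close>: the sign tests receive a quarter of the budget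
    \<eta>, as does \<open>k ^ 2 / n\<close> by the choice of \<open>n0\<close>; the correlation
    receives half by that of \<zeta>.\<close>
  define \<tau> where "\<tau> = min (\<theta> / 2) (\<eta> * \<theta> / 1032)"
  define \<zeta> where "\<zeta> = min 1 (min (\<gamma> / 4) (\<eta>\<^sup>2 / (8 * (real k)\<^sup>2)))"
  \<comment> \<open>Enough pinned variables for a potential up to \<open>k\<close> and error
    \<open>\<zeta>\<^sup>2\<close>; \<open>k\<close> in place of \<open>t\<close> keeps the degree
    independent of \<open>t\<close>.\<close>
  define r where "r = nat \<lceil>real k / \<zeta>\<^sup>2\<rceil>"
  define n0 where "n0 = nat \<lceil>4 * (real k)\<^sup>2 / \<eta>\<rceil>"
  have Q: "0 < Q" by (simp add: Q_def)
  have \<theta>: "0 < \<theta>" "Q * \<theta> \<le> \<gamma> / 8" using Q assms by (auto simp: \<theta>_def)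
  have \<tau>: "0 < \<tau>" "\<tau> \<le> \<theta> / 2" "258 * \<tau> / \<theta> \<le> \<eta> / 4"
    using \<theta> \<eta> by (auto simp: \<tau>_def min_def field_simps)
  have \<zeta>: "0 < \<zeta>" "\<zeta> \<le> 1" "\<zeta> \<le> \<gamma> / 4" "\<zeta> \<le> \<eta>\<^sup>2 / (8 * (real k)\<^sup>2)"
    using assms \<eta> by (auto simp: \<zeta>_def)
  have r: "real k \<le> real r * \<zeta>\<^sup>2"
  proof -
    have "real k / \<zeta>\<^sup>2 \<le> real r" unfolding r_def by linarith
    then show ?thesis using \<zeta> by (simp add: divide_le_eq)
  qed
  have sq: "real k * sqrt (2 * \<zeta>) \<le> \<eta> / 2"
  proof -
    have "2 * \<zeta> \<le> (\<eta> / (2 * real k))\<^sup>2"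
      using \<zeta>(4) by (simp add: power_divide power_mult_distrib)
    then have "sqrt (2 * \<zeta>) \<le> \<eta> / (2 * real k)" using \<eta> by (intro real_le_lsqrt) auto
    then show ?thesis using assms by (simp add: field_simps)
  qed
  have kn: "real k ^ 2 / real n \<le> \<eta> / 4" if "n0 \<le> n" "0 < n" for n
  proof -
    have "4 * (real k)\<^sup>2 / \<eta> \<le> real n0" unfolding n0_def by linarith
    also have "\<dots> \<le> real n" using that by simp
    finally show ?thesis using \<eta> that by (simp add: field_simps)
  qed
  show ?thesis
  proof (intro exI[of _ "2 * (r + 1 + 2 * k)"] allI exI[of _ "6 / \<tau>\<^sup>2"] impI)
    fix t and D :: "'a set" and \<R> :: "(nat \<Rightarrow> 'a) set set" and \<rho> :: "(nat \<Rightarrow> 'a) set pmf"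
    assume cD: "card D = q" and A: "k_csp k D \<R> \<and> set_pmf \<rho> \<subseteq> \<R> \<and> even t \<and> 2 \<le> t \<and> t \<le> k"
    then have D: "finite D" "D \<noteq> {}" and rel: "\<And>R. R \<in> set_pmf \<rho> \<Longrightarrow> R \<subseteq> ({1..k} \<rightarrow>\<^sub>E D)"
      and \<R>: "set_pmf \<rho> \<subseteq> \<R>" and t: "even t" "2 \<le> t" "t \<le> k"
      using assms(2) by (auto simp: k_csp_def)
    \<comment> \<open>Below \<open>n0\<close> the trivial bound 1 is used; finitely many values do
      not affect the limit.\<close>
    define \<delta> where "\<delta> n = (if n < n0 then 1 else 2 ^ (card D ^ k) * 2 ^ k * exp (- real n))" for n
    let ?Bad = "{I. \<not> (\<forall>E. pseudo_distribution (2 * (r + 1 + 2 * k)) (fst I) D E \<longrightarrow>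
                    E (Val k I) \<le> opt t k D \<R> \<rho> + \<gamma>)}"
    have "measure_pmf.prob (random_instance k \<rho> n m) ?Bad \<le> \<delta> n"
      if nm: "k \<le> n" "6 / \<tau>\<^sup>2 * real n ^ (t div 2) \<le> real m" for n m
    proof (cases "n < n0")
      case True
      then show ?thesis by (simp add: \<delta>_def)
    next
      case False
      have n0': "0 < n" using nm assms by simp
      have "measure_pmf.prob (random_instance k \<rho> n m) ?Bad \<le> 2 ^ (card D ^ k) * 2 ^ k * exp (- real n)"
      proof (rule prob_bad_instance_le[OF D t nm(1) rel \<tau>(1) nm(2)])
        fix \<sigma> Rel assume "good_instance k t n m D \<rho> \<sigma> Rel \<tau>"
        then interpret good_instance k t n m D \<rho> \<sigma> Rel \<tau> .
        have small: "258 * \<tau> / \<theta> + (real k ^ 2 / real n + real k * sqrt (2 * \<zeta>)) \<le> \<eta>"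
          using \<tau>(3) kn[of n] sq False n0' by linarith
        have cr: "real (card (set_pmf \<rho>)) \<le> Q"
        proof -
          have "real (card (set_pmf \<rho>)) \<le> real (2 ^ (card D ^ k))" using card_rels by (rule of_nat_mono)
          then show ?thesis by (simp add: Q_def cD)
        qed
        have "E (Val k ({..<n}, mset (map (\<lambda>i. (\<sigma> i, Rel i)) [0..<m]))) \<le> opt t k D \<R> \<rho> + \<gamma>"
          if E: "pseudo_distribution (2 * (r + 1 + 2 * k)) {..<n} D E" for E
        proof -
          have "E (Val k ({..<n}, mset (map (\<lambda>i. (\<sigma> i, Rel i)) [0..<m])))
              \<le> opt t k D \<R> \<rho> + \<gamma> / 4 + real (card (set_pmf \<rho>)) * (\<tau> + \<theta>) + \<zeta>"
            using \<eta> assms(3) \<theta> \<tau> \<zeta> r small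
            by (intro refutation[OF E \<R> repair[OF D(1) cD t(3)]]) auto
          also have "real (card (set_pmf \<rho>)) * (\<tau> + \<theta>) \<le> Q * (\<theta> + \<theta>)"
            using cr \<tau> \<theta> Q by (intro mult_mono) auto
          also have "\<dots> \<le> \<gamma> / 4" using \<theta>(2) by (simp add: algebra_simps)
          finally show ?thesis using \<zeta>(3) assms(3) by simp
        qed
        then show "({..<n}, mset (map (\<lambda>i. (\<sigma> i, Rel i)) [0..<m])) \<notin> ?Bad" by simp
      qed
      with False show ?thesis by (simp add: \<delta>_def)
    qed
    moreover have "\<delta> \<in> o(\<lambda>_. 1)" unfolding \<delta>_def[abs_def] by (rule exp_decay_smallo)
    ultimately show "whp_refuted k D \<R> \<rho> t \<gamma> (2 * (r + 1 + 2 * k)) (6 / \<tau>\<^sup>2)"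
      unfolding whp_refuted_def by blast
  qed
qed

text \<open>No pseudo-distribution exists, so the event misses the support for every
  \<open>c\<close>.\<close>

lemma refutation_empty_domain:
  assumes "1 \<le> k" "k \<le> n"
  shows "measure_pmf.prob (random_instance k \<rho> n m)
    {I. \<not> (\<forall>E. pseudo_distribution 2 (fst I) {} E \<longrightarrow> E (Val k I) \<le> c)} = 0"
proof -
  have "0 \<in> {..<n}" using assms by simp
  then have "\<not> pseudo_distribution 2 {..<n} {} E" for E :: "(nat \<times> 'a) rpoly \<Rightarrow> real"
    using no_pseudo_distribution_empty[of 2 "{..<n}" E 0] by blast
  then have "set_pmf (random_instance k \<rho> n m) \<inter>
      {I. \<not> (\<forall>E. pseudo_distribution 2 (fst I) {} E \<longrightarrow> E (Val k I) \<le> c)} = {}"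
    by (auto simp: random_instance_def)
  then show ?thesis by (simp add: measure_pmf_zero_iff)
qed

theorem theorem4p20:
  shows "\<exists>(K :: nat \<Rightarrow> nat \<Rightarrow> real \<Rightarrow> nat) (C :: nat \<Rightarrow> nat \<Rightarrow> nat \<Rightarrow> real \<Rightarrow> real).
    \<forall>(k :: nat) (D :: 'a set) (\<R> :: (nat \<Rightarrow> 'a) set set) (\<rho> :: (nat \<Rightarrow> 'a) set pmf)
      (t :: nat) (\<gamma> :: real).
      k_csp k D \<R> \<and> set_pmf \<rho> \<subseteq> \<R> \<and> even t \<and> 2 \<le> t \<and> t \<le> k \<and> \<gamma> > 0 \<longrightarrow>
      (\<exists>\<delta> :: nat \<Rightarrow> real. \<delta> \<in> o(\<lambda>_. 1) \<and>
        (\<forall>n m :: nat. k \<le> n \<and> real m \<ge> C k (card D) t \<gamma> * real n ^ (t div 2) \<longrightarrow>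
          measure_pmf.prob (random_instance k \<rho> n m)
            {I. \<not> (\<forall>E. pseudo_distribution (K k (card D) \<gamma>) (fst I) D E \<longrightarrow>
                    E (Val k I) \<le> opt t k D \<R> \<rho> + \<gamma>)} \<le> \<delta> n))"
proof -
  define P where "P k (q::nat) \<gamma> K t C \<longleftrightarrow> (\<forall>(D :: 'a set) \<R> \<rho>. card D = q \<longrightarrow>
      k_csp k D \<R> \<and> set_pmf \<rho> \<subseteq> \<R> \<and> even t \<and> 2 \<le> t \<and> t \<le> k \<longrightarrow>
      whp_refuted k D \<R> \<rho> t \<gamma> K C)"
    for k q \<gamma> K t and C :: real
  \<comment> \<open>\<open>K\<close> is found before \<open>t\<close>, so that it can become a
    function of \<open>k\<close>, \<open>q\<close> and \<gamma> only.\<close>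
  have ex: "\<exists>K. \<forall>t. \<exists>C. 0 < \<gamma> \<longrightarrow> P k q \<gamma> K t C" for k q \<gamma>
  proof (cases "1 \<le> k \<and> 1 \<le> q \<and> 0 < \<gamma>")
    case True
    then have "\<exists>K. \<forall>t. \<exists>C. P k q \<gamma> K t C"
      unfolding P_def by (intro refutation_parameters) auto
    then show ?thesis by blast
  next
    case False
    have "0 < \<gamma> \<longrightarrow> P k q \<gamma> 2 t C" for t C
      unfolding P_def
    proof (intro impI allI)
      fix D :: "'a set" and \<R> and \<rho> :: "(nat \<Rightarrow> 'a) set pmf"
      assume "0 < \<gamma>" "card D = q" and A: "k_csp k D \<R> \<and> set_pmf \<rho> \<subseteq> \<R> \<and> even t \<and> 2 \<le> t \<and> t \<le> k"
      then have k: "1 \<le> k" and "finite D" by (auto simp: k_csp_def)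
      \<comment> \<open>As \<open>k\<close> and \<gamma> are positive, the condition that fails must
        be \<open>1 \<le> q\<close>.\<close>
      moreover have "card D = 0" using False k \<open>0 < \<gamma>\<close> \<open>card D = q\<close> by simp
      ultimately have D: "D = {}" by simp
      show "whp_refuted k D \<R> \<rho> t \<gamma> 2 C"
        unfolding whp_refuted_def D
      proof (intro exI[of _ "\<lambda>_. 0"] conjI allI impI)
        fix n m assume "k \<le> n \<and> C * real n ^ (t div 2) \<le> real m"
        then have "k \<le> n" by simp
        show "measure_pmf.prob (random_instance k \<rho> n m)
            {I. \<not> (\<forall>E. pseudo_distribution 2 (fst I) {} E \<longrightarrow>
                    E (Val k I) \<le> opt t k {} \<R> \<rho> + \<gamma>)} \<le> 0"
          by (simp only: refutation_empty_domain[OF k \<open>k \<le> n\<close>] order_refl)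
      qed simp
    qed
    then show ?thesis by blast
  qed
  \<comment> \<open>Choice turns the nested existence statements into functions that do not see
    \<open>D\<close>, \<R> or \<rho>.\<close>
  define K where "K k q \<gamma> = (SOME K. \<forall>t. \<exists>C. 0 < \<gamma> \<longrightarrow> P k q \<gamma> K t C)" for k q \<gamma>
  have K: "\<forall>t. \<exists>C. 0 < \<gamma> \<longrightarrow> P k q \<gamma> (K k q \<gamma>) t C" for k q \<gamma>
    unfolding K_def by (rule someI_ex[OF ex])
  define C where "C k q t \<gamma> = (SOME C. 0 < \<gamma> \<longrightarrow> P k q \<gamma> (K k q \<gamma>) t C)" for k q t \<gamma>
  have C: "0 < \<gamma> \<longrightarrow> P k q \<gamma> (K k q \<gamma>) t (C k q t \<gamma>)" for k q t \<gamma>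
    unfolding C_def by (rule someI_ex[OF K[THEN spec]])
  have "whp_refuted k D \<R> \<rho> t \<gamma> (K k (card D) \<gamma>) (C k (card D) t \<gamma>)"
    if "k_csp k D \<R> \<and> set_pmf \<rho> \<subseteq> \<R> \<and> even t \<and> 2 \<le> t \<and> t \<le> k \<and> \<gamma> > 0"
    for k t \<gamma> and D :: "'a set" and \<R> \<rho>
    using C[of \<gamma> k "card D" t] that unfolding P_def by blast
  then show ?thesis
    unfolding whp_refuted_def[abs_def] by (intro exI[of _ K] exI[of _ C] allI impI)
qed

end
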